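(* Let $0\le\delta\le 1$ and let $X,X_1,X_2,\dots$ be i.i.d. real random variables with $\mathrm{E}X=0$, $\mathrm{E}X^2=\sigma^2>0$ and partial sums $S_n=\sum_{k=1}^n X_k$, $n\ge 1$. Suppose that $\mathrm{E}|X|^{2+\delta}<\infty$ if $0<\delta\le 1$, and that $\mathrm{E}\big[|X|^2\log(1+|X|)\big]<\infty$ if $\delta=0$. Then $$\lim_{\epsilon\searrow 0}\left[\sum_{n\ge 1}\frac{(\log n)^\delta}{n}\,\mathrm{P}\big(|S_n|\ge \epsilon\sqrt{n\log n}\big)-\frac{\mathrm{E}|N|^{2\delta+2}}{\delta+1}\,\sigma^{2\delta+2}\,\epsilon^{-(2\delta+2)}\right]=\gamma_\delta-\eta_\delta .$$
   Context: Convention: $\log x=\ln(\max\{x,e\})$, where $\ln$ is the natural logarithm (so $\log 1=\log 2=1$). $N$ denotes a standard normal random variable. For $0\le\delta\le1$ define $$\gamma_{n,\delta}:=\sum_{j=1}^n\frac{(\log j)^\delta}{j}-\frac{(\log n)^{\delta+1}}{\delta+1}\quad(n\ge 1),\qquad \gamma_\delta:=\lim_{n\to\infty}\gamma_{n,\delta}$$ (this limit exists), and $$\eta_\delta:=\sum_{n\ge 1}\frac{(\log n)^\delta}{n}\,\mathrm{P}(S_n=0)$$ (this series is finite under the hypotheses of the claim). *)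

theory Defs
  imports "HOL-Probability.Probability"
begin

text \<open>Logarithm truncated from below: \<open>\<ell> x = ln (max {x, e})\<close>, so that \<open>\<ell> x \<ge> 1\<close> for every \<open>x\<close>.
  It replaces the logarithm in every formula below, including those involving \<open>\<gamma>\<close> and \<open>\<eta>\<close>.\<close>

definition trunc_log :: "real \<Rightarrow> real" ("\<ell>") where
  "\<ell> x = ln (max x (exp 1))"

definition gamma_seq :: "real \<Rightarrow> nat \<Rightarrow> real" where
  "gamma_seq \<delta> n =
     (\<Sum>j=1..n. \<ell> (real j) powr \<delta> / real j) - \<ell> (real n) powr (\<delta> + 1) / (\<delta> + 1)"

definition gamma_const :: "real \<Rightarrow> real" where
  "gamma_const \<delta> = lim (gamma_seq \<delta>)"

definition partial_sum :: "(nat \<Rightarrow> 'a \<Rightarrow> real) \<Rightarrow> nat \<Rightarrow> 'a \<Rightarrow> real" where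
  "partial_sum Xs n \<omega> = (\<Sum>k=1..n. Xs k \<omega>)"

text \<open>\<^const>\<open>suminf\<close> and \<^const>\<open>summable\<close> start at index 0. The series here start
  at \<open>n = 1\<close>, so they are summed in the shifted form \<open>\<lambda>n. a (Suc n)\<close>.\<close>

definition eta_term :: "'a measure \<Rightarrow> (nat \<Rightarrow> 'a \<Rightarrow> real) \<Rightarrow> real \<Rightarrow> nat \<Rightarrow> real" where
  "eta_term M Xs \<delta> n =
     \<ell> (real n) powr \<delta> / real n * \<P>(\<omega> in M. partial_sum Xs n \<omega> = 0)"

definition eta_const :: "'a measure \<Rightarrow> (nat \<Rightarrow> 'a \<Rightarrow> real) \<Rightarrow> real \<Rightarrow> real" where
  "eta_const M Xs \<delta> = (\<Sum>n. eta_term M Xs \<delta> (Suc n))"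

definition tail_term :: "'a measure \<Rightarrow> (nat \<Rightarrow> 'a \<Rightarrow> real) \<Rightarrow> real \<Rightarrow> real \<Rightarrow> nat \<Rightarrow> real" where
  "tail_term M Xs \<delta> \<epsilon> n =
     \<ell> (real n) powr \<delta> / real n *
     \<P>(\<omega> in M. \<bar>partial_sum Xs n \<omega>\<bar> \<ge> \<epsilon> * sqrt (real n * \<ell> (real n)))"

end

theory Submission
  imports Defs "HOL-Real_Asymp.Real_Asymp"
begin

text \<open>Write \<open>w n = \<ell>(n)\<^sup>\<delta> / n\<close> for the weights, \<open>N\<close> for a standard normal variable and \<open>\<Phi>\<close> for its
distribution function. The series splits into a Gaussian part and a part that measures the distance
to the Gaussian:
\<open>\<Sum> w n P(|S n| \<ge> \<epsilon> \<surd>(n \<ell> n)) = \<Sum> w n P(\<sigma>|N| \<ge> \<epsilon> \<surd>(\<ell> n)) + \<Sum> w n d n \<epsilon>\<close>.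

\<^emph>\<open>Gaussian part.\<close> Exchanging sum and expectation turns it into \<open>E A(\<sigma>\<^sup>2 N\<^sup>2 / \<epsilon>\<^sup>2)\<close>, where
\<open>A y\<close> is the sum of the weights of all \<open>n\<close> with \<open>\<ell> n \<le> y\<close>. By the definition of \<open>\<gamma>\<close>,
the remainder \<open>A y - y powr (\<delta>+1) / (\<delta>+1)\<close> tends to \<open>\<gamma>\<close> as \<open>y \<rightarrow> \<infinity>\<close>, and it is bounded for \<open>y \<ge> 0\<close>. The
power contributes exactly the term that the theorem subtracts, and by dominated convergence the
expectation of the remainder tends to \<open>\<gamma>\<close> (\<open>weighted_normal_tail_sums\<close>, \<open>expectation_weight_remainder_tendsto\<close>).

\<^emph>\<open>Distance to the Gaussian.\<close> As \<open>\<epsilon>\<close> decreases to \<open>0\<close>, the two probabilities tend to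
\<open>P(S n \<noteq> 0)\<close> and \<open>1\<close>, so each \<open>d n \<epsilon>\<close> tends to \<open>- P(S n = 0)\<close>, and the weighted sum of these
limits is \<open>- \<eta>\<close>. Tannery's theorem allows the passage to the limit once \<open>\<Sum> w n \<Delta> n < \<infinity>\<close>, where \<open>\<Delta> n\<close> is
the Kolmogorov distance between \<open>S n\<close> and the Gaussian of the same variance
(\<open>summable_normal_approximation\<close>).

The bound on \<open>\<Delta> n\<close> comes from Lindeberg's replacement method applied to the smoothed indicators
\<open>\<Phi>((a - x)/h)\<close>. Gaussian smoothing only changes the scale of such a function, so every
replacement error is explicit and the errors telescope (\<open>expectation_Phi_partial_sum\<close>). Removing
the smoothing as in Esseen's inequality leaves, in units of the standard deviation of \<open>S n\<close>, an
error of order \<open>h + L/h\<close> with the Lyapunov ratio \<open>L\<close> of third moments (\<open>desmoothing\<close>). With the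
best \<open>h\<close> this is of order \<open>\<surd>L\<close>, weaker than the Berry--Esseen rate \<open>L\<close>. The loss is made up for by
truncating the summands at \<open>\<surd>(n / \<ell> n)\<close>, slightly below the usual level \<open>\<surd>n\<close>, which lowers the
third moments, and by the choice \<open>h = n\<^sup>-\<^sup>1\<^sup>/\<^sup>2 + \<ell>(n) powr -(3/2 + \<delta>)\<close>. All errors then sum to at most a
constant times \<open>1 + E X\<^sup>2 \<ell>(1 + |X|) powr (1 + 2 \<delta>)\<close>. For \<open>\<delta> = 0\<close> the finiteness of this moment is
the hypothesis itself, and for \<open>\<delta> > 0\<close> it follows from \<open>E|X| powr (2 + \<delta>) < \<infinity>\<close>.\<close>

section \<open>The standard normal distribution function\<close>

abbreviation "\<nu> \<equiv> std_normal_distribution"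

definition \<Phi> :: "real \<Rightarrow> real" where
  "\<Phi> x = measure \<nu> {..x}"

interpretation std_normal: real_distribution \<nu>
  by (rule real_dist_normal_dist)

lemma Phi_bounds: "0 \<le> \<Phi> x" "\<Phi> x \<le> 1"
  by (auto simp: \<Phi>_def)

lemma Phi_mono: "x \<le> y \<Longrightarrow> \<Phi> x \<le> \<Phi> y"
  unfolding \<Phi>_def by (intro std_normal.finite_measure_mono) auto

lemma Phi_measurable [measurable]: "\<Phi> \<in> borel_measurable borel"
  by (rule borel_measurable_mono) (auto simp: mono_def Phi_mono)

lemma Phi_diff:
  assumes "a \<le> b"
  shows "(std_normal_density has_integral (\<Phi> b - \<Phi> a)) {a..b}"
proof -
  have "\<Phi> b - \<Phi> a = measure \<nu> {a<..b}"
    unfolding \<Phi>_def using assms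
    by (subst std_normal.finite_measure_Diff[symmetric]) (auto intro!: arg_cong[where f = "measure \<nu>"])
  also have "\<dots> = integral\<^sup>L lborel (\<lambda>x. indicator {a<..b} x * std_normal_density x)"
    using integral_density[of "indicator {a<..b} :: real \<Rightarrow> real" lborel std_normal_density]
    by (simp add: mult.commute)
  also have "\<dots> = integral\<^sup>L lborel (\<lambda>x. indicator {a..b} x * std_normal_density x)"
    by (intro integral_cong_AE AE_I[where N = "{a}"]) (auto simp: indicator_def)
  finally have eq: "\<Phi> b - \<Phi> a = (LINT x:{a..b}|lborel. std_normal_density x)"
    by (simp add: set_lebesgue_integral_def)
  have "set_integrable lborel {a..b} std_normal_density"
    by (rule set_integrable_subset[of lborel UNIV]) (auto simp: set_integrable_def)
  then have "(std_normal_density has_integral (LINT x:{a..b}|lborel. std_normal_density x)) {a..b}"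
    using set_borel_integral_eq_integral[of "{a..b}" std_normal_density] by (simp add: integrable_integral)
  with eq show ?thesis by simp
qed

lemma continuous_std_normal_density: "continuous_on A std_normal_density"
  unfolding std_normal_density_def by (intro continuous_intros) auto

lemma Phi_has_derivative: "(\<Phi> has_real_derivative std_normal_density x) (at x)"
proof -
  have "((\<lambda>u. integral {x - 1..u} std_normal_density) has_real_derivative std_normal_density x) 
          (at x within {x - 1..x + 1})"
    by (rule integral_has_real_derivative) (auto intro: continuous_std_normal_density)
  from DERIV_add[OF this DERIV_const[of "\<Phi> (x - 1)"]]
  have "(\<Phi> has_real_derivative std_normal_density x) (at x within {x - 1..x + 1})"
  proof (rule has_field_derivative_transform_within[where d = 1, THEN DERIV_cong])
    fix u assume "u \<in> {x - 1..x + 1}"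
    then show "integral {x - 1..u} std_normal_density + \<Phi> (x - 1) = \<Phi> u"
      using integral_unique[OF Phi_diff[of "x - 1" u]] by simp
  qed auto
  moreover have "at x within {x - 1..x + 1} = at x"
    by (rule at_within_interior) simp
  ultimately show ?thesis by simp
qed

lemma std_normal_density_has_derivative:
  "(std_normal_density has_real_derivative (- x * std_normal_density x)) (at x)"
  unfolding std_normal_density_def
  by (auto intro!: derivative_eq_intros simp: field_simps)

lemma std_normal_density_le: "std_normal_density x \<le> exp (- x\<^sup>2 / 2)"
proof -
  have "1 \<le> sqrt (2 * pi)" using pi_ge_two by (intro real_le_rsqrt) auto
  then have "1 / sqrt (2 * pi) \<le> 1" by simp
  then show ?thesis unfolding std_normal_density_def
    using mult_right_mono[of "1 / sqrt (2 * pi)" 1 "exp (- x\<^sup>2 / 2)"] by simp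
qed

lemma std_normal_density_le_1: "std_normal_density x \<le> 1"
  using std_normal_density_le[of x] by (rule order_trans) auto

lemma abs_mult_std_normal_density_le_1: "\<bar>x\<bar> * std_normal_density x \<le> 1"
proof -
  have "\<bar>x\<bar> \<le> 1 + x\<^sup>2 / 2" 
    using zero_le_power2[of "\<bar>x\<bar> - 1"] by (simp add: power2_eq_square algebra_simps)
  also have "\<dots> \<le> exp (x\<^sup>2 / 2)" by (rule exp_ge_add_one_self)
  finally have "\<bar>x\<bar> * exp (- x\<^sup>2 / 2) \<le> exp (x\<^sup>2 / 2) * exp (- x\<^sup>2 / 2)" 
    by (intro mult_right_mono) auto
  also have "\<dots> = 1" by (simp flip: exp_add)
  finally show ?thesis
    using mult_left_mono[OF std_normal_density_le[of x], of "\<bar>x\<bar>"] by linarith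
qed

lemma abs_square_mult_std_normal_density_le_1: "\<bar>x\<^sup>2 - 1\<bar> * std_normal_density x \<le> 1"
proof -
  have "\<bar>x\<^sup>2 - 1\<bar> \<le> 1 + x\<^sup>2 / 2 + (x\<^sup>2/2)\<^sup>2/2" 
  proof -
    have "x\<^sup>2 \<le> 2 + x\<^sup>2 / 2 + (x\<^sup>2/2)\<^sup>2/2"
      using zero_le_power2[of "x\<^sup>2/2 - 1"] by (simp add: power2_eq_square algebra_simps)
    moreover have "0 \<le> x\<^sup>2" "0 \<le> (x\<^sup>2/2)\<^sup>2" by auto
    ultimately show ?thesis by linarith
  qed
  also have "\<dots> \<le> exp (x\<^sup>2 / 2)" 
    using exp_lower_Taylor_quadratic[of "x\<^sup>2/2"] by simp
  finally have "\<bar>x\<^sup>2 - 1\<bar> * exp (- x\<^sup>2 / 2) \<le> exp (x\<^sup>2 / 2) * exp (- x\<^sup>2 / 2)" 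
    by (intro mult_right_mono) auto
  also have "\<dots> = 1" by (simp flip: exp_add)
  finally show ?thesis
    using mult_left_mono[OF std_normal_density_le[of x], of "\<bar>x\<^sup>2 - 1\<bar>"] by linarith
qed

text \<open>The third derivative \<open>(t\<^sup>2 - 1) \<phi>(t)\<close> of \<open>\<Phi>\<close> is bounded by \<open>1\<close>, so this is Taylor's formula
with the Lagrange remainder.\<close>

lemma Phi_Taylor:
  "\<bar>\<Phi> (u + w) - \<Phi> u - std_normal_density u * w + u * std_normal_density u * w\<^sup>2 / 2\<bar> \<le> \<bar>w\<bar> ^ 3 / 6"
proof (cases "w = 0")
  case False
  define d where "d m = (if m = 0 then \<Phi> else if m = 1 then std_normal_density 
     else if m = 2 then (\<lambda>x. - x * std_normal_density x) 
     else (\<lambda>x. (x\<^sup>2 - 1) * std_normal_density x))" for m :: nat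
  have D: "(d m has_real_derivative d (Suc m) t) (at t)" if "m < 3" for m t
  proof -
    consider "m = 0" | "m = 1" | "m = 2" using \<open>m < 3\<close> by linarith
    then show ?thesis
    proof cases
      case 3
      show ?thesis unfolding 3 d_def
        by (auto intro!: derivative_eq_intros std_normal_density_has_derivative simp: algebra_simps power2_eq_square)
    next
      case 1
      show ?thesis unfolding 1 d_def using Phi_has_derivative by simp
    next
      case 2
      show ?thesis unfolding 2 d_def using std_normal_density_has_derivative by simp
    qed
  qed
  have d0: "d 0 = \<Phi>" "d (Suc 0) = std_normal_density" "d 2 = (\<lambda>x. - x * std_normal_density x)"
     "d 3 = (\<lambda>x. (x\<^sup>2 - 1) * std_normal_density x)"
    by (simp_all add: d_def)
  have S: "(\<Sum>m<3. f m) = f 0 + f 1 + f 2" for f :: "nat \<Rightarrow> real"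
    by (simp add: eval_nat_numeral)
  have "\<exists>t. (if u + w < u then u + w < t \<and> t < u else u < t \<and> t < u + w) \<and>
     \<Phi> (u + w) = (\<Sum>m<3. d m u / fact m * (u + w - u) ^ m) + d 3 t / fact 3 * (u + w - u) ^ 3"
    using False D by (intro Taylor[of 3 d \<Phi> "u - \<bar>w\<bar>" "u + \<bar>w\<bar>"]) (simp_all add: d0)
  then obtain t where "\<Phi> (u + w) = (\<Sum>m<3. d m u / fact m * w ^ m) + d 3 t / fact 3 * w ^ 3"
    by auto
  then have "\<Phi> (u + w) - \<Phi> u - std_normal_density u * w + u * std_normal_density u * w\<^sup>2 / 2
     = (t\<^sup>2 - 1) * std_normal_density t * w ^ 3 / 6"
    by (simp add: S d0 fact_numeral)
  also have "\<bar>\<dots>\<bar> = (\<bar>t\<^sup>2 - 1\<bar> * std_normal_density t) * \<bar>w\<bar> ^ 3 / 6"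
    by (simp add: abs_mult power_abs)
  also have "\<dots> \<le> 1 * \<bar>w\<bar> ^ 3 / 6"
    by (intro divide_right_mono mult_right_mono abs_square_mult_std_normal_density_le_1) auto
  finally show ?thesis by simp
qed auto

lemma Phi_Lipschitz: "\<bar>\<Phi> x - \<Phi> y\<bar> \<le> \<bar>x - y\<bar>"
proof -
  have *: "\<Phi> b - \<Phi> a \<le> b - a" if "a \<le> b" for a b
    using has_integral_le[OF Phi_diff[OF that] has_integral_const_real[of 1 a b]] 
      std_normal_density_le_1 that by auto
  show ?thesis
    using *[of x y] *[of y x] Phi_mono[of x y] Phi_mono[of y x] by (cases "x \<le> y") auto
qed

text \<open>This compares Gaussians of different variances. For \<open>l \<ge> 1\<close> the derivative \<open>u \<phi>(l u)\<close> of
\<open>l \<mapsto> \<Phi>(l u)\<close> is at most \<open>|l u| \<phi>(l u) \<le> 1\<close> in absolute value, uniformly in \<open>u\<close>.\<close>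

lemma Phi_scale_diff:
  assumes "1 \<le> r"
  shows "\<bar>\<Phi> (r * u) - \<Phi> u\<bar> \<le> r - 1"
proof (cases "u = 0 \<or> r = 1")
  case False
  then have u: "u \<noteq> 0" and r: "1 < r" using assms by auto
  have "\<exists>l. 1 < l \<and> l < r \<and> \<Phi> (r * u) - \<Phi> (1 * u) = (r - 1) * (u * std_normal_density (l * u))"
    by (rule MVT2[OF r]) (auto intro!: DERIV_chain2[OF Phi_has_derivative, THEN DERIV_cong] derivative_eq_intros)
  then obtain l where l: "1 < l" "\<Phi> (r * u) - \<Phi> u = (r - 1) * (u * std_normal_density (l * u))"
    by auto
  have "\<bar>u\<bar> * std_normal_density (l * u) \<le> \<bar>l * u\<bar> * std_normal_density (l * u)"
    using l u by (intro mult_right_mono) (auto simp: abs_mult)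
  also have "\<dots> \<le> 1" by (rule abs_mult_std_normal_density_le_1)
  finally have "\<bar>\<Phi> (r * u) - \<Phi> u\<bar> \<le> (r - 1) * 1"
    unfolding l(2) abs_mult using r by (intro mult_mono) auto
  then show ?thesis by simp
qed (use assms in auto)

lemma distr_std_normal_scale:
  assumes "0 < s"
  shows "distr \<nu> borel (\<lambda>z. s * z) = density lborel (normal_density 0 s)"
proof -
  have "distributed \<nu> lborel (\<lambda>x. x) std_normal_density"
    unfolding distributed_def by (auto simp: distr_id2)
  from std_normal.normal_density_affine[OF this, of s 0] assms
  have "distr \<nu> lborel (\<lambda>z. s * z) = density lborel (normal_density 0 s)"
    unfolding distributed_def by auto
  moreover have "distr \<nu> lborel (\<lambda>z. s * z) = distr \<nu> borel (\<lambda>z. s * z)" 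
    by (rule distr_cong) auto
  ultimately show ?thesis by simp
qed

lemma emeasure_normal_atMost:
  assumes "0 < s"
  shows "emeasure (density lborel (normal_density 0 s)) {..a} = \<Phi> (a / s)"
proof -
  have "emeasure (density lborel (normal_density 0 s)) {..a} = emeasure \<nu> ((\<lambda>z. s * z) -` {..a} \<inter> space \<nu>)"
    by (subst distr_std_normal_scale[OF assms, symmetric], subst emeasure_distr) auto
  also have "(\<lambda>z. s * z) -` {..a} \<inter> space \<nu> = {..a / s}"
    using assms by (auto simp: field_simps)
  finally show ?thesis by (simp add: \<Phi>_def std_normal.emeasure_eq_measure)
qed

text \<open>The integrand is \<open>P(s W + t z \<le> a)\<close> for a standard normal \<open>W\<close>, so the integral is the distribution
function of a sum of two independent Gaussians, whose variances add. Smoothed indicators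
\<open>\<Phi>((a - x)/s)\<close> are thus closed under Gaussian averaging, which only increases the scale \<open>s\<close>.\<close>

lemma integral_Phi_normal:
  assumes "0 < s" "0 \<le> t"
  shows "(\<integral>z. \<Phi> ((a - t * z) / s) \<partial>\<nu>) = \<Phi> (a / sqrt (s\<^sup>2 + t\<^sup>2))"
proof (cases "t = 0")
  case True
  then show ?thesis using assms std_normal.prob_space by simp
next
  case False
  then have t: "0 < t" using assms by simp
  let ?G = "\<lambda>s. density lborel (\<lambda>x. ennreal (normal_density 0 s x))"
  have fin: "finite_measure (?G s)" "finite_measure (?G t)"
    using prob_space_normal_density[of s 0] prob_space_normal_density[of t 0] assms t
    by (auto simp: prob_space_def)
  have "?G s \<star> ?G t = density lborel (\<lambda>x. \<integral>\<^sup>+y. ennreal (normal_density 0 s (x - y)) * ennreal (normal_density 0 t y) \<partial>lborel)"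
    using fin by (intro convolution_density) auto
  also have "\<dots> = ?G (sqrt (s\<^sup>2 + t\<^sup>2))"
    using conv_normal_density_zero_mean[of s t] assms t by (simp add: ennreal_mult fun_eq_iff)
  finally have "ennreal (\<Phi> (a / sqrt (s\<^sup>2 + t\<^sup>2))) = emeasure (?G t \<star> ?G s) {..a}"
    using emeasure_normal_atMost[of "sqrt (s\<^sup>2 + t\<^sup>2)" a] t fin
    by (subst convolution_commutative) (auto simp: sum_power2_gt_zero_iff)
  also have "\<dots> = (\<integral>\<^sup>+x. emeasure (?G s) {u. u + x \<in> {..a}} \<partial>?G t)"
    using fin by (intro convolution_emeasure) auto
  also have "\<dots> = (\<integral>\<^sup>+x. ennreal (\<Phi> ((a - x) / s)) \<partial>?G t)"
  proof (rule nn_integral_cong)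
    fix x
    have "{u. u + x \<in> {..a}} = {..a - x}" by auto
    then show "emeasure (?G s) {u. u + x \<in> {..a}} = ennreal (\<Phi> ((a - x) / s))"
      using emeasure_normal_atMost[OF assms(1), of "a - x"] by simp
  qed
  also have "\<dots> = (\<integral>\<^sup>+z. ennreal (\<Phi> ((a - t * z) / s)) \<partial>\<nu>)"
    by (subst distr_std_normal_scale[OF t, symmetric], subst nn_integral_distr) auto
  also have "\<dots> = ennreal (\<integral>z. \<Phi> ((a - t * z) / s) \<partial>\<nu>)"
    by (intro nn_integral_eq_integral std_normal.integrable_const_bound[where B = 1]) 
      (auto simp: Phi_bounds)
  finally show ?thesis
    by (subst (asm) ennreal_inj) (auto intro: integral_nonneg simp: Phi_bounds)
qed

section \<open>Replacing summands by Gaussians\<close>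

definition \<kappa> :: real where
  "\<kappa> = (\<integral>z. \<bar>z\<bar> ^ 3 \<partial>\<nu>)"

lemma kappa_nonneg: "0 \<le> \<kappa>"
  unfolding \<kappa>_def by (rule Bochner_Integration.integral_nonneg) auto

lemma integrable_std_normal_abs_power: "integrable \<nu> (\<lambda>z. \<bar>z\<bar> ^ k)"
  using integrable_std_normal_distribution_moment[of k, THEN integrable_abs] by (simp add: power_abs)

lemma (in prob_space) integrable_power_le:
  fixes Y :: "'a \<Rightarrow> real"
  assumes [measurable]: "Y \<in> borel_measurable M" and "integrable M (\<lambda>\<omega>. \<bar>Y \<omega>\<bar> ^ n)" "m \<le> n"
  shows "integrable M (\<lambda>\<omega>. Y \<omega> ^ m)"
proof (rule Bochner_Integration.integrable_bound)
  show "integrable M (\<lambda>\<omega>. 1 + \<bar>Y \<omega>\<bar> ^ n)" using assms by auto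
  show "AE \<omega> in M. norm (Y \<omega> ^ m) \<le> norm (1 + \<bar>Y \<omega>\<bar> ^ n)"
  proof (rule AE_I2)
    fix \<omega>
    have "\<bar>Y \<omega>\<bar> ^ m \<le> 1 + \<bar>Y \<omega>\<bar> ^ n"
    proof (cases "\<bar>Y \<omega>\<bar> \<le> 1")
      case True
      then have "\<bar>Y \<omega>\<bar> ^ m \<le> 1" by (intro power_le_one) auto
      then show ?thesis by (intro order_trans[OF _ le_add_same_cancel1[THEN iffD2]]) auto
    next
      case False
      then have "\<bar>Y \<omega>\<bar> ^ m \<le> \<bar>Y \<omega>\<bar> ^ n" using assms by (intro power_increasing) auto
      then show ?thesis by simp
    qed
    then show "norm (Y \<omega> ^ m) \<le> norm (1 + \<bar>Y \<omega>\<bar> ^ n)"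
      by (simp add: power_abs abs_of_nonneg)
  qed
qed simp

lemma (in prob_space) integrable_Phi [simp]:
  assumes [measurable]: "Y \<in> borel_measurable M"
  shows "integrable M (\<lambda>\<omega>. \<Phi> (Y \<omega>))"
  by (rule integrable_const_bound[where B = 1]) (auto simp: Phi_bounds)

text \<open>Up to an error governed by the third moment, the expectation depends on \<open>Y\<close> through its variance
alone.\<close>

lemma (in prob_space) expectation_Phi_Taylor:
  fixes Y :: "'a \<Rightarrow> real"
  assumes [measurable]: "Y \<in> borel_measurable M" and Y3: "integrable M (\<lambda>\<omega>. \<bar>Y \<omega>\<bar> ^ 3)"
    and EY: "expectation Y = 0" and VY: "expectation (\<lambda>\<omega>. (Y \<omega>)\<^sup>2) = v" and s: "0 < s"
  shows "\<bar>expectation (\<lambda>\<omega>. \<Phi> (u - Y \<omega> / s)) - (\<Phi> u - u * std_normal_density u * v / (2 * s\<^sup>2))\<bar>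
     \<le> expectation (\<lambda>\<omega>. \<bar>Y \<omega>\<bar> ^ 3) / (6 * s ^ 3)"
proof -
  let ?R = "\<lambda>\<omega>. \<Phi> (u - Y \<omega> / s) - \<Phi> u + std_normal_density u / s * Y \<omega> 
     + u * std_normal_density u / (2 * s\<^sup>2) * (Y \<omega>)\<^sup>2"
  have int1: "integrable M Y" using integrable_power_le[OF _ Y3, of 1] by simp
  have int2: "integrable M (\<lambda>\<omega>. (Y \<omega>)\<^sup>2)" using integrable_power_le[OF _ Y3, of 2] by simp
  have "expectation ?R = expectation (\<lambda>\<omega>. \<Phi> (u - Y \<omega> / s)) - \<Phi> u + std_normal_density u / s * expectation Y 
     + u * std_normal_density u / (2 * s\<^sup>2) * expectation (\<lambda>\<omega>. (Y \<omega>)\<^sup>2)"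
    using int1 int2 by (simp add: prob_space)
  also have "\<dots> = expectation (\<lambda>\<omega>. \<Phi> (u - Y \<omega> / s)) - (\<Phi> u - u * std_normal_density u * v / (2 * s\<^sup>2))"
    by (simp add: EY VY)
  finally have eq: "expectation ?R = \<dots>" .
  have "\<bar>expectation ?R\<bar> \<le> expectation (\<lambda>\<omega>. \<bar>?R \<omega>\<bar>)"
    by (rule integral_abs_bound)
  also have "\<dots> \<le> expectation (\<lambda>\<omega>. \<bar>Y \<omega>\<bar> ^ 3 / (6 * s ^ 3))"
  proof (rule integral_mono)
    fix \<omega>
    have "\<bar>?R \<omega>\<bar> \<le> \<bar>- Y \<omega> / s\<bar> ^ 3 / 6"
      using Phi_Taylor[of u "- Y \<omega> / s"] by (simp add: power_divide)
    also have "\<dots> = \<bar>Y \<omega>\<bar> ^ 3 / (6 * s ^ 3)"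
      using s by (simp add: power_divide)
    finally show "\<bar>?R \<omega>\<bar> \<le> \<bar>Y \<omega>\<bar> ^ 3 / (6 * s ^ 3)" .
  qed (use int1 int2 Y3 in auto)
  finally show ?thesis unfolding eq by simp
qed

text \<open>One step of Lindeberg's method: by the preceding expansion, \<open>Y\<close> may be replaced by a Gaussian of the
same mean and variance, and averaging over that Gaussian increases the scale from \<open>s\<close> to
\<open>\<surd>(s\<^sup>2 + v)\<close>.\<close>

lemma (in prob_space) expectation_Phi_swap:
  fixes Y :: "'a \<Rightarrow> real"
  assumes [measurable]: "Y \<in> borel_measurable M" and Y3: "integrable M (\<lambda>\<omega>. \<bar>Y \<omega>\<bar> ^ 3)"
    and EY: "expectation Y = 0" and VY: "expectation (\<lambda>\<omega>. (Y \<omega>)\<^sup>2) = v" and s: "0 < s"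
  shows "\<bar>expectation (\<lambda>\<omega>. \<Phi> ((a - Y \<omega>) / s)) - \<Phi> (a / sqrt (s\<^sup>2 + v))\<bar>
     \<le> (expectation (\<lambda>\<omega>. \<bar>Y \<omega>\<bar> ^ 3) + \<kappa> * sqrt v ^ 3) / (6 * s ^ 3)"
proof -
  let ?N = "\<lambda>z. sqrt v * z"
  have v: "0 \<le> v" unfolding VY[symmetric] by (rule Bochner_Integration.integral_nonneg) auto
  have N3: "(\<lambda>z. \<bar>?N z\<bar> ^ 3) = (\<lambda>z. sqrt v ^ 3 * \<bar>z\<bar> ^ 3)"
    using v by (simp add: abs_mult power_mult_distrib fun_eq_iff)
  define C where "C = \<Phi> (a / s) - a / s * std_normal_density (a / s) * v / (2 * s\<^sup>2)"
  have 1: "\<bar>std_normal.expectation (\<lambda>z. \<Phi> (a / s - ?N z / s)) - C\<bar>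
     \<le> std_normal.expectation (\<lambda>z. \<bar>?N z\<bar> ^ 3) / (6 * s ^ 3)"
    unfolding C_def
  proof (rule std_normal.expectation_Phi_Taylor[OF _ _ _ _ s])
    show "integrable \<nu> (\<lambda>z. \<bar>?N z\<bar> ^ 3)"
      unfolding N3 using integrable_std_normal_abs_power by auto
    show "std_normal.expectation ?N = 0"
      using integral_std_normal_distribution_moment_odd[of 1] by simp
    show "std_normal.expectation (\<lambda>z. (?N z)\<^sup>2) = v"
      using std_normal_distribution_even_moments(1)[of 1] v by (simp add: power_mult_distrib)
  qed simp
  have 2: "std_normal.expectation (\<lambda>z. \<Phi> (a / s - ?N z / s)) = \<Phi> (a / sqrt (s\<^sup>2 + v))"
    using integral_Phi_normal[OF s, of "sqrt v" a] v by (simp add: diff_divide_distrib)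
  have 3: "std_normal.expectation (\<lambda>z. \<bar>?N z\<bar> ^ 3) = \<kappa> * sqrt v ^ 3"
    unfolding N3 \<kappa>_def by simp
  have 4: "\<bar>expectation (\<lambda>\<omega>. \<Phi> (a / s - Y \<omega> / s)) - C\<bar>
     \<le> expectation (\<lambda>\<omega>. \<bar>Y \<omega>\<bar> ^ 3) / (6 * s ^ 3)"
    unfolding C_def using assms by (intro expectation_Phi_Taylor) auto
  show ?thesis
    using 1 4 unfolding 2 3 add_divide_distrib diff_divide_distrib[of a] by linarith
qed

lemma (in prob_space) indep_var_expectation_add:
  fixes f :: "real \<Rightarrow> real"
  assumes ind: "indep_var borel Y borel S" and [measurable]: "f \<in> borel_measurable borel" 
    and bnd: "\<And>x. \<bar>f x\<bar> \<le> c"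
  shows "expectation (\<lambda>\<omega>. f (S \<omega> + Y \<omega>)) = expectation (\<lambda>\<omega>. expectation (\<lambda>\<omega>'. f (S \<omega> + Y \<omega>')))"
proof -
  have [measurable]: "S \<in> borel_measurable M" "Y \<in> borel_measurable M"
    using ind by (auto dest: indep_var_rv1 indep_var_rv2)
  let ?S = "distr M borel S" and ?Y = "distr M borel Y"
  interpret S: prob_space ?S by (rule prob_space_distr) simp
  interpret Y: prob_space ?Y by (rule prob_space_distr) simp
  interpret YS: pair_prob_space ?Y ?S ..
  have "expectation (\<lambda>\<omega>. f (S \<omega> + Y \<omega>)) = (\<integral>(y, x). f (x + y) \<partial>distr M (borel \<Otimes>\<^sub>M borel) (\<lambda>\<omega>. (Y \<omega>, S \<omega>)))"
    by (subst integral_distr) auto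
  also have "\<dots> = (\<integral>(y, x). f (x + y) \<partial>(?Y \<Otimes>\<^sub>M ?S))"
    using ind by (simp add: indep_var_distribution_eq)
  also have "\<dots> = (\<integral>x. (\<integral>y. f (x + y) \<partial>?Y) \<partial>?S)"
    by (rule YS.integral_snd[symmetric]) 
      (auto intro!: YS.P.integrable_const_bound[where B = c] AE_I2 bnd)
  also have "\<dots> = expectation (\<lambda>\<omega>. (\<integral>y. f (S \<omega> + y) \<partial>?Y))"
    by (rule integral_distr) auto
  also have "\<dots> = expectation (\<lambda>\<omega>. expectation (\<lambda>\<omega>'. f (S \<omega> + Y \<omega>')))"
    by (intro Bochner_Integration.integral_cong refl integral_distr) auto
  finally show ?thesis .
qed

text \<open>A replacement at scale \<open>r\<close> costs a multiple of \<open>r\<^sup>-\<^sup>3\<close> and moves the scale to \<open>\<surd>(r\<^sup>2 + v)\<close>. Bounding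
the cost by a difference of inverse scales makes the costs of successive replacements telescope.\<close>

lemma inverse_cube_le_telescope:
  fixes r v :: real
  assumes r: "0 < r" and v: "0 < v" "v \<le> r\<^sup>2"
  shows "v / r ^ 3 \<le> 6 * (1 / r - 1 / sqrt (r\<^sup>2 + v))"
proof -
  define q where "q = sqrt (r\<^sup>2 + v)"
  have q2: "q\<^sup>2 = r\<^sup>2 + v" and q: "r < q"
    unfolding q_def using v r by (auto intro!: real_less_rsqrt)
  \<comment> \<open>The hypothesis \<open>v \<le> r\<^sup>2\<close> keeps two successive scales comparable.\<close>
  have "q\<^sup>2 \<le> (2 * r)\<^sup>2" unfolding q2 using v by (simp add: power_mult_distrib)
  then have q2r: "q \<le> 2 * r" by (rule power2_le_imp_le) (use r in simp)
  have "q * (q + r) \<le> (2 * r) * (2 * r + r)"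
    using q q2r r by (intro mult_mono) auto
  then have "r * (q * (q + r)) \<le> r * (6 * r\<^sup>2)"
    using r by (intro mult_left_mono) (simp_all add: power2_eq_square)
  moreover have "0 < r * (q * (q + r))" using q r by simp
  ultimately have "v / (r * (6 * r\<^sup>2)) \<le> v / (r * (q * (q + r)))"
    using v q r by (intro divide_left_mono mult_pos_pos) ((assumption | linarith | simp)+)
  also have "v / (r * (q * (q + r))) = (q - r) / (r * q)"
  proof -
    have "v = (q - r) * (q + r)" using q2 by (simp add: power2_eq_square algebra_simps)
    then show ?thesis using q r by simp
  qed
  also have "\<dots> = 1 / r - 1 / q" using q r by (simp add: field_simps)
  finally show ?thesis unfolding q_def[symmetric] 
    by (simp add: power3_eq_cube power2_eq_square field_simps)
qed

text \<open>Lindeberg's method: the summands are replaced by Gaussians one at a time, beginning with the last.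
Each Gaussian already inserted increases the scale and so makes the later replacements cheaper. In
total the cost is of order \<open>1/h\<close>, however many summands there are.\<close>

lemma (in prob_space) expectation_Phi_partial_sum:
  fixes Y :: "nat \<Rightarrow> 'a \<Rightarrow> real"
  assumes ind: "indep_vars (\<lambda>_. borel) Y {1..}"
    and Y3: "\<And>k. 1 \<le> k \<Longrightarrow> integrable M (\<lambda>\<omega>. \<bar>Y k \<omega>\<bar> ^ 3)"
    and EY: "\<And>k. 1 \<le> k \<Longrightarrow> expectation (Y k) = 0" 
    and VY: "\<And>k. 1 \<le> k \<Longrightarrow> expectation (\<lambda>\<omega>. (Y k \<omega>)\<^sup>2) = v" 
    and B: "\<And>k. 1 \<le> k \<Longrightarrow> expectation (\<lambda>\<omega>. \<bar>Y k \<omega>\<bar> ^ 3) \<le> \<beta>"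
    and v: "0 < v" "v \<le> h\<^sup>2" and h: "0 < h"
  shows "\<bar>expectation (\<lambda>\<omega>. \<Phi> ((a - (\<Sum>k=1..n. Y k \<omega>)) / h)) - \<Phi> (a / sqrt (h\<^sup>2 + n * v))\<bar>
     \<le> (\<beta> + \<kappa> * sqrt v ^ 3) / v * (1 / h - 1 / sqrt (h\<^sup>2 + n * v))"
  using h v(2)
proof (induction n arbitrary: h)
  case (Suc n)
  have [measurable]: "Y k \<in> borel_measurable M" if "1 \<le> k" for k
    using ind that by (auto simp: indep_vars_def)
  define S where "S \<omega> = (\<Sum>k=1..n. Y k \<omega>)" for \<omega>
  have [measurable]: "S \<in> borel_measurable M" unfolding S_def by measurable
  have Sm: "S \<in> borel_measurable M" and Ym: "Y (Suc n) \<in> borel_measurable M" by measurable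
  have "indep_vars (\<lambda>_. borel) Y (insert (Suc n) {1..n})"
    by (rule indep_vars_subset[OF ind]) auto
  then have indS: "indep_var borel (Y (Suc n)) borel S"
    unfolding S_def by (intro indep_vars_sum) auto
  define h' where "h' = sqrt (h\<^sup>2 + v)"
  have h': "0 < h'" "h'\<^sup>2 = h\<^sup>2 + v" using Suc.prems v by (auto simp: h'_def intro!: add_pos_pos)
  define c where "c = \<beta> + \<kappa> * sqrt v ^ 3"
  have c: "0 \<le> c" 
  proof -
    have "0 \<le> expectation (\<lambda>\<omega>. \<bar>Y 1 \<omega>\<bar> ^ 3)" by (rule Bochner_Integration.integral_nonneg) auto
    also have "\<dots> \<le> \<beta>" by (rule B) simp
    finally show ?thesis unfolding c_def using kappa_nonneg v by simp
  qed
  have X: "c / v / 6 * (6 * x) = c / v * x" for x by simp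
  let ?g = "\<lambda>\<omega>. expectation (\<lambda>\<omega>'. \<Phi> ((a - S \<omega> - Y (Suc n) \<omega>') / h))"
  have "expectation (\<lambda>\<omega>. \<Phi> ((a - (\<Sum>k=1..Suc n. Y k \<omega>)) / h)) = 
      expectation (\<lambda>\<omega>. (\<lambda>x. \<Phi> ((a - x) / h)) (S \<omega> + Y (Suc n) \<omega>))"
    by (simp add: S_def)
  also have "\<dots> = expectation (\<lambda>\<omega>. expectation (\<lambda>\<omega>'. (\<lambda>x. \<Phi> ((a - x) / h)) (S \<omega> + Y (Suc n) \<omega>')))"
    by (rule indep_var_expectation_add[where c = 1]) (auto simp: Phi_bounds indS)
  finally have 1: "expectation (\<lambda>\<omega>. \<Phi> ((a - (\<Sum>k=1..Suc n. Y k \<omega>)) / h)) = expectation ?g"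
    by (simp add: algebra_simps)
  have g: "\<bar>?g \<omega> - \<Phi> ((a - S \<omega>) / h')\<bar> \<le> c / (6 * h ^ 3)" for \<omega>
  proof -
    have "\<bar>?g \<omega> - \<Phi> ((a - S \<omega>) / h')\<bar> \<le> (expectation (\<lambda>\<omega>. \<bar>Y (Suc n) \<omega>\<bar> ^ 3) + \<kappa> * sqrt v ^ 3) / (6 * h ^ 3)"
      unfolding h'_def by (rule expectation_Phi_swap[OF Ym]) (auto simp: Y3 EY VY Suc.prems)
    also have "\<dots> \<le> c / (6 * h ^ 3)"
      unfolding c_def using B[of "Suc n"] Suc.prems by (intro divide_right_mono) auto
    finally show ?thesis .
  qed
  have gint: "integrable M ?g"
  proof (rule integrable_const_bound[where B = 1])
    have "0 \<le> ?g \<omega>" "?g \<omega> \<le> 1" for \<omega>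
      using Ym by (auto intro!: Bochner_Integration.integral_nonneg integral_le_const simp: Phi_bounds)
    then show "AE \<omega> in M. norm (?g \<omega>) \<le> 1" by (intro AE_I2) (simp add: abs_of_nonneg)
  qed (use Sm Ym in measurable)
  have "\<bar>expectation ?g - expectation (\<lambda>\<omega>. \<Phi> ((a - S \<omega>) / h'))\<bar> 
      = \<bar>expectation (\<lambda>\<omega>. ?g \<omega> - \<Phi> ((a - S \<omega>) / h'))\<bar>"
    using gint by simp
  also have "\<dots> \<le> expectation (\<lambda>\<omega>. \<bar>?g \<omega> - \<Phi> ((a - S \<omega>) / h')\<bar>)"
    by (rule integral_abs_bound)
  also have "\<dots> \<le> c / (6 * h ^ 3)"
    using gint by (intro integral_le_const AE_I2 g) auto
  also have "\<dots> = c / v / 6 * (v / h ^ 3)"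
    using v by simp
  also have "\<dots> \<le> c / v / 6 * (6 * (1 / h - 1 / h'))"
    unfolding h'_def using c v Suc.prems by (intro mult_left_mono inverse_cube_le_telescope) auto
  also have "c / v / 6 * (6 * (1 / h - 1 / h')) = c / v * (1 / h - 1 / h')"
    using X .
  finally have 2: "\<bar>expectation ?g - expectation (\<lambda>\<omega>. \<Phi> ((a - S \<omega>) / h'))\<bar> \<le> c / v * (1 / h - 1 / h')" .
  have e: "h'\<^sup>2 + real n * v = h\<^sup>2 + real (Suc n) * v"
    unfolding h'(2) by (simp add: algebra_simps)
  have 3: "\<bar>expectation (\<lambda>\<omega>. \<Phi> ((a - S \<omega>) / h')) - \<Phi> (a / sqrt (h\<^sup>2 + Suc n * v))\<bar> 
     \<le> c / v * (1 / h' - 1 / sqrt (h\<^sup>2 + Suc n * v))"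
  proof -
    have "v \<le> h'\<^sup>2" unfolding h'(2) by simp
    from Suc.IH[OF h'(1) this] show ?thesis unfolding c_def e S_def .
  qed
  show ?case
    unfolding 1 c_def[symmetric] using 2 3 unfolding right_diff_distrib by linarith
qed (simp add: prob_space)

section \<open>Removing the smoothing\<close>

lemma std_normal_central_mass: "3 / 4 \<le> measure \<nu> {z. \<bar>z\<bar> \<le> 2}"
proof -
  have i2: "integrable \<nu> (\<lambda>z. z\<^sup>2)" using integrable_std_normal_distribution_moment[of 2] .
  have "measure \<nu> {z \<in> space \<nu>. 4 \<le> z\<^sup>2} \<le> (\<integral>z. z\<^sup>2 \<partial>\<nu>) / 4"
    using i2 by (intro integral_Markov_inequality_measure[where A = "{}"]) auto
  also have "\<dots> = 1 / 4"
    using std_normal_distribution_even_moments(1)[of 1] by simp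
  finally have 1: "measure \<nu> {z. 4 \<le> z\<^sup>2} \<le> 1 / 4" by simp
  have "1 - measure \<nu> {z. 4 \<le> z\<^sup>2} = measure \<nu> (UNIV - {z. 4 \<le> z\<^sup>2})"
    using std_normal.prob_compl[of "{z. 4 \<le> z\<^sup>2}"] by simp
  also have "\<dots> \<le> measure \<nu> {z. \<bar>z\<bar> \<le> 2}"
  proof (rule std_normal.finite_measure_mono)
    have "\<bar>z\<bar> \<le> 2" if "\<not> 4 \<le> z\<^sup>2" for z :: real
      using that abs_le_square_iff[of z 2] by simp
    then show "UNIV - {z. 4 \<le> z\<^sup>2} \<subseteq> {z. \<bar>z\<bar> \<le> (2 :: real)}" by auto
  qed auto
  finally show ?thesis using 1 by linarith
qed

text \<open>If \<open>K\<close> is at least \<open>d\<close> on the window \<open>a - 2h \<dots> a + 2h\<close>, with \<open>d \<ge> 0\<close>, then its Gaussian average around \<open>a\<close>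
is at least \<open>3/4 d - 1/4 \<Delta>\<close>, because the window carries at least three quarters of the mass and
\<open>K \<ge> - \<Delta>\<close> elsewhere.\<close>

lemma smoothed_lower_bound:
  fixes K :: "real \<Rightarrow> real"
  assumes [measurable]: "K \<in> borel_measurable borel" and bnd: "\<And>x. \<bar>K x\<bar> \<le> \<Delta>"
    and low: "\<And>z. \<bar>z\<bar> \<le> 2 \<Longrightarrow> d \<le> K (a - h * z)"
  shows "d \<le> 4 / 3 * \<bar>\<integral>z. K (a - h * z) \<partial>\<nu>\<bar> + \<Delta> / 3"
proof (cases "d \<le> 0")
  case True
  have "0 \<le> \<Delta>" using bnd[of 0] by linarith
  then show ?thesis using True by auto
next
  case False
  let ?A = "{z :: real. \<bar>z\<bar> \<le> 2}"
  have "0 \<le> \<Delta>" using bnd[of 0] by linarith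
  have A: "?A \<in> sets \<nu>" by measurable
  then have i: "integrable \<nu> (indicator ?A :: real \<Rightarrow> real)"
    by (intro std_normal.integrable_const_bound[where B = 1]) auto
  have "(d + \<Delta>) * measure \<nu> ?A - \<Delta> = (\<integral>z. (d + \<Delta>) * indicator ?A z - \<Delta> \<partial>\<nu>)"
    using std_normal.prob_space A i by (subst Bochner_Integration.integral_diff) simp_all
  also have "\<dots> \<le> (\<integral>z. K (a - h * z) \<partial>\<nu>)"
  proof (rule integral_mono)
    show "integrable \<nu> (\<lambda>z. K (a - h * z))"
      by (rule std_normal.integrable_const_bound[where B = \<Delta>]) (auto simp: bnd)
    show "(d + \<Delta>) * indicator ?A z - \<Delta> \<le> K (a - h * z)" for z
      using low[of z] bnd[of "a - h * z"] by (auto simp: indicator_def)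
  qed (use i in simp)
  finally have 1: "(d + \<Delta>) * measure \<nu> ?A - \<Delta> \<le> \<bar>\<integral>z. K (a - h * z) \<partial>\<nu>\<bar>" by linarith
  have 2: "(d + \<Delta>) * (3 / 4) \<le> (d + \<Delta>) * measure \<nu> ?A"
    using std_normal_central_mass False \<open>0 \<le> \<Delta>\<close> by (intro mult_left_mono) auto
  show ?thesis
    using order_trans[OF diff_right_mono[OF 2] 1] by (simp add: algebra_simps)
qed

text \<open>Both sides are \<open>P(S + h N \<le> a)\<close> for a standard normal \<open>N\<close> independent of \<open>S\<close>.\<close>

lemma (in prob_space) expectation_Phi_eq_smoothed_cdf:
  assumes [measurable]: "S \<in> borel_measurable M" and h: "0 < h"
  shows "expectation (\<lambda>\<omega>. \<Phi> ((a - S \<omega>) / h)) = (\<integral>z. prob {\<omega> \<in> space M. S \<omega> \<le> a - h * z} \<partial>\<nu>)"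
proof -
  interpret P: pair_prob_space M \<nu> ..
  let ?f = "\<lambda>p. indicator {p \<in> space (M \<Otimes>\<^sub>M \<nu>). S (fst p) \<le> a - h * snd p} p :: real"
  have [measurable]: "?f \<in> borel_measurable (M \<Otimes>\<^sub>M \<nu>)" by measurable
  have int: "integrable (M \<Otimes>\<^sub>M \<nu>) ?f"
    by (rule P.integrable_const_bound[where B = 1]) auto
  have "\<Phi> ((a - S \<omega>) / h) = (\<integral>z. ?f (\<omega>, z) \<partial>\<nu>)" if "\<omega> \<in> space M" for \<omega>
  proof -
    have "(\<integral>z. ?f (\<omega>, z) \<partial>\<nu>) = (\<integral>z. indicator {..(a - S \<omega>) / h} z \<partial>\<nu>)"
      using h that by (intro Bochner_Integration.integral_cong) (auto simp: indicator_def space_pair_measure field_simps)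
    then show ?thesis by (simp add: \<Phi>_def)
  qed
  then have "expectation (\<lambda>\<omega>. \<Phi> ((a - S \<omega>) / h)) = expectation (\<lambda>\<omega>. \<integral>z. ?f (\<omega>, z) \<partial>\<nu>)"
    by (intro Bochner_Integration.integral_cong) auto
  also have "\<dots> = (\<integral>z. expectation (\<lambda>\<omega>. ?f (\<omega>, z)) \<partial>\<nu>)"
    using P.Fubini_integral[of "\<lambda>\<omega> z. ?f (\<omega>, z)"] int by (simp add: case_prod_beta')
  also have "\<dots> = (\<integral>z. prob {\<omega> \<in> space M. S \<omega> \<le> a - h * z} \<partial>\<nu>)"
  proof (intro Bochner_Integration.integral_cong refl)
    fix z
    have "expectation (\<lambda>\<omega>. ?f (\<omega>, z)) = expectation (indicator {\<omega> \<in> space M. S \<omega> \<le> a - h * z})"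
      by (intro Bochner_Integration.integral_cong) (auto simp: indicator_def space_pair_measure)
    then show "expectation (\<lambda>\<omega>. ?f (\<omega>, z)) = prob {\<omega> \<in> space M. S \<omega> \<le> a - h * z}" by simp
  qed
  finally show ?thesis .
qed

text \<open>Esseen's argument for removing the smoothing. Let \<open>H\<close> be the difference of the two distribution
functions and \<open>\<Delta>\<close> the supremum of \<open>|H|\<close>. One distribution function is monotone and the other is
Lipschitz, so a large value of \<open>H\<close> at \<open>x\<close> persists, up to \<open>4 h / t\<close>, on a window of length \<open>4 h\<close> to
the right of \<open>x\<close> (to the left for \<open>- H\<close>). The Gaussian average of \<open>H\<close> around the centre of the window is at
most \<open>D\<close> in absolute value, which bounds \<open>\<Delta>\<close> in terms of \<open>h\<close>, \<open>D\<close> and \<open>\<Delta>/3\<close>; the last term can be absorbed.\<close>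

lemma (in prob_space) desmoothing:
  assumes [measurable]: "S \<in> borel_measurable M" and h: "0 < h" and t: "0 < t"
    and D: "\<And>a. \<bar>expectation (\<lambda>\<omega>. \<Phi> ((a - S \<omega>) / h)) - \<Phi> (a / sqrt (h\<^sup>2 + t\<^sup>2))\<bar> \<le> D"
  shows "\<bar>prob {\<omega> \<in> space M. S \<omega> \<le> x} - \<Phi> (x / t)\<bar> \<le> 6 * h / t + 2 * D"
proof -
  define F where "F x = prob {\<omega> \<in> space M. S \<omega> \<le> x}" for x
  define H where "H x = F x - \<Phi> (x / t)" for x
  have F_mono: "F x \<le> F y" if "x \<le> y" for x y
    unfolding F_def using that by (intro finite_measure_mono) auto
  have [measurable]: "F \<in> borel_measurable borel"
    by (rule borel_measurable_mono) (auto simp: mono_def F_mono)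
  then have [measurable]: "H \<in> borel_measurable borel" unfolding H_def by measurable
  have F01: "0 \<le> F x" "F x \<le> 1" for x by (auto simp: F_def)
  have H1: "\<bar>H x\<bar> \<le> 1" for x
    using F01[of x] Phi_bounds[of "x / t"] by (auto simp: H_def)
  have smooth: "\<bar>\<integral>z. H (a - h * z) \<partial>\<nu>\<bar> \<le> D" for a
  proof -
    have "(\<integral>z. H (a - h * z) \<partial>\<nu>) = (\<integral>z. F (a - h * z) \<partial>\<nu>) - (\<integral>z. \<Phi> ((a - h * z) / t) \<partial>\<nu>)"
      unfolding H_def
      by (intro Bochner_Integration.integral_diff std_normal.integrable_const_bound[where B = 1])
        (auto simp: F01 Phi_bounds)
    also have "(\<integral>z. F (a - h * z) \<partial>\<nu>) = expectation (\<lambda>\<omega>. \<Phi> ((a - S \<omega>) / h))"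
      unfolding F_def by (rule expectation_Phi_eq_smoothed_cdf[symmetric]) (use h in auto)
    also have "(\<integral>z. \<Phi> ((a - h * z) / t) \<partial>\<nu>) = \<Phi> (a / sqrt (h\<^sup>2 + t\<^sup>2))"
      using integral_Phi_normal[OF t, of h a] h by (simp add: add.commute)
    finally show ?thesis using D[of a] by simp
  qed
  define \<Delta> where "\<Delta> = (SUP x. \<bar>H x\<bar>)"
  have bdd: "bdd_above (range (\<lambda>x. \<bar>H x\<bar>))" using H1 by (auto intro!: bdd_aboveI)
  have \<Delta>: "\<bar>H x\<bar> \<le> \<Delta>" for x
    unfolding \<Delta>_def by (rule cSUP_upper[OF _ bdd]) simp
  have Lip: "\<bar>\<Phi> (x / t) - \<Phi> (y / t)\<bar> \<le> \<bar>x - y\<bar> / t" for x y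
    using Phi_Lipschitz[of "x / t" "y / t"] t by (simp flip: diff_divide_distrib)
  have "\<bar>H x\<bar> \<le> 4 * h / t + (4 / 3 * D + \<Delta> / 3)" for x
  proof (rule abs_leI)
    have "H x - 4 * h / t \<le> 4 / 3 * \<bar>\<integral>z. H ((x + 2 * h) - h * z) \<partial>\<nu>\<bar> + \<Delta> / 3"
    proof (rule smoothed_lower_bound[OF _ \<Delta>])
      fix z :: real assume z: "\<bar>z\<bar> \<le> 2"
      then have y: "x \<le> (x + 2 * h) - h * z" "\<bar>((x + 2 * h) - h * z) - x\<bar> \<le> 4 * h"
        using h mult_left_mono[of z 2 h] mult_left_mono[of "-2" z h] by (auto simp: abs_le_iff)
      have "\<bar>((x + 2 * h) - h * z) - x\<bar> / t \<le> 4 * h / t"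
        using y t by (intro divide_right_mono) auto
      then show "H x - 4 * h / t \<le> H ((x + 2 * h) - h * z)"
        using F_mono[OF y(1)] Lip[of "(x + 2 * h) - h * z" x] unfolding H_def by linarith
    qed simp
    then show "H x \<le> 4 * h / t + (4 / 3 * D + \<Delta> / 3)" using smooth[of "x + 2 * h"] by linarith
  next
    have "- H x - 4 * h / t \<le> 4 / 3 * \<bar>\<integral>z. - H ((x - 2 * h) - h * z) \<partial>\<nu>\<bar> + \<Delta> / 3"
    proof (rule smoothed_lower_bound)
      fix z :: real assume z: "\<bar>z\<bar> \<le> 2"
      then have y: "(x - 2 * h) - h * z \<le> x" "\<bar>((x - 2 * h) - h * z) - x\<bar> \<le> 4 * h"
        using h mult_left_mono[of z 2 h] mult_left_mono[of "-2" z h] by (auto simp: abs_le_iff)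
      have "\<bar>((x - 2 * h) - h * z) - x\<bar> / t \<le> 4 * h / t"
        using y t by (intro divide_right_mono) auto
      then show "- H x - 4 * h / t \<le> - H ((x - 2 * h) - h * z)"
        using F_mono[OF y(1)] Lip[of "(x - 2 * h) - h * z" x] unfolding H_def by linarith
    qed (use \<Delta> in auto)
    then show "- H x \<le> 4 * h / t + (4 / 3 * D + \<Delta> / 3)" using smooth[of "x - 2 * h"] by simp
  qed
  then have "\<Delta> \<le> 4 * h / t + (4 / 3 * D + \<Delta> / 3)"
    unfolding \<Delta>_def by (intro cSUP_least) auto
  then show ?thesis using \<Delta>[of x] unfolding H_def F_def by linarith
qed

text \<open>The two errors are the width of the smoothing and the cost of the replacements. The scale \<open>h\<close> is left
free: the application balances them with a deterministic choice.\<close>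

lemma (in prob_space) normal_approximation_third_moment:
  fixes Y :: "nat \<Rightarrow> 'a \<Rightarrow> real"
  assumes ind: "indep_vars (\<lambda>_. borel) Y {1..}"
    and Y3: "\<And>k. 1 \<le> k \<Longrightarrow> integrable M (\<lambda>\<omega>. \<bar>Y k \<omega>\<bar> ^ 3)"
    and EY: "\<And>k. 1 \<le> k \<Longrightarrow> expectation (Y k) = 0" 
    and VY: "\<And>k. 1 \<le> k \<Longrightarrow> expectation (\<lambda>\<omega>. (Y k \<omega>)\<^sup>2) = v" 
    and B: "\<And>k. 1 \<le> k \<Longrightarrow> expectation (\<lambda>\<omega>. \<bar>Y k \<omega>\<bar> ^ 3) \<le> \<beta>"
    and v: "0 < v" "v \<le> h\<^sup>2" and h: "0 < h" and n: "1 \<le> n"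
  shows "\<bar>prob {\<omega> \<in> space M. (\<Sum>k=1..n. Y k \<omega>) \<le> x} - \<Phi> (x / sqrt (n * v))\<bar>
     \<le> 6 * h / sqrt (n * v) + 2 * (\<beta> + \<kappa> * sqrt v ^ 3) / (v * h)"
proof -
  have [measurable]: "Y k \<in> borel_measurable M" if "1 \<le> k" for k
    using ind that by (auto simp: indep_vars_def)
  have "0 \<le> expectation (\<lambda>\<omega>. \<bar>Y 1 \<omega>\<bar> ^ 3)" by (rule Bochner_Integration.integral_nonneg) auto
  also have "\<dots> \<le> \<beta>" by (rule B) simp
  finally have c: "0 \<le> \<beta> + \<kappa> * sqrt v ^ 3" using kappa_nonneg v by simp
  have "\<bar>prob {\<omega> \<in> space M. (\<Sum>k=1..n. Y k \<omega>) \<le> x} - \<Phi> (x / sqrt (n * v))\<bar>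
     \<le> 6 * h / sqrt (n * v) + 2 * ((\<beta> + \<kappa> * sqrt v ^ 3) / v * (1 / h))"
  proof (rule desmoothing[OF _ h])
    fix a
    have "\<bar>expectation (\<lambda>\<omega>. \<Phi> ((a - (\<Sum>k=1..n. Y k \<omega>)) / h)) - \<Phi> (a / sqrt (h\<^sup>2 + n * v))\<bar>
     \<le> (\<beta> + \<kappa> * sqrt v ^ 3) / v * (1 / h - 1 / sqrt (h\<^sup>2 + n * v))"
      by (rule expectation_Phi_partial_sum) (use assms in auto)
    also have "\<dots> \<le> (\<beta> + \<kappa> * sqrt v ^ 3) / v * (1 / h)"
      using c v h by (intro mult_left_mono) auto
    finally show "\<bar>expectation (\<lambda>\<omega>. \<Phi> ((a - (\<Sum>k=1..n. Y k \<omega>)) / h)) - \<Phi> (a / sqrt (h\<^sup>2 + (sqrt (n * v))\<^sup>2))\<bar>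
      \<le> (\<beta> + \<kappa> * sqrt v ^ 3) / v * (1 / h)"
      using v by simp
  qed (use n v in auto)
  then show ?thesis by simp
qed

section \<open>Truncation of the summands\<close>

lemma (in prob_space) expectation_square_ge:
  fixes Z :: "'a \<Rightarrow> real"
  assumes [measurable]: "Z \<in> borel_measurable M" and "integrable M (\<lambda>\<omega>. (Z \<omega>)\<^sup>2)"
  shows "(expectation Z)\<^sup>2 \<le> expectation (\<lambda>\<omega>. (Z \<omega>)\<^sup>2)"
proof -
  have "integrable M Z" using assms by (rule square_integrable_imp_integrable)
  then have "variance Z = expectation (\<lambda>\<omega>. (Z \<omega>)\<^sup>2) - (expectation Z)\<^sup>2"
    using assms by (intro variance_eq) auto
  moreover have "0 \<le> variance Z" by (rule variance_positive)
  ultimately show ?thesis by linarith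
qed

lemma abs_diff_cube_le:
  fixes a b :: real
  shows "\<bar>a - b\<bar> ^ 3 \<le> 4 * \<bar>a\<bar> ^ 3 + 4 * \<bar>b\<bar> ^ 3"
proof -
  have "\<bar>a - b\<bar> ^ 3 \<le> (\<bar>a\<bar> + \<bar>b\<bar>) ^ 3" by (intro power_mono) auto
  also have "\<dots> = 4 * \<bar>a\<bar> ^ 3 + 4 * \<bar>b\<bar> ^ 3 - 3 * ((\<bar>a\<bar> + \<bar>b\<bar>) * (\<bar>a\<bar> - \<bar>b\<bar>)\<^sup>2)"
    by (simp add: power3_eq_cube power2_eq_square algebra_simps)
  also have "\<dots> \<le> 4 * \<bar>a\<bar> ^ 3 + 4 * \<bar>b\<bar> ^ 3"
    by (simp add: mult_nonneg_nonneg)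
  finally show ?thesis .
qed

lemma (in prob_space) expectation_eq_of_distr_eq:
  fixes f :: "real \<Rightarrow> real"
  assumes [measurable]: "X \<in> borel_measurable M" "Y \<in> borel_measurable M" "f \<in> borel_measurable borel"
    and "distr M borel Y = distr M borel X"
  shows "expectation (\<lambda>\<omega>. f (Y \<omega>)) = expectation (\<lambda>\<omega>. f (X \<omega>))"
proof -
  have "expectation (\<lambda>\<omega>. f (Y \<omega>)) = (\<integral>x. f x \<partial>distr M borel Y)" by (rule integral_distr[symmetric]) auto
  also have "\<dots> = expectation (\<lambda>\<omega>. f (X \<omega>))" unfolding assms(4) by (rule integral_distr) auto
  finally show ?thesis .
qed

text \<open>The summands are truncated at level \<open>b\<close> and centred. In the order of the right-hand side, the errors
come from the event that the truncation changes some summand, from the shift of the mean, from the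
loss of variance, from the width \<open>h\<close> of the smoothing, and from the replacement of the truncated
summands by Gaussians.\<close>

lemma (in prob_space) normal_approximation_truncated:
  fixes Xs :: "nat \<Rightarrow> 'a \<Rightarrow> real" and X :: "'a \<Rightarrow> real"
  assumes Xm [measurable]: "X \<in> borel_measurable M"
    and ind: "indep_vars (\<lambda>_. borel) Xs {1..}"
    and dist: "\<And>k. k \<ge> 1 \<Longrightarrow> distr M borel (Xs k) = distr M borel X"
    and X1: "integrable M X" and EX: "expectation X = 0"
    and X2: "integrable M (\<lambda>\<omega>. (X \<omega>)\<^sup>2)" and VX: "expectation (\<lambda>\<omega>. (X \<omega>)\<^sup>2) = \<sigma>\<^sup>2" 
    and \<sigma>: "\<sigma> > 0" and b: "0 < b" and h: "\<sigma> \<le> h" and n: "1 \<le> n"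
  shows "\<bar>prob {\<omega> \<in> space M. (\<Sum>k=1..n. Xs k \<omega>) \<le> x} - \<Phi> (x / (\<sigma> * sqrt n))\<bar> \<le>
      real n * expectation (\<lambda>\<omega>. indicator {b<..} \<bar>X \<omega>\<bar>)
      + 2 / \<sigma> * (sqrt n * expectation (\<lambda>\<omega>. \<bar>X \<omega>\<bar> * indicator {b<..} \<bar>X \<omega>\<bar>))
      + 4 / \<sigma>\<^sup>2 * expectation (\<lambda>\<omega>. (X \<omega>)\<^sup>2 * indicator {b<..} \<bar>X \<omega>\<bar>)
      + 12 / \<sigma> * (h / sqrt n)
      + 8 / \<sigma>\<^sup>2 * ((4 * expectation (\<lambda>\<omega>. \<bar>X \<omega>\<bar> ^ 3 * indicator {..b} \<bar>X \<omega>\<bar>) + (4 + \<kappa>) * \<sigma> ^ 3) / h)"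
    (is "\<bar>?P - _\<bar> \<le> real n * ?e0 + 2 / \<sigma> * (sqrt n * ?e1) + 4 / \<sigma>\<^sup>2 * ?\<tau> + 12 / \<sigma> * (h / sqrt n) + 8 / \<sigma>\<^sup>2 * ((4 * ?e3 + _) / h)")
proof -
  have [measurable]: "Xs k \<in> borel_measurable M" if "1 \<le> k" for k
    using ind that by (auto simp: indep_vars_def)
  define T where "T y = y * indicator {..b} \<bar>y\<bar>" for y :: real
  have [measurable]: "T \<in> borel_measurable borel" unfolding T_def by measurable
  have T_bound: "\<bar>T y\<bar> \<le> b" for y using b by (auto simp: T_def indicator_def)
  have T_add: "T y + y * indicator {b<..} \<bar>y\<bar> = y" for y by (auto simp: T_def indicator_def)
  have T2: "(T y)\<^sup>2 = y\<^sup>2 - y\<^sup>2 * indicator {b<..} \<bar>y\<bar>" for y by (auto simp: T_def indicator_def)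
  have tail_sq: "(y * indicator {b<..} \<bar>y\<bar>)\<^sup>2 = y\<^sup>2 * indicator {b<..} \<bar>y\<bar>" for y :: real
    by (auto simp: indicator_def)
  have T3: "\<bar>T y\<bar> ^ 3 = \<bar>y\<bar> ^ 3 * indicator {..b} \<bar>y\<bar>" for y by (auto simp: T_def indicator_def)
  have Tint: "integrable M (\<lambda>\<omega>. T (X \<omega>))"
    by (rule integrable_const_bound[where B = b]) (auto simp: T_bound)
  have T2int: "integrable M (\<lambda>\<omega>. (T (X \<omega>))\<^sup>2)"
    by (rule integrable_const_bound[where B = "b\<^sup>2"]) (use T_bound abs_le_square_iff[of "T _" b] b in auto)
  have T3int: "integrable M (\<lambda>\<omega>. \<bar>T (X \<omega>)\<bar> ^ 3)"
    by (rule integrable_const_bound[where B = "b ^ 3"]) (auto intro!: AE_I2 power_mono T_bound)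
  have tail1: "integrable M (\<lambda>\<omega>. X \<omega> * indicator {b<..} \<bar>X \<omega>\<bar>)"
    by (rule Bochner_Integration.integrable_bound[OF X1]) (auto simp: indicator_def)
  have tail2: "integrable M (\<lambda>\<omega>. (X \<omega>)\<^sup>2 * indicator {b<..} \<bar>X \<omega>\<bar>)"
    by (rule Bochner_Integration.integrable_bound[OF X2]) (auto simp: indicator_def)

  define \<mu> where "\<mu> = expectation (\<lambda>\<omega>. T (X \<omega>))"
  define v where "v = expectation (\<lambda>\<omega>. (T (X \<omega>))\<^sup>2) - \<mu>\<^sup>2"
  \<comment> \<open>As \<open>X\<close> is centred, the truncated mean equals minus the mean of the removed part.\<close>
  have "\<mu> + expectation (\<lambda>\<omega>. X \<omega> * indicator {b<..} \<bar>X \<omega>\<bar>) = expectation (\<lambda>\<omega>. T (X \<omega>) + X \<omega> * indicator {b<..} \<bar>X \<omega>\<bar>)"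
    unfolding \<mu>_def by (rule Bochner_Integration.integral_add[symmetric]) (auto simp: Tint tail1)
  also have "\<dots> = 0" unfolding T_add by (rule EX)
  finally have \<mu>_tail: "\<mu> = - expectation (\<lambda>\<omega>. X \<omega> * indicator {b<..} \<bar>X \<omega>\<bar>)" by simp
  have \<mu>_e1: "\<bar>\<mu>\<bar> \<le> ?e1"
    unfolding \<mu>_tail abs_minus_cancel using integral_abs_bound[of M "\<lambda>\<omega>. X \<omega> * indicator {b<..} \<bar>X \<omega>\<bar>"]
    by (simp add: abs_mult)
  have \<tau>0: "0 \<le> ?\<tau>" by (rule Bochner_Integration.integral_nonneg) auto
  have \<mu>_\<tau>: "\<mu>\<^sup>2 \<le> ?\<tau>"
    using expectation_square_ge[of "\<lambda>\<omega>. X \<omega> * indicator {b<..} \<bar>X \<omega>\<bar>"] tail2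
    unfolding \<mu>_tail power2_minus tail_sq by simp
  have ET2: "expectation (\<lambda>\<omega>. (T (X \<omega>))\<^sup>2) = \<sigma>\<^sup>2 - ?\<tau>"
    unfolding T2 using X2 tail2 by (simp add: VX)
  have v_le: "v \<le> \<sigma>\<^sup>2" and v_ge: "\<sigma>\<^sup>2 - v \<le> 2 * ?\<tau>"
    unfolding v_def ET2 using \<tau>0 \<mu>_\<tau> zero_le_power2[of \<mu>] by linarith+
  have \<mu>_\<sigma>: "\<bar>\<mu>\<bar> \<le> \<sigma>"
  proof -
    have "\<mu>\<^sup>2 \<le> expectation (\<lambda>\<omega>. (T (X \<omega>))\<^sup>2)"
      unfolding \<mu>_def by (rule expectation_square_ge[OF _ T2int]) simp
    also have "\<dots> \<le> \<sigma>\<^sup>2" unfolding ET2 using \<tau>0 by simp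
    finally show ?thesis using abs_le_square_iff[of \<mu> \<sigma>] \<sigma> by simp
  qed
  have nonneg: "0 \<le> ?e0" "0 \<le> ?e1" "0 \<le> ?e3"
    by (auto intro!: Bochner_Integration.integral_nonneg)
  have h0: "0 < h" using h \<sigma> by linarith

  show ?thesis
  proof (cases "v < \<sigma>\<^sup>2 / 4")
    case True
    \<comment> \<open>Here the truncation destroys so much variance that the term for the loss of variance exceeds \<open>1\<close>.\<close>
    then have "\<sigma>\<^sup>2 \<le> 4 * ?\<tau>" using v_ge \<tau>0 by linarith
    then have "1 \<le> 4 / \<sigma>\<^sup>2 * ?\<tau>" using \<sigma> by (simp add: field_simps)
    moreover have "\<bar>?P - \<Phi> (x / (\<sigma> * sqrt n))\<bar> \<le> 1"
      using Phi_bounds[of "x / (\<sigma> * sqrt n)"] measure_nonneg prob_le_1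
      by (smt (verit, best))
    moreover have "0 \<le> real n * ?e0" "0 \<le> 2 / \<sigma> * (sqrt n * ?e1)" "0 \<le> 12 / \<sigma> * (h / sqrt n)"
       "0 \<le> 8 / \<sigma>\<^sup>2 * ((4 * ?e3 + (4 + \<kappa>) * \<sigma> ^ 3) / h)"
      using nonneg \<sigma> h0 kappa_nonneg by simp_all
    ultimately show ?thesis by linarith
  next
    case False
    then have v4: "\<sigma>\<^sup>2 / 4 \<le> v" by simp
    then have v: "0 < v" using \<sigma> zero_less_power2[of \<sigma>] by linarith
    have sv: "\<sigma> / 2 \<le> sqrt v"
      using v4 \<sigma> by (intro real_le_rsqrt) (simp add: power_divide)
    have sv_le: "sqrt v \<le> \<sigma>" using v_le \<sigma> by (intro real_le_lsqrt) auto
    have n0: "0 < sqrt n" using n by simp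
    define Y where "Y k \<omega> = T (Xs k \<omega>) - \<mu>" for k \<omega>
    define \<beta> where "\<beta> = 4 * ?e3 + 4 * \<sigma> ^ 3"
    have Yf: "expectation (\<lambda>\<omega>. f (Y k \<omega>)) = expectation (\<lambda>\<omega>. f (T (X \<omega>) - \<mu>))" 
      if "1 \<le> k" and [measurable]: "f \<in> borel_measurable borel" for k and f :: "real \<Rightarrow> real"
      unfolding Y_def using that
      by (intro expectation_eq_of_distr_eq[where f = "\<lambda>y. f (T y - \<mu>)"] dist) auto
    have approx: "\<bar>prob {\<omega> \<in> space M. (\<Sum>k=1..n. Y k \<omega>) \<le> y} - \<Phi> (y / sqrt (n * v))\<bar>
        \<le> 6 * h / sqrt (n * v) + 2 * (\<beta> + \<kappa> * sqrt v ^ 3) / (v * h)" for y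
    proof (rule normal_approximation_third_moment[OF _ _ _ _ _ v _ h0 n])
      show "indep_vars (\<lambda>_. borel) Y {1..}"
        unfolding Y_def by (rule indep_vars_compose2[OF ind]) auto
      show "v \<le> h\<^sup>2" using v_le power_mono[OF h, of 2] \<sigma> by linarith
      fix k :: nat assume k: "1 \<le> k"
      have [measurable]: "Y k \<in> borel_measurable M" using k unfolding Y_def by measurable
      show "integrable M (\<lambda>\<omega>. \<bar>Y k \<omega>\<bar> ^ 3)"
      proof (rule integrable_const_bound[where B = "(b + \<bar>\<mu>\<bar>) ^ 3"])
        have "\<bar>Y k \<omega>\<bar> \<le> b + \<bar>\<mu>\<bar>" for \<omega> using T_bound[of "Xs k \<omega>"] unfolding Y_def by linarith
        then show "AE \<omega> in M. norm (\<bar>Y k \<omega>\<bar> ^ 3) \<le> (b + \<bar>\<mu>\<bar>) ^ 3" by (auto intro!: AE_I2 power_mono)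
      qed simp
      show "expectation (Y k) = 0"
        using Yf[OF k, of "\<lambda>x. x"] Tint by (simp add: \<mu>_def prob_space)
      have "expectation (\<lambda>\<omega>. (Y k \<omega>)\<^sup>2) = variance (\<lambda>\<omega>. T (X \<omega>))"
        using Yf[OF k, of "\<lambda>x. x\<^sup>2"] by (simp add: \<mu>_def)
      then show "expectation (\<lambda>\<omega>. (Y k \<omega>)\<^sup>2) = v"
        unfolding v_def \<mu>_def using Tint T2int by (simp add: variance_eq)
      have "expectation (\<lambda>\<omega>. \<bar>Y k \<omega>\<bar> ^ 3) = expectation (\<lambda>\<omega>. \<bar>T (X \<omega>) - \<mu>\<bar> ^ 3)"
        using Yf[OF k, of "\<lambda>x. \<bar>x\<bar> ^ 3"] by simp
      also have "\<dots> \<le> expectation (\<lambda>\<omega>. 4 * \<bar>T (X \<omega>)\<bar> ^ 3 + 4 * \<bar>\<mu>\<bar> ^ 3)"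
        by (rule integral_mono_AE') (use T3int abs_diff_cube_le in \<open>auto\<close>)
      also have "\<dots> = 4 * ?e3 + 4 * \<bar>\<mu>\<bar> ^ 3"
        using T3int by (simp add: prob_space T3)
      also have "\<dots> \<le> \<beta>" unfolding \<beta>_def using \<mu>_\<sigma> by (intro add_left_mono mult_left_mono power_mono) auto
      finally show "expectation (\<lambda>\<omega>. \<bar>Y k \<omega>\<bar> ^ 3) \<le> \<beta>" .
    qed
    have approx_bound: "6 * h / sqrt (n * v) + 2 * (\<beta> + \<kappa> * sqrt v ^ 3) / (v * h)
       \<le> 12 / \<sigma> * (h / sqrt n) + 8 / \<sigma>\<^sup>2 * ((4 * ?e3 + (4 + \<kappa>) * \<sigma> ^ 3) / h)"
    proof (rule add_mono)
      have "6 * h / sqrt (n * v) \<le> 6 * h / (sqrt n * (\<sigma> / 2))"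
        unfolding real_sqrt_mult using h0 n0 \<sigma> sv v by (intro divide_left_mono mult_left_mono mult_pos_pos) auto
      then show "6 * h / sqrt (n * v) \<le> 12 / \<sigma> * (h / sqrt n)" by (simp add: field_simps)
      have "\<beta> + \<kappa> * sqrt v ^ 3 \<le> \<beta> + \<kappa> * \<sigma> ^ 3"
        using sv_le v kappa_nonneg by (intro add_left_mono mult_left_mono power_mono) auto
      then have "2 * (\<beta> + \<kappa> * sqrt v ^ 3) / (v * h) \<le> 2 * (\<beta> + \<kappa> * \<sigma> ^ 3) / (\<sigma>\<^sup>2 / 4 * h)"
        using v4 v h0 \<sigma> nonneg kappa_nonneg
        by (intro frac_le mult_right_mono mult_left_mono mult_pos_pos) (auto simp: \<beta>_def)
      also have "\<dots> = 8 / \<sigma>\<^sup>2 * ((4 * ?e3 + (4 + \<kappa>) * \<sigma> ^ 3) / h)"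
      proof -
        have "\<beta> + \<kappa> * \<sigma> ^ 3 = 4 * ?e3 + (4 + \<kappa>) * \<sigma> ^ 3"
          unfolding \<beta>_def by (simp add: algebra_simps)
        then show ?thesis by simp
      qed
      finally show "2 * (\<beta> + \<kappa> * sqrt v ^ 3) / (v * h) \<le> 8 / \<sigma>\<^sup>2 * ((4 * ?e3 + (4 + \<kappa>) * \<sigma> ^ 3) / h)" .
    qed

    define U where "U = (\<Union>k\<in>{1..n}. {\<omega> \<in> space M. b < \<bar>Xs k \<omega>\<bar>})"
    have [measurable]: "U \<in> sets M" unfolding U_def by measurable
    have "prob U \<le> (\<Sum>k=1..n. prob {\<omega> \<in> space M. b < \<bar>Xs k \<omega>\<bar>})"
      unfolding U_def by (rule finite_measure_subadditive_finite) auto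
    also have "\<dots> = (\<Sum>k=1..n. ?e0)"
    proof (rule sum.cong)
      fix k assume k: "k \<in> {1..n}"
      have "prob {\<omega> \<in> space M. b < \<bar>Xs k \<omega>\<bar>} = expectation (indicator {\<omega> \<in> space M. b < \<bar>Xs k \<omega>\<bar>})"
        using k by simp
      also have "\<dots> = expectation (\<lambda>\<omega>. indicator {b<..} \<bar>Xs k \<omega>\<bar>)"
        by (intro Bochner_Integration.integral_cong) (auto simp: indicator_def)
      also have "\<dots> = ?e0"
        using k by (intro expectation_eq_of_distr_eq[where f = "\<lambda>y. indicator {b<..} \<bar>y\<bar>"] dist) auto
      finally show "prob {\<omega> \<in> space M. b < \<bar>Xs k \<omega>\<bar>} = ?e0" .
    qed simp
    finally have PU: "prob U \<le> real n * ?e0" by simp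
    let ?Q = "prob {\<omega> \<in> space M. (\<Sum>k=1..n. T (Xs k \<omega>)) \<le> x}"
    have same: "(\<Sum>k=1..n. T (Xs k \<omega>)) = (\<Sum>k=1..n. Xs k \<omega>)" if "\<omega> \<in> space M" "\<omega> \<notin> U" for \<omega>
      using that by (intro sum.cong) (auto simp: U_def T_def indicator_def not_less)
    have "?P \<le> prob ({\<omega> \<in> space M. (\<Sum>k=1..n. T (Xs k \<omega>)) \<le> x} \<union> U)"
      by (intro finite_measure_mono) (use same in \<open>force, measurable\<close>)
    also have "\<dots> \<le> ?Q + prob U" by (rule measure_Un_le) measurable
    finally have 1: "?P \<le> ?Q + prob U" .
    have "?Q \<le> prob ({\<omega> \<in> space M. (\<Sum>k=1..n. Xs k \<omega>) \<le> x} \<union> U)"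
      by (intro finite_measure_mono) (use same in \<open>force, measurable\<close>)
    also have "\<dots> \<le> ?P + prob U" by (rule measure_Un_le) measurable
    finally have 2: "?Q \<le> ?P + prob U" .

    have Q: "?Q = prob {\<omega> \<in> space M. (\<Sum>k=1..n. Y k \<omega>) \<le> x - n * \<mu>}"
      by (simp add: Y_def sum_subtractf)
    have 3: "\<bar>\<Phi> ((x - n * \<mu>) / sqrt (n * v)) - \<Phi> (x / sqrt (n * v))\<bar> \<le> 2 / \<sigma> * (sqrt n * ?e1)"
    proof -
      have "\<bar>\<Phi> ((x - n * \<mu>) / sqrt (n * v)) - \<Phi> (x / sqrt (n * v))\<bar> \<le> \<bar>(x - n * \<mu>) / sqrt (n * v) - x / sqrt (n * v)\<bar>"
        by (rule Phi_Lipschitz)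
      also have "(x - n * \<mu>) / sqrt (n * v) - x / sqrt (n * v) = - (n * \<mu> / sqrt (n * v))"
        by (simp add: diff_divide_distrib)
      also have "\<bar>\<dots>\<bar> = n * \<bar>\<mu>\<bar> / (sqrt n * sqrt v)"
        using v by (simp add: abs_mult real_sqrt_mult)
      also have "\<dots> = sqrt n * \<bar>\<mu>\<bar> / sqrt v"
      proof -
        have "real n * \<bar>\<mu>\<bar> = sqrt n * (sqrt n * \<bar>\<mu>\<bar>)"
          by (simp flip: mult.assoc)
        then show ?thesis
          using n0 by (simp only: nonzero_mult_divide_mult_cancel_left[OF less_imp_neq[OF n0, symmetric]])
      qed
      also have "\<dots> \<le> sqrt n * ?e1 / (\<sigma> / 2)"
        using sv \<sigma> n0 \<mu>_e1 nonneg by (intro frac_le mult_left_mono) auto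
      finally show ?thesis by (simp add: ac_simps)
    qed
    have 4: "\<bar>\<Phi> (x / sqrt (n * v)) - \<Phi> (x / (\<sigma> * sqrt n))\<bar> \<le> 4 / \<sigma>\<^sup>2 * ?\<tau>"
    proof -
      have sv0: "0 < sqrt v" using v by simp
      have r: "1 \<le> \<sigma> / sqrt v" using sv_le sv0 by simp
      have "\<bar>\<Phi> (\<sigma> / sqrt v * (x / (\<sigma> * sqrt n))) - \<Phi> (x / (\<sigma> * sqrt n))\<bar> \<le> \<sigma> / sqrt v - 1"
        by (rule Phi_scale_diff[OF r])
      also have "\<sigma> / sqrt v * (x / (\<sigma> * sqrt n)) = x / sqrt (n * v)"
        using \<sigma> by (simp add: real_sqrt_mult)
      also have "\<sigma> / sqrt v - 1 = (\<sigma> - sqrt v) / sqrt v"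
        using sv0 by (simp add: diff_divide_distrib)
      also have "\<dots> = ((\<sigma> - sqrt v) * (\<sigma> + sqrt v)) / (sqrt v * (\<sigma> + sqrt v))"
        using add_pos_pos[OF \<sigma> sv0] by (simp add: less_imp_neq[symmetric])
      also have "(\<sigma> - sqrt v) * (\<sigma> + sqrt v) = \<sigma>\<^sup>2 - v"
        using v by (simp add: algebra_simps power2_eq_square)
      also have "(\<sigma>\<^sup>2 - v) / (sqrt v * (\<sigma> + sqrt v)) \<le> (2 * ?\<tau>) / (\<sigma> / 2 * \<sigma>)"
        using sv \<sigma> v_ge \<tau>0 v by (intro frac_le mult_mono mult_pos_pos) auto
      also have "\<dots> = 4 / \<sigma>\<^sup>2 * ?\<tau>" by (simp add: power2_eq_square)
      finally show ?thesis .
    qed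
    have "\<bar>?Q - \<Phi> ((x - n * \<mu>) / sqrt (n * v))\<bar> 
        \<le> 12 / \<sigma> * (h / sqrt n) + 8 / \<sigma>\<^sup>2 * ((4 * ?e3 + (4 + \<kappa>) * \<sigma> ^ 3) / h)"
      unfolding Q using approx[of "x - n * \<mu>"] approx_bound by linarith
    then show ?thesis using 1 2 3 4 PU by linarith
  qed
qed

section \<open>The truncated logarithm\<close>

lemma max_exp_pos: "0 < max x (exp 1 :: real)"
  by (rule less_le_trans[OF exp_gt_zero[of 1]]) simp

lemma ell_ge_1: "1 \<le> \<ell> x"
proof -
  have "ln (exp 1) \<le> ln (max x (exp 1))" by (subst ln_le_cancel_iff) (auto simp: max_exp_pos)
  then show ?thesis by (simp add: trunc_log_def)
qed

lemma ell_pos [simp]: "0 < \<ell> x" 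
  using ell_ge_1[of x] by linarith

lemma ell_mono: "x \<le> y \<Longrightarrow> \<ell> x \<le> \<ell> y"
  unfolding trunc_log_def by (subst ln_le_cancel_iff) (auto simp: max_exp_pos)

lemma ell_measurable [measurable]: "\<ell> \<in> borel_measurable borel"
  by (rule borel_measurable_mono) (auto simp: mono_def ell_mono)

lemma ell_eq_ln: "exp 1 \<le> x \<Longrightarrow> \<ell> x = ln x"
  by (simp add: trunc_log_def max_def)

lemma ell_eq_1: "x \<le> exp 1 \<Longrightarrow> \<ell> x = 1"
  by (simp add: trunc_log_def max_def)

lemma ln_le_ell: "0 < x \<Longrightarrow> ln x \<le> \<ell> x"
  unfolding trunc_log_def by (subst ln_le_cancel_iff) (auto simp: max_exp_pos)

lemma ell_mult_le: 
  assumes "1 \<le> y"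
  shows "\<ell> (x * y) \<le> \<ell> x + ln y"
proof -
  have m: "0 < max x (exp 1)" by (rule max_exp_pos)
  have "x * y \<le> max x (exp 1) * y" using assms m by (intro mult_right_mono max.cobounded1) linarith
  moreover have "exp 1 * 1 \<le> max x (exp 1) * y" using assms less_imp_le[OF m] by (intro mult_mono max.cobounded2) auto
  ultimately have "max (x * y) (exp 1) \<le> max x (exp 1) * y" by simp
  then have "\<ell> (x * y) \<le> ln (max x (exp 1) * y)"
    unfolding trunc_log_def using m assms
    by (subst ln_le_cancel_iff) (auto simp: max_exp_pos)
  then show ?thesis using m assms by (simp add: trunc_log_def ln_mult)
qed

lemma ell_power_le:
  assumes "0 \<le> x" "1 \<le> k"
  shows "\<ell> (x ^ k) \<le> real k * \<ell> x"
proof -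
  have e: "(1::real) \<le> exp 1" by simp
  have m: "0 < max x (exp 1)" by (rule max_exp_pos)
  have "x ^ k \<le> max x (exp 1) ^ k" using assms by (intro power_mono) auto
  moreover have "exp 1 ^ 1 \<le> (max x (exp 1)) ^ k" 
  proof -
    have "exp (1::real) ^ 1 \<le> exp 1 ^ k" using e assms by (intro power_increasing)
    also have "\<dots> \<le> max x (exp 1) ^ k" by (intro power_mono) auto
    finally show ?thesis .
  qed
  ultimately have "max (x ^ k) (exp 1) \<le> max x (exp 1) ^ k" by simp
  then have "\<ell> (x ^ k) \<le> ln (max x (exp 1) ^ k)"
    unfolding trunc_log_def using m
    by (subst ln_le_cancel_iff) (auto simp: max_exp_pos)
  then show ?thesis using m by (simp add: trunc_log_def ln_realpow)
qed

lemma ell_le_self: "1 \<le> x \<Longrightarrow> \<ell> x \<le> x"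
  using ln_le_minus_one[of x] by (cases "x \<le> exp 1") (auto simp: ell_eq_1 ell_eq_ln)

lemma ell_le_two_sqrt: 
  assumes "1 \<le> x" shows "\<ell> x \<le> 2 * sqrt x"
proof (cases "x \<le> exp 1")
  case True
  have "1 \<le> sqrt x" using assms by simp
  then have "1 \<le> 2 * sqrt x" by linarith
  then show ?thesis using True by (simp only: ell_eq_1)
next
  case False
  have "ln x = 2 * ln (sqrt x)" using assms by (simp add: ln_sqrt)
  also have "\<dots> \<le> 2 * sqrt x" using assms ln_le_minus_one[of "sqrt x"] by simp
  finally show ?thesis using False by (simp add: ell_eq_ln)
qed

lemma ln_2_le_1: "ln (2::real) \<le> 1" 
  using ln_le_minus_one[of 2] by simp

section \<open>Sums over the truncation levels\<close>

lemma sum_inverse_sqrt_le: "(\<Sum>n=1..m. 1 / sqrt (real n)) \<le> 2 * sqrt (real m)"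
proof (induction m)
  case (Suc m)
  have "1 / sqrt (real (Suc m)) \<le> 2 * (sqrt (Suc m) - sqrt m)"
  proof -
    let ?a = "sqrt (real (Suc m))" and ?b = "sqrt (real m)"
    have ab: "?b \<le> ?a" "0 < ?a" "0 \<le> ?b" by auto
    have "1 = (?a - ?b) * (?a + ?b)" by (simp add: algebra_simps)
    also have "\<dots> \<le> (?a - ?b) * (2 * ?a)" using ab by (intro mult_left_mono) auto
    finally show ?thesis using ab by (simp add: field_simps)
  qed
  then show ?case using Suc by simp
qed simp

lemma sum_inverse_le: "(\<Sum>n=1..m. 1 / real n) \<le> 2 * \<ell> (real m)"
proof (cases "m = 0")
  case False
  have "(\<Sum>n=1..m. 1 / real n) \<le> 1 + ln (real m)" if "1 \<le> m" for m
    using that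
  proof (induction m rule: dec_induct)
    case (step m)
    have "1 / real (Suc m) \<le> ln (real (Suc m)) - ln (real m)"
    proof -
      have "ln (real m / real (Suc m)) \<le> real m / real (Suc m) - 1"
        using step by (intro ln_le_minus_one) auto
      also have "\<dots> = - 1 / real (Suc m)" by (simp add: field_simps)
      finally show ?thesis using step by (simp add: ln_div)
    qed
    then show ?case using step by simp
  qed simp
  then show ?thesis using False ln_le_ell[of "real m"] ell_ge_1[of "real m"] 
    by (smt (verit) One_nat_def Suc_leI bot_nat_0.not_eq_extremum of_nat_0_less_iff)
qed (use ell_pos[of 0] in \<open>simp add: less_imp_le\<close>)

text \<open>A value \<open>x\<close> lies above the truncation level \<open>\<surd>(n / \<ell> n)\<close> only if \<open>n < x\<^sup>2 \<ell>(n)\<close>. Since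
\<open>\<ell> n \<le> 2 \<surd>n\<close>, this first gives \<open>n < 4 x\<^sup>4\<close>, hence \<open>\<ell> n\<close> is at most of order \<open>\<ell>(1 + x)\<close>, and
then \<open>n\<close> is at most of order \<open>x\<^sup>2 \<ell>(1 + x)\<close>.\<close>

lemma levels_below:
  fixes x :: real
  assumes x: "0 \<le> x"
  obtains m :: nat where "{n\<in>{1..N}. sqrt (real n / \<ell> (real n)) < x} \<subseteq> {1..m}" 
    "\<ell> (real m) \<le> 6 * \<ell> (1 + x)" "real m \<le> 6 * x\<^sup>2 * \<ell> (1 + x)"
proof -
  define A where "A = {n\<in>{1..N}. sqrt (real n / \<ell> (real n)) < x}"
  have *: "\<ell> (real n) \<le> 6 * \<ell> (1 + x) \<and> real n \<le> 6 * x\<^sup>2 * \<ell> (1 + x)" if "n \<in> A" for n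
  proof -
    have n: "1 \<le> real n" and "sqrt (real n / \<ell> (real n)) < x" using that by (auto simp: A_def)
    then have "real n / \<ell> (real n) < x\<^sup>2"
      by (metis real_less_lsqrt sqrt_le_D not_le x real_sqrt_abs abs_of_nonneg real_sqrt_less_iff)
    then have nx: "real n < x\<^sup>2 * \<ell> (real n)" by (simp add: divide_less_eq)
    also have "\<dots> \<le> x\<^sup>2 * (2 * sqrt n)" using n by (intro mult_left_mono ell_le_two_sqrt) auto
    finally have "sqrt n * sqrt n < sqrt n * (2 * x\<^sup>2)" by (simp add: ac_simps)
    then have "sqrt n < 2 * x\<^sup>2" using n by (subst (asm) mult_less_cancel_left_pos) auto
    then have "(sqrt n)\<^sup>2 \<le> (2 * x\<^sup>2)\<^sup>2" by (intro power_mono) auto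
    then have "real n \<le> 4 * x ^ 4" by (simp add: power_mult_distrib)
    also have "\<dots> \<le> (1 + x) ^ 4 * 4" using x power_mono[of x "1 + x" 4] by simp
    finally have "\<ell> (real n) \<le> \<ell> ((1 + x) ^ 4 * 4)" by (rule ell_mono)
    also have "\<dots> \<le> \<ell> ((1 + x) ^ 4) + ln 4" by (rule ell_mult_le) simp
    also have "\<dots> \<le> 4 * \<ell> (1 + x) + 2"
      using ell_power_le[of "1 + x" 4] x ln_2_le_1 ln_realpow[of 2 2] by simp
    also have "\<dots> \<le> 6 * \<ell> (1 + x)" using ell_ge_1[of "1 + x"] by simp
    finally have 1: "\<ell> (real n) \<le> 6 * \<ell> (1 + x)" .
    have "real n \<le> x\<^sup>2 * (6 * \<ell> (1 + x))"
      using nx mult_left_mono[OF 1 zero_le_power2[of x]] by linarith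
    then show ?thesis using 1 by (simp add: ac_simps)
  qed
  show ?thesis
  proof (cases "A = {}")
    case True
    have "\<ell> (real 0) \<le> 6 * \<ell> (1 + x)" using ell_ge_1[of "1 + x"] by (subst ell_eq_1) auto
    then show ?thesis using True that[of 0] ell_pos[of "1 + x"] by (auto simp: A_def)
  next
    case False
    have fin: "finite A" by (auto simp: A_def)
    have "Max A \<in> A" using False fin by (rule Max_in[rotated])
    moreover have "A \<subseteq> {1..Max A}" using fin by (auto simp: A_def)
    ultimately show ?thesis using * that[of "Max A"] unfolding A_def by blast
  qed
qed

text \<open>The nonzero terms lie in an initial segment of the integers on which \<open>\<ell> n\<close> is at most \<open>6 \<ell>(1 + x)\<close>, so the
factor \<open>\<ell>(n) powr \<delta>\<close> may be pulled out.\<close>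

lemma sum_indicator_levels_le:
  fixes x :: real and f :: "nat \<Rightarrow> real"
  assumes x: "0 \<le> x" and \<delta>: "0 \<le> \<delta>" and f: "\<And>n. 0 \<le> f n"
    and bnd: "\<And>m. \<ell> (real m) \<le> 6 * \<ell> (1 + x) \<Longrightarrow> real m \<le> 6 * x\<^sup>2 * \<ell> (1 + x) \<Longrightarrow> (\<Sum>n=1..m. f n) \<le> c"
  shows "(\<Sum>n=1..N. \<ell> (real n) powr \<delta> * f n * indicator {sqrt (real n / \<ell> (real n))<..} x) 
    \<le> (6 * \<ell> (1 + x)) powr \<delta> * c"
proof -
  let ?A = "{n\<in>{1..N}. sqrt (real n / \<ell> (real n)) < x}"
  obtain m where m: "?A \<subseteq> {1..m}" "\<ell> (real m) \<le> 6 * \<ell> (1 + x)" "real m \<le> 6 * x\<^sup>2 * \<ell> (1 + x)"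
    using levels_below[OF x] .
  have "(\<Sum>n=1..N. \<ell> (real n) powr \<delta> * f n * indicator {sqrt (real n / \<ell> (real n))<..} x)
      = (\<Sum>n\<in>?A. \<ell> (real n) powr \<delta> * f n)"
    by (rule sum.mono_neutral_cong_right) (auto simp: indicator_def)
  also have "\<dots> \<le> (\<Sum>n\<in>{1..m}. \<ell> (real n) powr \<delta> * f n)"
    using m f by (intro sum_mono2) auto
  also have "\<dots> \<le> (\<Sum>n\<in>{1..m}. (6 * \<ell> (1 + x)) powr \<delta> * f n)"
  proof (intro sum_mono mult_right_mono powr_mono2 \<delta> f)
    fix n assume "n \<in> {1..m}"
    then have "\<ell> (real n) \<le> \<ell> (real m)" by (intro ell_mono) auto
    then show "\<ell> (real n) \<le> 6 * \<ell> (1 + x)" using m by linarith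
  qed (simp add: less_imp_le)
  also have "\<dots> \<le> (6 * \<ell> (1 + x)) powr \<delta> * c"
    unfolding sum_distrib_left[symmetric] using m by (intro mult_left_mono bnd) auto
  finally show ?thesis .
qed

lemma powr_six_ell_le:
  assumes "0 \<le> \<delta>" "\<delta> \<le> 1"
  shows "(6 * \<ell> y) powr \<delta> * \<ell> y \<le> 6 * \<ell> y powr (1 + 2 * \<delta>)"
proof -
  have "(6 * \<ell> y) powr \<delta> * \<ell> y = 6 powr \<delta> * \<ell> y powr (1 + \<delta>)"
    by (simp add: powr_mult powr_add less_imp_le)
  also have "\<dots> \<le> 6 powr 1 * \<ell> y powr (1 + 2 * \<delta>)"
    using assms ell_ge_1[of y] by (intro mult_mono powr_mono) auto
  finally show ?thesis by simp
qed

text \<open>This sum and the next two are of order at most \<open>x\<^sup>2 \<ell>(1 + x) powr (1 + \<delta>)\<close>. They are stated with the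
larger exponent \<open>1 + 2 \<delta>\<close>, the one that the third moments require.\<close>

lemma sum_levels_0:
  fixes x :: real
  assumes x: "0 \<le> x" and \<delta>: "0 \<le> \<delta>" "\<delta> \<le> 1"
  shows "(\<Sum>n=1..N. \<ell> (real n) powr \<delta> * indicator {sqrt (real n / \<ell> (real n))<..} x) 
    \<le> 36 * (x\<^sup>2 * \<ell> (1 + x) powr (1 + 2 * \<delta>))"
proof -
  have "(\<Sum>n=1..N. \<ell> (real n) powr \<delta> * 1 * indicator {sqrt (real n / \<ell> (real n))<..} x) 
    \<le> (6 * \<ell> (1 + x)) powr \<delta> * (6 * x\<^sup>2 * \<ell> (1 + x))"
    by (rule sum_indicator_levels_le) (use x \<delta> in auto)
  also have "\<dots> = 6 * x\<^sup>2 * ((6 * \<ell> (1 + x)) powr \<delta> * \<ell> (1 + x))" by simp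
  also have "\<dots> \<le> 6 * x\<^sup>2 * (6 * \<ell> (1 + x) powr (1 + 2 * \<delta>))"
    using \<delta> by (intro mult_left_mono powr_six_ell_le) auto
  finally show ?thesis by simp
qed

lemma sum_levels_1:
  fixes x :: real
  assumes x: "0 \<le> x" and \<delta>: "0 \<le> \<delta>" "\<delta> \<le> 1"
  shows "(\<Sum>n=1..N. \<ell> (real n) powr \<delta> / sqrt (real n) * (x * indicator {sqrt (real n / \<ell> (real n))<..} x)) 
    \<le> 72 * (x\<^sup>2 * \<ell> (1 + x) powr (1 + 2 * \<delta>))"
proof -
  have "(\<Sum>n=1..N. \<ell> (real n) powr \<delta> * (1 / sqrt (real n)) * indicator {sqrt (real n / \<ell> (real n))<..} x) 
    \<le> (6 * \<ell> (1 + x)) powr \<delta> * (12 * x * \<ell> (1 + x))"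
  proof (rule sum_indicator_levels_le[OF x \<delta>(1)])
    fix m assume "real m \<le> 6 * x\<^sup>2 * \<ell> (1 + x)"
    also have "\<dots> \<le> 36 * x\<^sup>2 * (\<ell> (1 + x))\<^sup>2"
      using mult_left_mono[OF ell_ge_1[of "1 + x"], of "\<ell> (1 + x)"] ell_ge_1[of "1 + x"] 
      unfolding power2_eq_square by (simp add: mult_mono' mult_left_mono)
    also have "\<dots> = (6 * x * \<ell> (1 + x))\<^sup>2" by (simp add: power_mult_distrib)
    finally have "sqrt (real m) \<le> 6 * x * \<ell> (1 + x)"
      using x by (intro real_le_lsqrt) (auto simp: less_imp_le)
    then show "(\<Sum>n=1..m. 1 / sqrt (real n)) \<le> 12 * x * \<ell> (1 + x)"
      using sum_inverse_sqrt_le[of m] by linarith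
  qed auto
  from mult_left_mono[OF this x]
  have "(\<Sum>n=1..N. \<ell> (real n) powr \<delta> / sqrt (real n) * (x * indicator {sqrt (real n / \<ell> (real n))<..} x)) 
    \<le> 12 * x\<^sup>2 * ((6 * \<ell> (1 + x)) powr \<delta> * \<ell> (1 + x))"
    by (simp add: sum_distrib_left ac_simps power2_eq_square)
  also have "\<dots> \<le> 12 * x\<^sup>2 * (6 * \<ell> (1 + x) powr (1 + 2 * \<delta>))"
    using \<delta> by (intro mult_left_mono powr_six_ell_le) auto
  finally show ?thesis by simp
qed

lemma sum_levels_2:
  fixes x :: real
  assumes x: "0 \<le> x" and \<delta>: "0 \<le> \<delta>" "\<delta> \<le> 1"
  shows "(\<Sum>n=1..N. \<ell> (real n) powr \<delta> / real n * (x\<^sup>2 * indicator {sqrt (real n / \<ell> (real n))<..} x)) 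
    \<le> 72 * (x\<^sup>2 * \<ell> (1 + x) powr (1 + 2 * \<delta>))"
proof -
  have "(\<Sum>n=1..N. \<ell> (real n) powr \<delta> * (1 / real n) * indicator {sqrt (real n / \<ell> (real n))<..} x) 
    \<le> (6 * \<ell> (1 + x)) powr \<delta> * (12 * \<ell> (1 + x))"
  proof (rule sum_indicator_levels_le[OF x \<delta>(1)])
    fix m assume "\<ell> (real m) \<le> 6 * \<ell> (1 + x)"
    then show "(\<Sum>n=1..m. 1 / real n) \<le> 12 * \<ell> (1 + x)"
      using sum_inverse_le[of m] by linarith
  qed auto
  from mult_left_mono[OF this zero_le_power2[of x]]
  have "(\<Sum>n=1..N. \<ell> (real n) powr \<delta> / real n * (x\<^sup>2 * indicator {sqrt (real n / \<ell> (real n))<..} x)) 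
    \<le> 12 * x\<^sup>2 * ((6 * \<ell> (1 + x)) powr \<delta> * \<ell> (1 + x))"
    by (simp add: sum_distrib_left ac_simps)
  also have "\<dots> \<le> 12 * x\<^sup>2 * (6 * \<ell> (1 + x) powr (1 + 2 * \<delta>))"
    using \<delta> by (intro mult_left_mono powr_six_ell_le) auto
  finally show ?thesis by simp
qed

text \<open>The mean value theorem for \<open>x powr (-1/4)\<close>; the constant uses \<open>x + 1 \<le> 2 x\<close>.\<close>

lemma powr_telescope:
  fixes x :: real
  assumes x: "1 \<le> x"
  shows "x powr (- 5 / 4) \<le> 16 * (x powr (- 1 / 4) - (x + 1) powr (- 1 / 4))"
proof -
  have "\<exists>z>x. z < x + 1 \<and> (x + 1) powr (- 1 / 4) - x powr (- 1 / 4) = (x + 1 - x) * (- 1 / 4 * z powr (- 5 / 4))"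
    by (rule MVT2) (use x in \<open>auto intro!: derivative_eq_intros simp: field_simps\<close>)
  then obtain z where z: "x < z" "z < x + 1" 
    "(x + 1) powr (- 1 / 4) - x powr (- 1 / 4) = - 1 / 4 * z powr (- 5 / 4)" by auto
  have "4 powr (- 1) * x powr (- 5 / 4) \<le> 2 powr (- 5 / 4) * x powr (- 5 / 4)"
  proof (intro mult_right_mono)
    have "4 powr (- 1) = (2 powr 2) powr (- 1 :: real)" by simp
    also have "\<dots> = 2 powr (- 2)" unfolding powr_powr by simp
    also have "\<dots> \<le> 2 powr (- 5 / 4)" by (rule powr_mono) auto
    finally show "4 powr (- 1) \<le> (2 powr (- 5 / 4) :: real)" .
  qed auto
  also have "\<dots> = (2 * x) powr (- 5 / 4)" using x by (simp add: powr_mult)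
  also have "\<dots> \<le> z powr (- 5 / 4)" using z x by (intro powr_mono2') auto
  finally have "x powr (- 5 / 4) \<le> 4 * z powr (- 5 / 4)" by (simp add: powr_minus)
  also have "4 * z powr (- 5 / 4) = 16 * (x powr (- 1 / 4) - (x + 1) powr (- 1 / 4))"
    using z(3) by (simp add: algebra_simps)
  finally show ?thesis .
qed

lemma sum_powr_tail_le:
  fixes K :: real
  assumes K: "0 < K"
  shows "(\<Sum>n\<in>{n\<in>{1..N}. K \<le> real n}. real n powr (- 5 / 4)) \<le> 16 * K powr (- 1 / 4)"
proof -
  define m where "m = nat \<lceil>K\<rceil>"
  have m: "1 \<le> m" "K \<le> real m" using K by (auto simp: m_def) linarith
  have "(\<Sum>n\<in>{n\<in>{1..N}. K \<le> real n}. real n powr (- 5 / 4)) \<le> (\<Sum>n\<in>{m..<max m (Suc N)}. real n powr (- 5 / 4))"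
    by (rule sum_mono2) (auto simp: m_def nat_ceiling_le_eq)
  also have "\<dots> \<le> (\<Sum>n\<in>{m..<max m (Suc N)}. 16 * (real n powr (- 1 / 4) - real (Suc n) powr (- 1 / 4)))"
  proof (rule sum_mono)
    fix n assume "n \<in> {m..<max m (Suc N)}"
    then have "1 \<le> real n" using m by simp
    from powr_telescope[OF this] show "real n powr (- 5 / 4) \<le> 16 * (real n powr (- 1 / 4) - real (Suc n) powr (- 1 / 4))"
      by (simp add: add.commute)
  qed
  also have "\<dots> = 16 * (real m powr (- 1 / 4) - real (max m (Suc N)) powr (- 1 / 4))"
    unfolding sum_distrib_left[symmetric]
    using sum_Suc_diff'[of m "max m (Suc N)" "\<lambda>n. - (real n powr (- 1 / 4))"] by simp
  also have "\<dots> \<le> 16 * real m powr (- 1 / 4)" by simp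
  also have "\<dots> \<le> 16 * K powr (- 1 / 4)" using m K by (intro mult_left_mono powr_mono2') auto
  finally show ?thesis .
qed

text \<open>A value \<open>x\<close> below the truncation level forces \<open>n \<ge> K\<close>, where \<open>K\<close> is of order \<open>x\<^sup>2 \<ell>(1 + x)\<close>, and the
sum is dominated by its first terms, of total order \<open>x\<^sup>3 \<ell>(1 + x) powr q / \<surd>K\<close>. The logarithm in
\<open>K\<close>, the effect of truncating below \<open>\<surd>n\<close>, lowers the exponent from \<open>q\<close> to \<open>q - 1/2\<close>.\<close>

lemma sum_levels_3:
  fixes x :: real
  assumes x: "0 \<le> x" and q: "0 \<le> q" "q \<le> 7 / 2"
  shows "(\<Sum>n=1..N. \<ell> (real n) powr q * real n powr (- 3 / 2) * (x ^ 3 * indicator {..sqrt (real n / \<ell> (real n))} x))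
    \<le> 32 * 17 ^ 4 * (x\<^sup>2 * \<ell> (1 + x) powr (q - 1 / 2))"
proof (cases "x = 0")
  case False
  then have x0: "0 < x" using x by simp
  define L where "L = \<ell> (1 + x)"
  have L: "1 \<le> L" unfolding L_def by (rule ell_ge_1)
  define K where "K = x\<^sup>2 * L / 2"
  have K: "0 < K" using x0 L by (simp add: K_def)
  have lK: "\<ell> K \<le> 3 * L"
  proof -
    have "0 \<le> x\<^sup>2 * L" using L by simp
    then have "K \<le> x\<^sup>2 * L" unfolding K_def by linarith
    also have "\<dots> \<le> (1 + x)\<^sup>2 * (1 + x)" unfolding L_def 
      using x ell_pos[of "1 + x"] by (intro mult_mono power_mono ell_le_self) (auto simp: less_imp_le)
    finally have "\<ell> K \<le> \<ell> ((1 + x) ^ 3)" by (intro ell_mono) (simp add: power3_eq_cube power2_eq_square)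
    then show ?thesis using ell_power_le[of "1 + x" 3] x by (simp add: L_def)
  qed
  have key: "K \<le> real n \<and> \<ell> (real n) powr q * real n powr (- 3 / 2) \<le> 17 ^ 4 * L powr q * K powr (- 1 / 4) * real n powr (- 5 / 4)"
    if n: "1 \<le> n" and xn: "x \<le> sqrt (real n / \<ell> (real n))" for n
  proof
    have "x\<^sup>2 \<le> (sqrt (real n / \<ell> (real n)))\<^sup>2" using x xn by (intro power_mono) auto
    then have xl: "x\<^sup>2 * \<ell> (real n) \<le> real n" by (simp add: field_simps less_imp_le)
    moreover have "x\<^sup>2 * 1 \<le> x\<^sup>2 * \<ell> (real n)" by (intro mult_left_mono ell_ge_1) auto
    ultimately have xn2: "x\<^sup>2 \<le> real n" by linarith
    have "1 + x \<le> real n * 2"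
    proof (cases "x \<le> 1")
      case False
      then have "x * 1 \<le> x * x" by (intro mult_left_mono) auto
      then show ?thesis using xn2 n by (simp add: power2_eq_square)
    qed (use n in simp)
    then have "L \<le> \<ell> (real n * 2)" unfolding L_def by (rule ell_mono)
    also have "\<dots> \<le> \<ell> (real n) + ln 2" by (rule ell_mult_le) simp
    also have "\<dots> \<le> 2 * \<ell> (real n)" using ln_2_le_1 ell_ge_1[of "real n"] by simp
    finally have "x\<^sup>2 * (L / 2) \<le> x\<^sup>2 * \<ell> (real n)" by (intro mult_left_mono) auto
    then show Kn: "K \<le> real n" using xl by (simp add: K_def)
    define y where "y = real n / K"
    have y: "1 \<le> y" "real n = K * y" using Kn K by (auto simp: y_def)
    \<comment> \<open>With the exponent \<open>1/14\<close>, the bound \<open>q \<le> 7/2\<close> gives \<open>z powr q \<le> y powr (1/4)\<close>. This leaves the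
      summable power \<open>n powr (-5/4)\<close>.\<close>
    define z where "z = y powr (1 / 14)"
    have z: "1 \<le> z" using y ge_one_powr_ge_zero[of y "1/14"] by (simp add: z_def)
    have "\<ell> (real n) \<le> \<ell> K + ln y" unfolding y(2) by (rule ell_mult_le[OF y(1)])
    also have "ln y = 14 * ln z" using y by (simp add: z_def ln_powr)
    also have "\<ell> K + 14 * ln z \<le> 3 * L + 14 * z"
      using lK ln_le_minus_one[of z] z by simp
    also have "3 * L + 14 * z \<le> 17 * (L * z)"
    proof -
      have "L * 1 \<le> L * z" "1 * z \<le> L * z" using L z by (auto intro!: mult_left_mono mult_right_mono)
      then show ?thesis by linarith
    qed
    finally have "\<ell> (real n) powr q \<le> (17 * (L * z)) powr q"
      using q by (intro powr_mono2) (auto simp: less_imp_le)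
    also have "\<dots> = 17 powr q * L powr q * z powr q" using L z by (simp add: powr_mult)
    also have "\<dots> \<le> 17 powr 4 * L powr q * y powr (1 / 4)"
    proof (intro mult_mono)
      show "17 powr q \<le> (17 powr 4 :: real)" using q by (intro powr_mono) auto
      have "z powr q = y powr (q / 14)" by (simp add: z_def powr_powr)
      also have "\<dots> \<le> y powr (1 / 4)" using q y by (intro powr_mono) auto
      finally show "z powr q \<le> y powr (1 / 4)" .
    qed auto
    also have "y powr (1 / 4) = real n powr (1 / 4) * K powr (- 1 / 4)"
      using K by (simp add: y_def powr_divide powr_minus_divide)
    finally have "\<ell> (real n) powr q * real n powr (- 3 / 2) \<le> 
       17 powr 4 * L powr q * (real n powr (1 / 4) * K powr (- 1 / 4)) * real n powr (- 3 / 2)"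
      by (intro mult_right_mono) auto
    also have "\<dots> = 17 ^ 4 * L powr q * K powr (- 1 / 4) * (real n powr (1 / 4) * real n powr (- 3 / 2))"
      by simp
    also have "real n powr (1 / 4) * real n powr (- 3 / 2) = real n powr (- 5 / 4)"
      by (simp flip: powr_add)
    finally show "\<ell> (real n) powr q * real n powr (- 3 / 2) \<le> 17 ^ 4 * L powr q * K powr (- 1 / 4) * real n powr (- 5 / 4)" .
  qed
  define c where "c = 17 ^ 4 * L powr q * K powr (- 1 / 4)"
  have c: "0 \<le> c" by (simp add: c_def)
  have "(\<Sum>n=1..N. \<ell> (real n) powr q * real n powr (- 3 / 2) * (x ^ 3 * indicator {..sqrt (real n / \<ell> (real n))} x))
     = (\<Sum>n\<in>{n\<in>{1..N}. x \<le> sqrt (real n / \<ell> (real n))}. \<ell> (real n) powr q * real n powr (- 3 / 2) * x ^ 3)"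
    by (rule sum.mono_neutral_cong_right) (auto simp: indicator_def)
  also have "\<dots> \<le> (\<Sum>n\<in>{n\<in>{1..N}. x \<le> sqrt (real n / \<ell> (real n))}. c * real n powr (- 5 / 4) * x ^ 3)"
    using key x unfolding c_def by (intro sum_mono mult_right_mono) auto
  also have "\<dots> \<le> (\<Sum>n\<in>{n\<in>{1..N}. K \<le> real n}. c * real n powr (- 5 / 4) * x ^ 3)"
    using key x c by (intro sum_mono2) auto
  also have "\<dots> = c * x ^ 3 * (\<Sum>n\<in>{n\<in>{1..N}. K \<le> real n}. real n powr (- 5 / 4))"
    by (simp add: sum_distrib_left ac_simps)
  also have "\<dots> \<le> c * x ^ 3 * (16 * K powr (- 1 / 4))"
    using c x by (intro mult_left_mono sum_powr_tail_le K) auto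
  also have "\<dots> = 16 * 17 ^ 4 * L powr q * x ^ 3 * (K powr (- 1 / 4) * K powr (- 1 / 4))"
    by (simp add: c_def)
  also have "K powr (- 1 / 4) * K powr (- 1 / 4) = K powr (- 1 / 2)"
    by (simp flip: powr_add)
  also have "K powr (- 1 / 2) \<le> 2 * (L powr (- 1 / 2) / x)"
  proof -
    have "K powr (- 1 / 2) = 1 / sqrt K" using K by (simp add: powr_minus_divide powr_half_sqrt)
    also have "sqrt K = x * sqrt L / sqrt 2" using x by (simp add: K_def real_sqrt_mult real_sqrt_divide)
    also have "1 / (x * sqrt L / sqrt 2) = sqrt 2 * (L powr (- 1 / 2) / x)"
      using L by (simp add: powr_minus_divide powr_half_sqrt)
    also have "\<dots> \<le> 2 * (L powr (- 1 / 2) / x)"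
      using x0 by (intro mult_right_mono real_le_lsqrt) auto
    finally show ?thesis .
  qed
  also have "16 * 17 ^ 4 * L powr q * x ^ 3 * (2 * (L powr (- 1 / 2) / x)) = 32 * 17 ^ 4 * (x\<^sup>2 * (L powr q * L powr (- 1 / 2)))"
    using x0 by (simp add: power3_eq_cube power2_eq_square)
  also have "L powr q * L powr (- 1 / 2) = L powr (q - 1 / 2)"
    by (simp flip: powr_add)
  finally show ?thesis
    using x by (simp add: L_def mult_left_mono)
qed auto

lemma one_le_level:
  assumes "1 \<le> n" shows "1 \<le> sqrt (real n / \<ell> (real n))"
  using assms ell_le_self[of "real n"] by simp

text \<open>The truncation level is never below \<open>1\<close>, so this is the preceding bound for \<open>x = 1\<close>.\<close>

lemma summable_ell_powr_three_half:
  assumes q: "0 \<le> q" "q \<le> 7 / 2"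
  shows "summable (\<lambda>n. \<ell> (real (Suc n)) powr q * real (Suc n) powr (- 3 / 2))"
proof (rule summableI_nonneg_bounded)
  fix N
  have "(\<Sum>n<N. \<ell> (real (Suc n)) powr q * real (Suc n) powr (- 3 / 2)) = 
     (\<Sum>n=1..N. \<ell> (real n) powr q * real n powr (- 3 / 2) * (1 ^ 3 * indicator {..sqrt (real n / \<ell> (real n))} 1))"
    unfolding One_nat_def sum.atLeast1_atMost_eq
  proof (rule sum.cong)
    fix k
    show "\<ell> (real (Suc k)) powr q * real (Suc k) powr (- 3 / 2) = \<ell> (real (Suc k)) powr q * real (Suc k) powr (- 3 / 2) *
        (1 ^ 3 * indicator {..sqrt (real (Suc k) / \<ell> (real (Suc k)))} 1)"
      using one_le_level[of "Suc k"] by (simp del: of_nat_Suc)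
  qed simp
  then show "(\<Sum>n<N. \<ell> (real (Suc n)) powr q * real (Suc n) powr (- 3 / 2)) \<le> 32 * 17 ^ 4 * (1\<^sup>2 * \<ell> (1 + 1) powr (q - 1 / 2))"
    using sum_levels_3[of 1 q N] q by simp
qed simp

text \<open>From \<open>n = 3\<close> on, the terms are bounded by the decrements of \<open>2 ln(n) powr (-1/2)\<close>.\<close>

lemma summable_inverse_ell_three_half:
  "summable (\<lambda>n. \<ell> (real (Suc n)) powr (- 3 / 2) / real (Suc n))"
proof -
  define F where "F n = 2 * ln (real n) powr (- 1 / 2)" for n :: nat
  have "F \<longlonglongrightarrow> 0" unfolding F_def by real_asymp
  then have "summable (\<lambda>n. F n - F (Suc n))" by (rule telescope_summable')
  moreover have "\<forall>\<^sub>F n in sequentially. norm (\<ell> (real (Suc n)) powr (- 3 / 2) / real (Suc n)) \<le> F n - F (Suc n)"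
    using eventually_ge_at_top[of 3]
  proof eventually_elim
    case (elim n)
    have e: "exp 1 < real n" using elim e_less_272 by simp
    have l1: "1 < ln (real n)" using e elim ln_less_cancel_iff[of "exp 1" "real n"] by simp
    have "\<exists>z>real n. z < real (Suc n) \<and> 2 * ln (real (Suc n)) powr (- 1 / 2) - 2 * ln (real n) powr (- 1 / 2) = 
        (real (Suc n) - real n) * (- (ln z powr (- 3 / 2) / z))"
    proof (rule MVT2)
      fix z assume z: "real n \<le> z" "z \<le> real (Suc n)"
      have "1 < ln z" using l1 z elim by (meson less_le_trans ln_le_cancel_iff of_nat_0_less_iff order_less_le_trans zero_less_numeral)
      then show "((\<lambda>z. 2 * ln z powr (- 1 / 2)) has_real_derivative - (ln z powr (- 3 / 2) / z)) (at z)"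
        using z elim by (auto intro!: derivative_eq_intros simp: field_simps)
    qed simp
    then obtain z where z: "real n < z" "z < real (Suc n)" and Fz: "F n - F (Suc n) = ln z powr (- 3 / 2) / z"
      unfolding F_def by auto
    have "ln (real (Suc n)) powr (- 3 / 2) / real (Suc n) \<le> ln z powr (- 3 / 2) / z"
    proof (intro frac_le powr_mono2')
      show "0 < ln z" using z e l1 elim ln_less_cancel_iff[of "real n" z] by linarith
      show "ln z \<le> ln (real (Suc n))" using z elim by (subst ln_le_cancel_iff) auto
    qed (use z elim in auto)
    then show ?case using Fz e by (simp add: ell_eq_ln)
  qed
  ultimately show ?thesis by (rule summable_comparison_test_ev[rotated])
qed

section \<open>Summability of the normal approximation\<close>

definition log_weight :: "real \<Rightarrow> nat \<Rightarrow> real" where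
  "log_weight \<delta> n = \<ell> (real n) powr \<delta> / real n"

lemma ell_nonzero [simp]: "\<ell> x \<noteq> 0"
  using ell_pos[of x] by linarith

lemma log_weight_nonneg: "0 \<le> log_weight \<delta> n"
  by (simp add: log_weight_def)

lemma (in prob_space) summable_expectation_of_sum_le:
  fixes f :: "nat \<Rightarrow> 'a \<Rightarrow> real"
  assumes "\<And>n. integrable M (f n)" "\<And>n \<omega>. 0 \<le> f n \<omega>" "integrable M g" 
    and "\<And>N \<omega>. (\<Sum>n<N. f n \<omega>) \<le> g \<omega>"
  shows "summable (\<lambda>n. expectation (f n))"
proof (rule summableI_nonneg_bounded)
  show "0 \<le> expectation (f n)" for n
    using assms by (intro Bochner_Integration.integral_nonneg) auto
  fix N
  have "(\<Sum>n<N. expectation (f n)) = expectation (\<lambda>\<omega>. \<Sum>n<N. f n \<omega>)"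
    using assms by (intro Bochner_Integration.integral_sum[symmetric]) auto
  also have "\<dots> \<le> expectation g"
    using assms by (intro integral_mono) auto
  finally show "(\<Sum>n<N. expectation (f n)) \<le> expectation g" .
qed

text \<open>Exchanging sum and expectation reduces each series to a pointwise bound on the sum over \<open>n\<close> for a fixed
value \<open>x = |X \<omega>|\<close>, which the preceding section provides.\<close>

lemma (in prob_space) summable_truncation_terms:
  fixes X :: "'a \<Rightarrow> real"
  assumes [measurable]: "X \<in> borel_measurable M" and \<delta>: "0 \<le> \<delta>" "\<delta> \<le> 1"
    and X1: "integrable M X" and X2: "integrable M (\<lambda>\<omega>. (X \<omega>)\<^sup>2)"
    and XL: "integrable M (\<lambda>\<omega>. (X \<omega>)\<^sup>2 * \<ell> (1 + \<bar>X \<omega>\<bar>) powr (1 + 2 * \<delta>))"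
  defines "b \<equiv> \<lambda>n. sqrt (real n / \<ell> (real n))"
  shows "summable (\<lambda>i. \<ell> (real (Suc i)) powr \<delta> * expectation (\<lambda>\<omega>. indicator {b (Suc i)<..} \<bar>X \<omega>\<bar>))" (is ?s0)
    and "summable (\<lambda>i. \<ell> (real (Suc i)) powr \<delta> / sqrt (real (Suc i)) * expectation (\<lambda>\<omega>. \<bar>X \<omega>\<bar> * indicator {b (Suc i)<..} \<bar>X \<omega>\<bar>))" (is ?s1)
    and "summable (\<lambda>i. \<ell> (real (Suc i)) powr \<delta> / real (Suc i) * expectation (\<lambda>\<omega>. (X \<omega>)\<^sup>2 * indicator {b (Suc i)<..} \<bar>X \<omega>\<bar>))" (is ?s2)
    and "summable (\<lambda>i. \<ell> (real (Suc i)) powr (3 / 2 + 2 * \<delta>) * real (Suc i) powr (- 3 / 2) * 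
           expectation (\<lambda>\<omega>. \<bar>X \<omega>\<bar> ^ 3 * indicator {..b (Suc i)} \<bar>X \<omega>\<bar>))" (is ?s3)
proof -
  let ?G = "\<lambda>\<omega>. (X \<omega>)\<^sup>2 * \<ell> (1 + \<bar>X \<omega>\<bar>) powr (1 + 2 * \<delta>)"
  have int0: "integrable M (\<lambda>\<omega>. indicator {c<..} \<bar>X \<omega>\<bar> :: real)" for c
    by (rule integrable_const_bound[where B = 1]) auto
  have int1: "integrable M (\<lambda>\<omega>. \<bar>X \<omega>\<bar> * indicator {c<..} \<bar>X \<omega>\<bar>)" for c
    by (rule Bochner_Integration.integrable_bound[OF X1]) (auto simp: indicator_def)
  have int2: "integrable M (\<lambda>\<omega>. (X \<omega>)\<^sup>2 * indicator {c<..} \<bar>X \<omega>\<bar>)" for c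
    by (rule Bochner_Integration.integrable_bound[OF X2]) (auto simp: indicator_def)
  have int3: "integrable M (\<lambda>\<omega>. \<bar>X \<omega>\<bar> ^ 3 * indicator {..c} \<bar>X \<omega>\<bar>)" for c
  proof (rule integrable_const_bound[where B = "\<bar>c\<bar> ^ 3"])
    have "\<bar>X \<omega>\<bar> ^ 3 \<le> \<bar>c\<bar> ^ 3" if "\<bar>X \<omega>\<bar> \<le> c" for \<omega>
      using that by (intro power_mono) auto
    then show "AE \<omega> in M. norm (\<bar>X \<omega>\<bar> ^ 3 * indicator {..c} \<bar>X \<omega>\<bar>) \<le> \<bar>c\<bar> ^ 3"
      by (auto simp: indicator_def)
  qed simp
  have shift: "(\<Sum>n<N. f (Suc n)) = (\<Sum>n=1..N. f n)" for f :: "nat \<Rightarrow> real" and N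
    unfolding One_nat_def sum.atLeast1_atMost_eq ..
  have "summable (\<lambda>i. expectation (\<lambda>\<omega>. \<ell> (real (Suc i)) powr \<delta> * indicator {b (Suc i)<..} \<bar>X \<omega>\<bar>))"
  proof (rule summable_expectation_of_sum_le[where g = "\<lambda>\<omega>. 36 * ?G \<omega>"])
    show "(\<Sum>n<N. \<ell> (real (Suc n)) powr \<delta> * indicator {b (Suc n)<..} \<bar>X \<omega>\<bar>) \<le> 36 * ?G \<omega>" for N \<omega>
      unfolding b_def shift[of "\<lambda>n. \<ell> (real n) powr \<delta> * indicator {sqrt (real n / \<ell> (real n))<..} \<bar>X \<omega>\<bar>"]
      using sum_levels_0[where x = "\<bar>X \<omega>\<bar>" and N = N, OF abs_ge_zero \<delta>] unfolding power2_abs .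
  qed (use int0 XL in auto)
  then show ?s0 by simp
  have "summable (\<lambda>i. expectation (\<lambda>\<omega>. \<ell> (real (Suc i)) powr \<delta> / sqrt (real (Suc i)) * (\<bar>X \<omega>\<bar> * indicator {b (Suc i)<..} \<bar>X \<omega>\<bar>)))"
  proof (rule summable_expectation_of_sum_le[where g = "\<lambda>\<omega>. 72 * ?G \<omega>"])
    show "(\<Sum>n<N. \<ell> (real (Suc n)) powr \<delta> / sqrt (real (Suc n)) * (\<bar>X \<omega>\<bar> * indicator {b (Suc n)<..} \<bar>X \<omega>\<bar>)) \<le> 72 * ?G \<omega>" for N \<omega>
      unfolding b_def shift[of "\<lambda>n. \<ell> (real n) powr \<delta> / sqrt (real n) * (\<bar>X \<omega>\<bar> * indicator {sqrt (real n / \<ell> (real n))<..} \<bar>X \<omega>\<bar>)"]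
      using sum_levels_1[where x = "\<bar>X \<omega>\<bar>" and N = N, OF abs_ge_zero \<delta>] unfolding power2_abs .
  qed (use int1 XL in auto)
  then show ?s1 by simp
  have "summable (\<lambda>i. expectation (\<lambda>\<omega>. \<ell> (real (Suc i)) powr \<delta> / real (Suc i) * ((X \<omega>)\<^sup>2 * indicator {b (Suc i)<..} \<bar>X \<omega>\<bar>)))"
  proof (rule summable_expectation_of_sum_le[where g = "\<lambda>\<omega>. 72 * ?G \<omega>"])
    show "(\<Sum>n<N. \<ell> (real (Suc n)) powr \<delta> / real (Suc n) * ((X \<omega>)\<^sup>2 * indicator {b (Suc n)<..} \<bar>X \<omega>\<bar>)) \<le> 72 * ?G \<omega>" for N \<omega>
      unfolding b_def shift[of "\<lambda>n. \<ell> (real n) powr \<delta> / real n * ((X \<omega>)\<^sup>2 * indicator {sqrt (real n / \<ell> (real n))<..} \<bar>X \<omega>\<bar>)"]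
      using sum_levels_2[where x = "\<bar>X \<omega>\<bar>" and N = N, OF abs_ge_zero \<delta>] unfolding power2_abs .
  qed (use int2 XL in auto)
  then show ?s2 by simp
  have "summable (\<lambda>i. expectation (\<lambda>\<omega>. \<ell> (real (Suc i)) powr (3 / 2 + 2 * \<delta>) * real (Suc i) powr (- 3 / 2) * (\<bar>X \<omega>\<bar> ^ 3 * indicator {..b (Suc i)} \<bar>X \<omega>\<bar>)))"
  proof (rule summable_expectation_of_sum_le[where g = "\<lambda>\<omega>. 32 * 17 ^ 4 * ?G \<omega>"])
    have q: "3 / 2 + 2 * \<delta> - 1 / 2 = 1 + 2 * \<delta>" by simp
    show "(\<Sum>n<N. \<ell> (real (Suc n)) powr (3 / 2 + 2 * \<delta>) * real (Suc n) powr (- 3 / 2) * (\<bar>X \<omega>\<bar> ^ 3 * indicator {..b (Suc n)} \<bar>X \<omega>\<bar>)) 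
        \<le> 32 * 17 ^ 4 * ?G \<omega>" for N \<omega>
      unfolding b_def shift[of "\<lambda>n. \<ell> (real n) powr (3 / 2 + 2 * \<delta>) * real n powr (- 3 / 2) * (\<bar>X \<omega>\<bar> ^ 3 * indicator {..sqrt (real n / \<ell> (real n))} \<bar>X \<omega>\<bar>)"]
      using sum_levels_3[where x = "\<bar>X \<omega>\<bar>" and q = "3 / 2 + 2 * \<delta>" and N = N, OF abs_ge_zero] \<delta>
      unfolding q power2_abs by auto
  qed (use int3 XL in auto)
  then show ?s3 by simp
qed

text \<open>The error terms of the truncated approximation are matched with the series above: the effects of the
truncation with the tails of \<open>X\<close>, the width of the smoothing with \<open>\<Sum> 1 / (n \<ell>(n) powr 3/2)\<close>, and the
replacement errors with the truncated third moments.\<close>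

lemma (in prob_space) summable_normal_approximation:
  fixes Xs :: "nat \<Rightarrow> 'a \<Rightarrow> real" and X :: "'a \<Rightarrow> real"
  assumes Xm [measurable]: "X \<in> borel_measurable M"
    and ind: "indep_vars (\<lambda>_. borel) Xs {1..}"
    and dist: "\<And>k. k \<ge> 1 \<Longrightarrow> distr M borel (Xs k) = distr M borel X"
    and X1: "integrable M X" and EX: "expectation X = 0"
    and X2: "integrable M (\<lambda>\<omega>. (X \<omega>)\<^sup>2)" and VX: "expectation (\<lambda>\<omega>. (X \<omega>)\<^sup>2) = \<sigma>\<^sup>2" 
    and \<sigma>: "\<sigma> > 0" and \<delta>: "0 \<le> \<delta>" "\<delta> \<le> 1"
    and XL: "integrable M (\<lambda>\<omega>. (X \<omega>)\<^sup>2 * \<ell> (1 + \<bar>X \<omega>\<bar>) powr (1 + 2 * \<delta>))"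
  obtains C where "summable (\<lambda>i. C (Suc i))"
    and "\<And>n x. 1 \<le> n \<Longrightarrow> log_weight \<delta> n * \<bar>prob {\<omega> \<in> space M. (\<Sum>k=1..n. Xs k \<omega>) \<le> x} - \<Phi> (x / (\<sigma> * sqrt n))\<bar> \<le> C n"
proof -
  define b where "b n = sqrt (real n / \<ell> (real n))" for n
  \<comment> \<open>The second term of \<open>h\<close> is \<open>\<ell>(n) powr -(3/2 + \<delta>)\<close> in units of the standard deviation of \<open>S n\<close>, small
    enough for its weighted sum to converge and large enough for the replacement errors. The first
    term secures \<open>h \<ge> \<sigma>\<close>, so that the scale dominates each single summand.\<close>
  define h where "h n = \<sigma> * (1 + sqrt (real n) * \<ell> (real n) powr (- (3 / 2 + \<delta>)))" for n
  define e0 where "e0 n = expectation (\<lambda>\<omega>. indicator {b n<..} \<bar>X \<omega>\<bar> :: real)" for n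
  define e1 where "e1 n = expectation (\<lambda>\<omega>. \<bar>X \<omega>\<bar> * indicator {b n<..} \<bar>X \<omega>\<bar>)" for n
  define e2 where "e2 n = expectation (\<lambda>\<omega>. (X \<omega>)\<^sup>2 * indicator {b n<..} \<bar>X \<omega>\<bar>)" for n
  define e3 where "e3 n = expectation (\<lambda>\<omega>. \<bar>X \<omega>\<bar> ^ 3 * indicator {..b n} \<bar>X \<omega>\<bar>)" for n
  define c where "c = (4 + \<kappa>) * \<sigma> ^ 3"
  define u where "u q n = \<ell> (real n) powr q * real n powr (- 3 / 2)" for q and n :: nat
  define C where "C n = \<ell> (real n) powr \<delta> * e0 n + 2 / \<sigma> * (\<ell> (real n) powr \<delta> / sqrt (real n) * e1 n)
      + 4 / \<sigma>\<^sup>2 * (\<ell> (real n) powr \<delta> / real n * e2 n)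
      + 12 * (u \<delta> n + \<ell> (real n) powr (- 3 / 2) / real n)
      + 8 / \<sigma> ^ 3 * (4 * (u (3 / 2 + 2 * \<delta>) n * e3 n) + c * u (3 / 2 + 2 * \<delta>) n)" for n
  have c: "0 \<le> c" using \<sigma> kappa_nonneg by (simp add: c_def)
  have e3: "0 \<le> e3 n" for n unfolding e3_def by (rule Bochner_Integration.integral_nonneg) auto
  have "summable (\<lambda>i. C (Suc i))"
    unfolding C_def e0_def e1_def e2_def e3_def b_def u_def
    using \<delta> by (intro summable_add summable_mult summable_truncation_terms assms
      summable_ell_powr_three_half summable_inverse_ell_three_half) auto
  moreover have "log_weight \<delta> n * \<bar>prob {\<omega> \<in> space M. (\<Sum>k=1..n. Xs k \<omega>) \<le> x} - \<Phi> (x / (\<sigma> * sqrt n))\<bar> \<le> C n"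
    if n: "1 \<le> n" for n x
  proof -
    have n0: "0 < real n" using n by simp
    have b0: "0 < b n" unfolding b_def using n by simp
    have pos: "0 < sqrt (real n) * \<ell> (real n) powr (- (3 / 2 + \<delta>))" using n by simp
    have h0: "\<sigma> \<le> h n" using \<sigma> pos by (simp add: h_def)
    have bound: "\<bar>prob {\<omega> \<in> space M. (\<Sum>k=1..n. Xs k \<omega>) \<le> x} - \<Phi> (x / (\<sigma> * sqrt n))\<bar> \<le>
      real n * e0 n + 2 / \<sigma> * (sqrt n * e1 n) + 4 / \<sigma>\<^sup>2 * e2 n
      + 12 / \<sigma> * (h n / sqrt n) + 8 / \<sigma>\<^sup>2 * ((4 * e3 n + c) / h n)"
      unfolding e0_def e1_def e2_def e3_def c_def
      by (rule normal_approximation_truncated[OF Xm ind dist X1 EX X2 VX \<sigma> b0 h0 n])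
    have w1: "log_weight \<delta> n * real n = \<ell> (real n) powr \<delta>" using n0 by (simp add: log_weight_def)
    have w2: "log_weight \<delta> n * sqrt n = \<ell> (real n) powr \<delta> / sqrt n" 
    proof -
      have "log_weight \<delta> n * sqrt n = \<ell> (real n) powr \<delta> * (sqrt n / n)" by (simp add: log_weight_def)
      also have "\<dots> = \<ell> (real n) powr \<delta> / sqrt n" using sqrt_divide_self_eq[of "real n"] by (simp add: divide_inverse)
      finally show ?thesis .
    qed
    have w3: "log_weight \<delta> n / sqrt n = u \<delta> n"
    proof -
      have "real n powr (- 3 / 2) = real n powr (- 1) * real n powr (- 1 / 2)"
        using powr_add[of "real n" "- 1" "- 1 / 2"] by simp
      also have "\<dots> = 1 / real n * (1 / sqrt n)" 
        using n0 by (simp add: powr_minus_divide powr_half_sqrt)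
      finally have e: "real n powr (- 3 / 2) = 1 / real n * (1 / sqrt n)" .
      show ?thesis unfolding log_weight_def u_def e by simp
    qed
    have w4: "log_weight \<delta> n * (h n / sqrt n) = \<sigma> * (u \<delta> n + \<ell> (real n) powr (- 3 / 2) / real n)"
    proof -
      have "h n / sqrt n = \<sigma> * (1 / sqrt n + \<ell> (real n) powr (- (3 / 2 + \<delta>)))"
        using n0 by (simp add: h_def field_simps)
      then have "log_weight \<delta> n * (h n / sqrt n) = \<sigma> * (log_weight \<delta> n / sqrt n + log_weight \<delta> n * \<ell> (real n) powr (- (3 / 2 + \<delta>)))"
        by (simp add: algebra_simps)
      also have "log_weight \<delta> n * \<ell> (real n) powr (- (3 / 2 + \<delta>)) = (\<ell> (real n) powr \<delta> * \<ell> (real n) powr (- (3 / 2 + \<delta>))) / real n"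
        by (simp add: log_weight_def)
      also have "\<ell> (real n) powr \<delta> * \<ell> (real n) powr (- (3 / 2 + \<delta>)) = \<ell> (real n) powr (- 3 / 2)"
        by (simp flip: powr_add)
      finally show ?thesis unfolding w3 .
    qed
    have w5: "log_weight \<delta> n * (1 / h n) \<le> u (3 / 2 + 2 * \<delta>) n / \<sigma>"
    proof -
      have "0 < \<sigma> * (sqrt n * \<ell> (real n) powr (- (3 / 2 + \<delta>)))"
        by (rule mult_pos_pos[OF \<sigma> pos])
      moreover have "\<sigma> * (sqrt n * \<ell> (real n) powr (- (3 / 2 + \<delta>))) \<le> h n"
        using \<sigma> unfolding h_def by (intro mult_left_mono) auto
      ultimately have "1 / h n \<le> 1 / (\<sigma> * (sqrt n * \<ell> (real n) powr (- (3 / 2 + \<delta>))))"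
        by (intro frac_le order_refl zero_le_one)
      also have "\<dots> = \<ell> (real n) powr (3 / 2 + \<delta>) / sqrt n / \<sigma>"
        by (simp add: powr_minus field_simps)
      finally have "log_weight \<delta> n * (1 / h n) \<le> log_weight \<delta> n * (\<ell> (real n) powr (3 / 2 + \<delta>) / sqrt n / \<sigma>)"
        by (intro mult_left_mono log_weight_nonneg)
      also have "\<dots> = (log_weight \<delta> n / sqrt n) * \<ell> (real n) powr (3 / 2 + \<delta>) / \<sigma>" by simp
      also have "(log_weight \<delta> n / sqrt n) * \<ell> (real n) powr (3 / 2 + \<delta>) = (\<ell> (real n) powr \<delta> * \<ell> (real n) powr (3 / 2 + \<delta>)) * real n powr (- 3 / 2)"
        unfolding w3 by (simp add: u_def)
      also have "\<ell> (real n) powr \<delta> * \<ell> (real n) powr (3 / 2 + \<delta>) = \<ell> (real n) powr (3 / 2 + 2 * \<delta>)"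
        by (simp add: add_ac flip: powr_add)
      finally show ?thesis by (simp add: u_def)
    qed
    have "log_weight \<delta> n * \<bar>prob {\<omega> \<in> space M. (\<Sum>k=1..n. Xs k \<omega>) \<le> x} - \<Phi> (x / (\<sigma> * sqrt n))\<bar> \<le>
      log_weight \<delta> n * (real n * e0 n + 2 / \<sigma> * (sqrt n * e1 n) + 4 / \<sigma>\<^sup>2 * e2 n
      + 12 / \<sigma> * (h n / sqrt n) + 8 / \<sigma>\<^sup>2 * ((4 * e3 n + c) / h n))"
      by (intro mult_left_mono bound log_weight_nonneg)
    also have "\<dots> = (log_weight \<delta> n * real n) * e0 n + 2 / \<sigma> * ((log_weight \<delta> n * sqrt n) * e1 n) + 4 / \<sigma>\<^sup>2 * (log_weight \<delta> n * e2 n)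
      + 12 / \<sigma> * (log_weight \<delta> n * (h n / sqrt n)) + 8 / \<sigma>\<^sup>2 * ((4 * e3 n + c) * (log_weight \<delta> n * (1 / h n)))"
      by (simp add: algebra_simps add_divide_distrib)
    also have "\<dots> \<le> (log_weight \<delta> n * real n) * e0 n + 2 / \<sigma> * ((log_weight \<delta> n * sqrt n) * e1 n) + 4 / \<sigma>\<^sup>2 * (log_weight \<delta> n * e2 n)
      + 12 / \<sigma> * (log_weight \<delta> n * (h n / sqrt n)) + 8 / \<sigma>\<^sup>2 * ((4 * e3 n + c) * (u (3 / 2 + 2 * \<delta>) n / \<sigma>))"
      using w5 e3[of n] c by (intro add_left_mono mult_left_mono) auto
    also have "\<dots> = C n"
    proof -
      have "8 / \<sigma>\<^sup>2 * ((4 * e3 n + c) * (u (3 / 2 + 2 * \<delta>) n / \<sigma>)) = 8 / \<sigma> ^ 3 * (4 * (u (3 / 2 + 2 * \<delta>) n * e3 n) + c * u (3 / 2 + 2 * \<delta>) n)"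
        using \<sigma> by (simp add: power3_eq_cube power2_eq_square field_simps)
      moreover have "12 / \<sigma> * (\<sigma> * (u \<delta> n + \<ell> (real n) powr (- 3 / 2) / real n)) = 12 * (u \<delta> n + \<ell> (real n) powr (- 3 / 2) / real n)"
        using \<sigma> by simp
      ultimately show ?thesis unfolding w1 w2 w4 C_def by (simp only: log_weight_def)
    qed
    finally show ?thesis .
  qed
  ultimately show ?thesis using that by blast
qed

lemma std_normal_two_sided_tail:
  assumes "0 < t"
  shows "measure \<nu> {z. t \<le> \<bar>z\<bar>} = 2 * \<Phi> (- t)"
proof -
  have "distributed \<nu> lborel (\<lambda>x. x) std_normal_density"
    unfolding distributed_def by (auto simp: distr_id2)
  from std_normal.normal_density_affine[OF this, of "-1" 0]
  have "distr \<nu> lborel (\<lambda>z. - z) = \<nu>"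
    unfolding distributed_def by auto
  then have "measure \<nu> {..- t} = measure (distr \<nu> lborel (\<lambda>z. - z)) {..- t}" by simp
  also have "\<dots> = measure \<nu> ((\<lambda>z. - z) -` {..- t} \<inter> space \<nu>)"
    by (rule measure_distr) auto
  also have "(\<lambda>z. - z) -` {..- t} \<inter> space \<nu> = {t..}" by auto
  finally have "measure \<nu> {t..} = \<Phi> (- t)" by (simp add: \<Phi>_def)
  moreover have "{z. t \<le> \<bar>z\<bar>} = {..- t} \<union> {t..}" by (auto simp: abs_if)
  moreover have "measure \<nu> ({..- t} \<union> {t..}) = measure \<nu> {..- t} + measure \<nu> {t..}"
    using assms by (intro std_normal.finite_measure_Union) auto
  ultimately show ?thesis by (simp add: \<Phi>_def)
qed

text \<open>For \<open>y > 0\<close> the event \<open>|S n| \<ge> y\<close> is the disjoint union of \<open>S n \<le> - y\<close> and \<open>- S n \<le> - y\<close>, so the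
one-sided result is applied to \<open>X\<close> and to \<open>- X\<close>.\<close>

lemma (in prob_space) summable_two_sided_normal_approximation:
  fixes Xs :: "nat \<Rightarrow> 'a \<Rightarrow> real" and X :: "'a \<Rightarrow> real"
  assumes Xm [measurable]: "X \<in> borel_measurable M"
    and ind: "indep_vars (\<lambda>_. borel) Xs {1..}"
    and dist: "\<And>k. k \<ge> 1 \<Longrightarrow> distr M borel (Xs k) = distr M borel X"
    and X1: "integrable M X" and EX: "expectation X = 0"
    and X2: "integrable M (\<lambda>\<omega>. (X \<omega>)\<^sup>2)" and VX: "expectation (\<lambda>\<omega>. (X \<omega>)\<^sup>2) = \<sigma>\<^sup>2" 
    and \<sigma>: "\<sigma> > 0" and \<delta>: "0 \<le> \<delta>" "\<delta> \<le> 1"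
    and XL: "integrable M (\<lambda>\<omega>. (X \<omega>)\<^sup>2 * \<ell> (1 + \<bar>X \<omega>\<bar>) powr (1 + 2 * \<delta>))"
  obtains C where "summable (\<lambda>i. C (Suc i))"
    and "\<And>n y. 1 \<le> n \<Longrightarrow> 0 < y \<Longrightarrow> log_weight \<delta> n * \<bar>prob {\<omega> \<in> space M. y \<le> \<bar>\<Sum>k=1..n. Xs k \<omega>\<bar>} 
          - measure \<nu> {z. y / (\<sigma> * sqrt n) \<le> \<bar>z\<bar>}\<bar> \<le> C n"
proof -
  have [measurable]: "Xs k \<in> borel_measurable M" if "1 \<le> k" for k
    using ind that by (auto simp: indep_vars_def)
  obtain C1 where C1: "summable (\<lambda>i. C1 (Suc i))"
    "\<And>n x. 1 \<le> n \<Longrightarrow> log_weight \<delta> n * \<bar>prob {\<omega> \<in> space M. (\<Sum>k=1..n. Xs k \<omega>) \<le> x} - \<Phi> (x / (\<sigma> * sqrt n))\<bar> \<le> C1 n"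
    using summable_normal_approximation[OF assms] by blast
  have neg: "distr M borel (\<lambda>\<omega>. - Xs k \<omega>) = distr M borel (\<lambda>\<omega>. - X \<omega>)" if k: "1 \<le> k" for k
  proof -
    have "distr M borel (\<lambda>\<omega>. - Xs k \<omega>) = distr (distr M borel (Xs k)) borel uminus"
      using k by (subst distr_distr) (auto simp: comp_def)
    also have "\<dots> = distr M borel (\<lambda>\<omega>. - X \<omega>)"
      unfolding dist[OF k] by (subst distr_distr) (auto simp: comp_def)
    finally show ?thesis .
  qed
  have negind: "indep_vars (\<lambda>_. borel) (\<lambda>k \<omega>. - Xs k \<omega>) {1..}"
    by (rule indep_vars_compose2[OF ind]) auto
  obtain C2 where C2: "summable (\<lambda>i. C2 (Suc i))"
    "\<And>n x. 1 \<le> n \<Longrightarrow> log_weight \<delta> n * \<bar>prob {\<omega> \<in> space M. (\<Sum>k=1..n. - Xs k \<omega>) \<le> x} - \<Phi> (x / (\<sigma> * sqrt n))\<bar> \<le> C2 n"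
    by (rule summable_normal_approximation[of "\<lambda>\<omega>. - X \<omega>" "\<lambda>k \<omega>. - Xs k \<omega>" \<sigma> \<delta>, OF _ negind neg])
      (use assms in auto)
  have "log_weight \<delta> n * \<bar>prob {\<omega> \<in> space M. y \<le> \<bar>\<Sum>k=1..n. Xs k \<omega>\<bar>} - measure \<nu> {z. y / (\<sigma> * sqrt n) \<le> \<bar>z\<bar>}\<bar> \<le> C1 n + C2 n"
    if n: "1 \<le> n" and y: "0 < y" for n y
  proof -
    let ?S = "\<lambda>\<omega>. \<Sum>k=1..n. Xs k \<omega>"
    let ?p1 = "prob {\<omega> \<in> space M. ?S \<omega> \<le> - y}" and ?p2 = "prob {\<omega> \<in> space M. (\<Sum>k=1..n. - Xs k \<omega>) \<le> - y}"
    let ?q = "\<Phi> (- y / (\<sigma> * sqrt n))"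
    have "{\<omega> \<in> space M. y \<le> \<bar>?S \<omega>\<bar>} = {\<omega> \<in> space M. ?S \<omega> \<le> - y} \<union> {\<omega> \<in> space M. (\<Sum>k=1..n. - Xs k \<omega>) \<le> - y}"
      by (auto simp: sum_negf abs_if)
    moreover have "prob \<dots> = ?p1 + ?p2"
      using y by (intro finite_measure_Union) (auto simp: sum_negf)
    ultimately have p: "prob {\<omega> \<in> space M. y \<le> \<bar>?S \<omega>\<bar>} = ?p1 + ?p2" by simp
    have q: "measure \<nu> {z. y / (\<sigma> * sqrt n) \<le> \<bar>z\<bar>} = ?q + ?q"
      using std_normal_two_sided_tail[of "y / (\<sigma> * sqrt n)"] y \<sigma> n by simp
    have "\<bar>?p1 + ?p2 - (?q + ?q)\<bar> \<le> \<bar>?p1 - ?q\<bar> + \<bar>?p2 - ?q\<bar>" by linarith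
    from mult_left_mono[OF this log_weight_nonneg[of \<delta> n]]
    show ?thesis unfolding p q using C1(2)[OF n, of "- y"] C2(2)[OF n, of "- y"] 
      by (simp add: distrib_left)
  qed
  then show ?thesis using that[of "\<lambda>n. C1 n + C2 n"] summable_add[OF C1(1) C2(1)] by blast
qed

section \<open>The sum of the weights and the constant \<open>\<gamma>\<close>\<close>

lemma gamma_seq_eq: "gamma_seq \<delta> n = (\<Sum>j=1..n. log_weight \<delta> j) - \<ell> (real n) powr (\<delta> + 1) / (\<delta> + 1)"
  by (simp add: gamma_seq_def log_weight_def)

lemma ln_powr_over_antimono:
  fixes s t :: real
  assumes \<delta>: "0 \<le> \<delta>" "\<delta> \<le> 1" and s: "exp 1 \<le> s" "s \<le> t"
  shows "ln t powr \<delta> / t \<le> ln s powr \<delta> / s"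
proof -
  \<comment> \<open>Both factors are decreasing: the first because \<open>ln u / u\<close> decreases beyond \<open>exp 1\<close>, the second
    because \<open>\<delta> \<le> 1\<close>.\<close>
  have eq: "ln u powr \<delta> / u = (ln u / u) powr \<delta> * u powr (\<delta> - 1)" if "exp 1 \<le> u" for u :: real
  proof -
    have "(1::real) < exp 1" by simp
    then have u: "1 < u" using that by linarith
    then have "(ln u / u) powr \<delta> * u powr (\<delta> - 1) = ln u powr \<delta> / u powr \<delta> * (u powr \<delta> / u powr 1)"
      unfolding powr_diff by (simp add: powr_divide)
    then show ?thesis using u by simp
  qed
  have "(1::real) < exp 1" by simp
  then have s1: "1 < s" "1 < t" using s by linarith+
  have "(ln t / t) powr \<delta> * t powr (\<delta> - 1) \<le> (ln s / s) powr \<delta> * s powr (\<delta> - 1)"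
    using s1 s \<delta> by (intro mult_mono powr_mono2 powr_mono2' ln_x_over_x_mono) auto
  then show ?thesis using eq[of s] eq[of t] s by simp
qed

text \<open>By the mean value theorem the increment of \<open>ln powr (\<delta> + 1) / (\<delta> + 1)\<close> from \<open>n\<close> to \<open>n + 1\<close> lies between the
weights at \<open>n + 1\<close> and at \<open>n\<close>. The first claim makes \<open>\<gamma>\<close> decreasing, the second bounds it from below.
Both start at \<open>n = 3 > exp 1\<close>, where the truncation of the logarithm stops acting.\<close>

lemma gamma_seq_step:
  assumes \<delta>: "0 \<le> \<delta>" "\<delta> \<le> 1" and n: "3 \<le> n"
  shows "gamma_seq \<delta> (Suc n) \<le> gamma_seq \<delta> n"
    and "gamma_seq \<delta> n - log_weight \<delta> n \<le> gamma_seq \<delta> (Suc n) - log_weight \<delta> (Suc n)"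
proof -
  have e: "exp 1 < real n" using n e_less_272 by simp
  have l: "\<ell> (real n) = ln (real n)" "\<ell> (real (Suc n)) = ln (real (Suc n))"
    using e by (auto intro!: ell_eq_ln)
  have "\<exists>z>real n. z < real (Suc n) \<and> ln (real (Suc n)) powr (\<delta> + 1) / (\<delta> + 1) - ln (real n) powr (\<delta> + 1) / (\<delta> + 1)
     = (real (Suc n) - real n) * (ln z powr \<delta> / z)"
  proof (rule MVT2)
    fix z assume z: "real n \<le> z" "z \<le> real (Suc n)"
    have "(1::real) < exp 1" by simp
    then have z1: "1 < z" using z e by linarith
    then have "0 < ln z" "0 < z" by simp_all
    then have "((\<lambda>z. ln z powr (\<delta> + 1)) has_real_derivative (\<delta> + 1) * ln z powr (\<delta> + 1 - 1) * (1 / z)) (at z)"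
      by (intro DERIV_chain2[OF has_real_derivative_powr DERIV_ln_divide])
    from DERIV_cdivide[OF this, of "\<delta> + 1"]
    show "((\<lambda>z. ln z powr (\<delta> + 1) / (\<delta> + 1)) has_real_derivative ln z powr \<delta> / z) (at z)"
      using \<delta> by simp
  qed simp
  then obtain z where z: "real n < z" "z < real (Suc n)" and
    eq: "ln (real (Suc n)) powr (\<delta> + 1) / (\<delta> + 1) - ln (real n) powr (\<delta> + 1) / (\<delta> + 1) = ln z powr \<delta> / z"
    by auto
  have "ln z powr \<delta> / z \<le> log_weight \<delta> n" "log_weight \<delta> (Suc n) \<le> ln z powr \<delta> / z"
    unfolding log_weight_def l using z e \<delta> by (intro ln_powr_over_antimono; linarith)+
  moreover have "gamma_seq \<delta> (Suc n) = gamma_seq \<delta> n + log_weight \<delta> (Suc n) - ln z powr \<delta> / z"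
    unfolding gamma_seq_eq l eq[symmetric] by simp
  ultimately show "gamma_seq \<delta> (Suc n) \<le> gamma_seq \<delta> n"
    and "gamma_seq \<delta> n - log_weight \<delta> n \<le> gamma_seq \<delta> (Suc n) - log_weight \<delta> (Suc n)"
    by linarith+
qed

lemma convergent_gamma_seq:
  assumes \<delta>: "0 \<le> \<delta>" "\<delta> \<le> 1"
  shows "convergent (gamma_seq \<delta>)"
proof -
  let ?g = "\<lambda>n. gamma_seq \<delta> (n + 3)"
  have "decseq ?g"
  proof (rule decseq_SucI)
    show "?g (Suc n) \<le> ?g n" for n using gamma_seq_step(1)[OF \<delta>, of "n + 3"] by simp
  qed
  moreover have "gamma_seq \<delta> 3 - log_weight \<delta> 3 \<le> ?g n" for n
  proof -
    have "gamma_seq \<delta> 3 - log_weight \<delta> 3 \<le> ?g n - log_weight \<delta> (n + 3)"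
    proof (induction n)
      case (Suc n)
      then show ?case using gamma_seq_step(2)[OF \<delta>, of "n + 3"] by simp
    qed simp
    then show ?thesis using log_weight_nonneg[of \<delta> "n + 3"] by linarith
  qed
  ultimately obtain L where "?g \<longlonglongrightarrow> L" 
    using decseq_convergent[of ?g "gamma_seq \<delta> 3 - log_weight \<delta> 3"] by metis
  then have "convergent ?g" by (rule convergentI)
  then show ?thesis by (simp add: convergent_ignore_initial_segment)
qed

lemma gamma_seq_tendsto:
  assumes "0 \<le> \<delta>" "\<delta> \<le> 1"
  shows "gamma_seq \<delta> \<longlonglongrightarrow> gamma_const \<delta>"
  using convergent_gamma_seq[OF assms] by (simp add: convergent_LIMSEQ_iff gamma_const_def)

lemma log_weight_tendsto_0:
  assumes "0 \<le> \<delta>" "\<delta> \<le> 1"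
  shows "log_weight \<delta> \<longlonglongrightarrow> 0"
proof (rule tendsto_sandwich)
  show "\<forall>\<^sub>F n in sequentially. 0 \<le> log_weight \<delta> n" by (simp add: log_weight_nonneg)
  show "\<forall>\<^sub>F n in sequentially. log_weight \<delta> n \<le> 2 / sqrt (real n)"
    using eventually_ge_at_top[of 1]
  proof eventually_elim
    case (elim n)
    have "\<ell> (real n) powr \<delta> \<le> \<ell> (real n) powr 1"
      using assms ell_ge_1[of "real n"] by (intro powr_mono) auto
    also have "\<dots> \<le> 2 * sqrt (real n)" using elim ell_le_two_sqrt[of "real n"] by (simp add: less_imp_le)
    finally have "log_weight \<delta> n \<le> 2 * sqrt (real n) / real n"
      unfolding log_weight_def by (intro divide_right_mono) auto
    also have "\<dots> = 2 / sqrt (real n)" using elim by (simp add: real_div_sqrt field_simps)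
    finally show ?case .
  qed
  show "(\<lambda>n. 2 / sqrt (real n)) \<longlonglongrightarrow> 0" by real_asymp
qed simp

text \<open>The sum is written as a series over all indices, so that measurability and termwise integration
are immediate.\<close>

definition weight_sum :: "real \<Rightarrow> real \<Rightarrow> real" where
  "weight_sum \<delta> y = (\<Sum>i. log_weight \<delta> (Suc i) * indicator {\<ell> (real (Suc i))..} y)"

lemma weight_sum_measurable [measurable]: "weight_sum \<delta> \<in> borel_measurable borel"
  unfolding weight_sum_def[abs_def] by measurable

lemma ell_le_iff:
  assumes "1 \<le> y"
  shows "\<ell> (real n) \<le> y \<longleftrightarrow> n \<le> nat \<lfloor>exp y\<rfloor>"
proof -
  have "\<ell> (real n) \<le> y \<longleftrightarrow> exp (\<ell> (real n)) \<le> exp y" by simp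
  also have "exp (\<ell> (real n)) = max (real n) (exp 1)"
    unfolding trunc_log_def by (rule exp_ln[OF max_exp_pos])
  also have "max (real n) (exp 1) \<le> exp y \<longleftrightarrow> real n \<le> exp y" using assms by simp
  also have "\<dots> \<longleftrightarrow> n \<le> nat \<lfloor>exp y\<rfloor>" by (simp add: le_nat_iff le_floor_iff)
  finally show ?thesis .
qed

lemma weight_sums:
  "(\<lambda>i. log_weight \<delta> (Suc i) * indicator {\<ell> (real (Suc i))..} y) sums weight_sum \<delta> y"
proof -
  have "log_weight \<delta> (Suc i) * indicator {\<ell> (real (Suc i))..} y = 0" if "i \<notin> {..<nat \<lfloor>exp y\<rfloor>}" for i
  proof (cases "1 \<le> y")
    case True
    then show ?thesis using that ell_le_iff[of y "Suc i"] by (simp add: not_less Suc_le_eq)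
  next
    case False
    then show ?thesis using ell_ge_1[of "real (Suc i)"] by (simp add: not_le)
  qed
  then have "summable (\<lambda>i. log_weight \<delta> (Suc i) * indicator {\<ell> (real (Suc i))..} y)"
    by (intro summable_finite[of "{..<nat \<lfloor>exp y\<rfloor>}"]) auto
  then show ?thesis unfolding weight_sum_def by (rule summable_sums)
qed

lemma weight_sum_eq_0: "y < 1 \<Longrightarrow> weight_sum \<delta> y = 0"
proof -
  assume "y < 1"
  then have "indicator {\<ell> (real (Suc i))..} y = (0::real)" for i
    using ell_ge_1[of "real (Suc i)"] by simp
  then show ?thesis by (simp add: weight_sum_def)
qed

lemma weight_sum_eq:
  assumes "1 \<le> y"
  shows "weight_sum \<delta> y = (\<Sum>j=1..nat \<lfloor>exp y\<rfloor>. log_weight \<delta> j)"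
proof -
  have "weight_sum \<delta> y = (\<Sum>i<nat \<lfloor>exp y\<rfloor>. log_weight \<delta> (Suc i) * indicator {\<ell> (real (Suc i))..} y)"
    unfolding weight_sum_def
  proof (rule suminf_finite)
    fix i assume "i \<notin> {..<nat \<lfloor>exp y\<rfloor>}"
    then show "log_weight \<delta> (Suc i) * indicator {\<ell> (real (Suc i))..} y = 0"
      using ell_le_iff[OF assms, of "Suc i"] by (simp add: not_less Suc_le_eq)
  qed simp
  also have "\<dots> = (\<Sum>i<nat \<lfloor>exp y\<rfloor>. log_weight \<delta> (Suc i))"
    using ell_le_iff[OF assms] by (intro sum.cong) (auto simp: indicator_def Suc_le_eq simp del: of_nat_Suc)
  finally show ?thesis unfolding One_nat_def sum.atLeast1_atMost_eq .
qed

definition weight_remainder :: "real \<Rightarrow> real \<Rightarrow> real" where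
  "weight_remainder \<delta> y = weight_sum \<delta> y - y powr (\<delta> + 1) / (\<delta> + 1)"

lemma weight_remainder_measurable [measurable]: "weight_remainder \<delta> \<in> borel_measurable borel"
  unfolding weight_remainder_def[abs_def] by measurable

text \<open>This is \<open>(\<ell>(n + 1) powr (\<delta> + 1) - \<ell>(n) powr (\<delta> + 1)) / (\<delta> + 1)\<close>, written so that its convergence
to \<open>0\<close> is visible.\<close>

definition ell_gap :: "real \<Rightarrow> nat \<Rightarrow> real" where
  "ell_gap \<delta> n = log_weight \<delta> (Suc n) - (gamma_seq \<delta> (Suc n) - gamma_seq \<delta> n)"

lemma ell_gap_tendsto_0:
  assumes \<delta>: "0 \<le> \<delta>" "\<delta> \<le> 1"
  shows "ell_gap \<delta> \<longlonglongrightarrow> 0"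
proof -
  have "(\<lambda>n. log_weight \<delta> (Suc n) - (gamma_seq \<delta> (Suc n) - gamma_seq \<delta> n)) \<longlonglongrightarrow> 0 - (gamma_const \<delta> - gamma_const \<delta>)"
    by (intro tendsto_diff LIMSEQ_Suc log_weight_tendsto_0 gamma_seq_tendsto \<delta>)
  then show ?thesis by (simp add: ell_gap_def[abs_def])
qed

text \<open>For \<open>m = \<lfloor>exp y\<rfloor>\<close> the weights counted by \<open>weight_sum\<close> are those of \<open>1, \<dots>, m\<close>, and \<open>y\<close> lies between \<open>\<ell> m\<close>
and \<open>\<ell> (m + 1)\<close>.\<close>

lemma weight_remainder_close:
  assumes \<delta>: "0 \<le> \<delta>" "\<delta> \<le> 1" and y: "1 \<le> y"
  shows "\<bar>weight_remainder \<delta> y - gamma_seq \<delta> (nat \<lfloor>exp y\<rfloor>)\<bar> \<le> ell_gap \<delta> (nat \<lfloor>exp y\<rfloor>)"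
proof -
  define m where "m = nat \<lfloor>exp y\<rfloor>"
  have ey: "\<ell> (exp y) = y" using y by (simp add: ell_eq_ln)
  have m: "real m \<le> exp y" "exp y \<le> real (Suc m)" unfolding m_def by (simp_all add: of_nat_nat) linarith
  have "\<ell> (real m) \<le> y" "y \<le> \<ell> (real (Suc m))"
    using ell_mono[OF m(1)] ell_mono[OF m(2)] by (simp_all add: ey)
  then have "\<ell> (real m) powr (\<delta> + 1) \<le> y powr (\<delta> + 1)" "y powr (\<delta> + 1) \<le> \<ell> (real (Suc m)) powr (\<delta> + 1)"
    using \<delta> y by (auto intro!: powr_mono2 simp: less_imp_le simp del: of_nat_Suc)
  then have p: "\<ell> (real m) powr (\<delta> + 1) / (\<delta> + 1) \<le> y powr (\<delta> + 1) / (\<delta> + 1)" 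
     "y powr (\<delta> + 1) / (\<delta> + 1) \<le> \<ell> (real (Suc m)) powr (\<delta> + 1) / (\<delta> + 1)"
    using \<delta> by (auto intro!: divide_right_mono simp del: of_nat_Suc)
  have g: "ell_gap \<delta> m = \<ell> (real (Suc m)) powr (\<delta> + 1) / (\<delta> + 1) - \<ell> (real m) powr (\<delta> + 1) / (\<delta> + 1)"
    by (simp add: ell_gap_def gamma_seq_eq)
  have "weight_remainder \<delta> y - gamma_seq \<delta> m = \<ell> (real m) powr (\<delta> + 1) / (\<delta> + 1) - y powr (\<delta> + 1) / (\<delta> + 1)"
    unfolding weight_remainder_def gamma_seq_eq weight_sum_eq[OF y] m_def by simp
  then show ?thesis unfolding m_def[symmetric] using p g by linarith
qed

lemma weight_remainder_tendsto:
  assumes \<delta>: "0 \<le> \<delta>" "\<delta> \<le> 1"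
  shows "(weight_remainder \<delta> \<longlongrightarrow> gamma_const \<delta>) at_top"
proof -
  have m: "filterlim (\<lambda>y::real. nat \<lfloor>exp y\<rfloor>) sequentially at_top"
    by (intro filterlim_compose[OF filterlim_nat_sequentially] filterlim_compose[OF filterlim_floor_sequentially] exp_at_top)
  have "((\<lambda>y. weight_remainder \<delta> y - gamma_seq \<delta> (nat \<lfloor>exp y\<rfloor>)) \<longlongrightarrow> 0) at_top"
    by (rule tendsto_rabs_zero_cancel, rule Lim_null_comparison[OF _ filterlim_compose[OF ell_gap_tendsto_0[OF \<delta>] m]])
      (use weight_remainder_close[OF \<delta>] in \<open>auto intro!: eventually_at_top_linorderI[of 1]\<close>)
  from tendsto_add[OF this filterlim_compose[OF gamma_seq_tendsto[OF \<delta>] m]]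
  show ?thesis by simp
qed

lemma weight_remainder_bounded:
  assumes \<delta>: "0 \<le> \<delta>" "\<delta> \<le> 1"
  obtains c where "\<And>y. 0 \<le> y \<Longrightarrow> \<bar>weight_remainder \<delta> y\<bar> \<le> c"
proof -
  have "Bseq (gamma_seq \<delta>)" "Bseq (ell_gap \<delta>)"
    using gamma_seq_tendsto[OF \<delta>] ell_gap_tendsto_0[OF \<delta>] by (auto intro: convergent_imp_Bseq convergentI)
  then obtain a b where a: "\<And>n. \<bar>gamma_seq \<delta> n\<bar> \<le> a" and b: "\<And>n. \<bar>ell_gap \<delta> n\<bar> \<le> b"
    unfolding Bseq_def by auto
  have "0 \<le> a" "0 \<le> b" using a[of 0] b[of 0] by linarith+
  have "\<bar>weight_remainder \<delta> y\<bar> \<le> a + b + 1" if y: "0 \<le> y" for y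
  proof (cases "1 \<le> y")
    case True
    then show ?thesis 
      using weight_remainder_close[OF \<delta> True] a[of "nat \<lfloor>exp y\<rfloor>"] b[of "nat \<lfloor>exp y\<rfloor>"] by linarith
  next
    case False
    then have "weight_remainder \<delta> y = - (y powr (\<delta> + 1) / (\<delta> + 1))"
      by (simp add: weight_remainder_def weight_sum_eq_0)
    moreover have "y powr (\<delta> + 1) / (\<delta> + 1) \<le> 1 / 1"
      using False y \<delta> powr_mono2[of "\<delta> + 1" y 1] by (intro frac_le) auto
    moreover have "0 \<le> y powr (\<delta> + 1) / (\<delta> + 1)" using \<delta> by simp
    ultimately show ?thesis using \<open>0 \<le> a\<close> \<open>0 \<le> b\<close> by linarith
  qed
  then show ?thesis using that by blast
qed

section \<open>The Gaussian series\<close>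

lemma integrable_std_normal_abs_powr:
  assumes "0 \<le> p" "p \<le> 4"
  shows "integrable \<nu> (\<lambda>z. \<bar>z\<bar> powr p)"
proof (rule Bochner_Integration.integrable_bound)
  show "integrable \<nu> (\<lambda>z. 1 + \<bar>z\<bar> ^ 4)" using integrable_std_normal_abs_power[of 4] by auto
  show "AE z in \<nu>. norm (\<bar>z\<bar> powr p) \<le> norm (1 + \<bar>z\<bar> ^ 4)"
  proof (rule AE_I2)
    fix z :: real
    have "\<bar>z\<bar> powr p \<le> 1 + \<bar>z\<bar> ^ 4"
    proof (cases "\<bar>z\<bar> \<le> 1")
      case True
      then have "\<bar>z\<bar> powr p \<le> 1" using assms powr_mono2[of p "\<bar>z\<bar>" 1] by simp
      then show ?thesis by (intro order_trans[OF _ le_add_same_cancel1[THEN iffD2]]) auto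
    next
      case False
      then have "\<bar>z\<bar> powr p \<le> \<bar>z\<bar> powr (real 4)" using assms by (intro powr_mono) auto
      also have "\<dots> = \<bar>z\<bar> ^ 4" using False by (intro powr_realpow) auto
      finally show ?thesis by simp
    qed
    then show "norm (\<bar>z\<bar> powr p) \<le> norm (1 + \<bar>z\<bar> ^ 4)" by simp
  qed
qed simp

lemma std_normal_AE_nonzero: "AE z in \<nu>. z \<noteq> 0"
  by (simp add: AE_density) (use AE_lborel_singleton[of 0] in \<open>auto elim: eventually_mono\<close>)

lemma square_powr_eq:
  fixes t z :: real
  assumes "0 < t"
  shows "((t * z)\<^sup>2) powr (\<delta> + 1) = t powr (2 * \<delta> + 2) * \<bar>z\<bar> powr (2 * \<delta> + 2)"
proof -
  have "((t * z)\<^sup>2) powr (\<delta> + 1) = (\<bar>t * z\<bar> powr 2) powr (\<delta> + 1)"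
    by (cases "t * z = 0") (auto simp: powr_numeral)
  also have "\<dots> = \<bar>t * z\<bar> powr (2 * \<delta> + 2)" unfolding powr_powr by (simp add: distrib_left)
  also have "\<dots> = t powr (2 * \<delta> + 2) * \<bar>z\<bar> powr (2 * \<delta> + 2)"
    using assms by (simp add: abs_mult powr_mult)
  finally show ?thesis .
qed

text \<open>The condition \<open>\<surd>(\<ell> n) / t \<le> |z|\<close> says that \<open>n\<close> is counted by \<open>weight_sum\<close> at \<open>(t z)\<^sup>2\<close>. Summing under
the integral sign gives the expectation of \<open>weight_sum\<close>, whose leading power has an explicit
moment.\<close>

lemma weighted_normal_tail_sums:
  assumes \<delta>: "0 \<le> \<delta>" "\<delta> \<le> 1" and t: "0 < t"
  shows "(\<lambda>i. log_weight \<delta> (Suc i) * measure \<nu> {z. sqrt (\<ell> (real (Suc i))) / t \<le> \<bar>z\<bar>}) sums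
     ((\<integral>z. weight_remainder \<delta> ((t * z)\<^sup>2) \<partial>\<nu>) + (\<integral>z. \<bar>z\<bar> powr (2 * \<delta> + 2) \<partial>\<nu>) / (\<delta> + 1) * t powr (2 * \<delta> + 2))"
proof -
  obtain c where c: "\<And>y. 0 \<le> y \<Longrightarrow> \<bar>weight_remainder \<delta> y\<bar> \<le> c"
    using weight_remainder_bounded[OF \<delta>] by blast
  have int_r: "integrable \<nu> (\<lambda>z. weight_remainder \<delta> ((t * z)\<^sup>2))"
    by (rule std_normal.integrable_const_bound[where B = c]) (auto simp: c)
  have int_p: "integrable \<nu> (\<lambda>z. \<bar>z\<bar> powr (2 * \<delta> + 2))"
    using \<delta> by (intro integrable_std_normal_abs_powr) auto
  have split: "weight_sum \<delta> ((t * z)\<^sup>2) = weight_remainder \<delta> ((t * z)\<^sup>2) + t powr (2 * \<delta> + 2) / (\<delta> + 1) * \<bar>z\<bar> powr (2 * \<delta> + 2)" for z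
    by (simp add: weight_remainder_def square_powr_eq[OF t])
  have int_w: "integrable \<nu> (\<lambda>z. weight_sum \<delta> ((t * z)\<^sup>2))"
    unfolding split using int_r int_p by auto
  have w_eq: "(\<integral>z. weight_sum \<delta> ((t * z)\<^sup>2) \<partial>\<nu>) = 
     (\<integral>z. weight_remainder \<delta> ((t * z)\<^sup>2) \<partial>\<nu>) + (\<integral>z. \<bar>z\<bar> powr (2 * \<delta> + 2) \<partial>\<nu>) / (\<delta> + 1) * t powr (2 * \<delta> + 2)"
    unfolding split using int_r int_p by simp
  let ?f = "\<lambda>i z. log_weight \<delta> (Suc i) * indicator {\<ell> (real (Suc i))..} ((t * z)\<^sup>2)"
  have "(\<lambda>N. \<integral>z. (\<Sum>i<N. ?f i z) \<partial>\<nu>) \<longlonglongrightarrow> (\<integral>z. weight_sum \<delta> ((t * z)\<^sup>2) \<partial>\<nu>)"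
  proof (rule integral_dominated_convergence[OF _ _ int_w])
    show "AE z in \<nu>. (\<lambda>N. \<Sum>i<N. ?f i z) \<longlonglongrightarrow> weight_sum \<delta> ((t * z)\<^sup>2)"
      using weight_sums[of \<delta>] by (simp add: sums_def)
    show "AE z in \<nu>. norm (\<Sum>i<N. ?f i z) \<le> weight_sum \<delta> ((t * z)\<^sup>2)" for N
    proof (rule AE_I2)
      fix z
      have "(\<Sum>i<N. ?f i z) \<le> weight_sum \<delta> ((t * z)\<^sup>2)"
        unfolding weight_sum_def
        by (rule sum_le_suminf) (use sums_summable[OF weight_sums] log_weight_nonneg in auto)
      moreover have "0 \<le> (\<Sum>i<N. ?f i z)" by (intro sum_nonneg) (auto simp: log_weight_nonneg)
      ultimately show "norm (\<Sum>i<N. ?f i z) \<le> weight_sum \<delta> ((t * z)\<^sup>2)" by simp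
    qed
  qed measurable
  also have "(\<lambda>N. \<integral>z. (\<Sum>i<N. ?f i z) \<partial>\<nu>) = (\<lambda>N. \<Sum>i<N. log_weight \<delta> (Suc i) * measure \<nu> {z. sqrt (\<ell> (real (Suc i))) / t \<le> \<bar>z\<bar>})"
  proof
    fix N
    have f_eq: "?f i z = log_weight \<delta> (Suc i) * indicator {z. sqrt (\<ell> (real (Suc i))) / t \<le> \<bar>z\<bar>} z" for i z
    proof -
      have "\<ell> (real (Suc i)) \<le> (t * z)\<^sup>2 \<longleftrightarrow> sqrt (\<ell> (real (Suc i))) \<le> \<bar>t * z\<bar>"
        using real_sqrt_le_iff[of "\<ell> (real (Suc i))" "(t * z)\<^sup>2"] by simp
      also have "\<dots> \<longleftrightarrow> sqrt (\<ell> (real (Suc i))) / t \<le> \<bar>z\<bar>"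
        using t by (simp add: abs_mult field_simps)
      finally show ?thesis by (simp add: indicator_def)
    qed
    have A: "{z. sqrt (\<ell> (real (Suc i))) / t \<le> \<bar>z\<bar>} \<in> sets \<nu>" for i by measurable
    have "(\<integral>z. (\<Sum>i<N. ?f i z) \<partial>\<nu>) = (\<Sum>i<N. \<integral>z. ?f i z \<partial>\<nu>)"
      unfolding f_eq
      by (intro Bochner_Integration.integral_sum integrable_mult_right std_normal.integrable_const_bound[where B = 1])
        (use A in auto)
    also have "\<dots> = (\<Sum>i<N. log_weight \<delta> (Suc i) * measure \<nu> {z. sqrt (\<ell> (real (Suc i))) / t \<le> \<bar>z\<bar>})"
      unfolding f_eq using A by simp
    finally show "(\<integral>z. (\<Sum>i<N. ?f i z) \<partial>\<nu>) = \<dots>" .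
  qed
  finally show ?thesis unfolding sums_def w_eq .
qed

text \<open>For \<open>z \<noteq> 0\<close> the argument of the bounded remainder tends to infinity as \<open>\<epsilon>\<close> decreases to \<open>0\<close>.\<close>

lemma expectation_weight_remainder_tendsto:
  assumes \<delta>: "0 \<le> \<delta>" "\<delta> \<le> 1" and \<sigma>: "0 < \<sigma>"
  shows "((\<lambda>\<epsilon>. \<integral>z. weight_remainder \<delta> ((\<sigma> / \<epsilon> * z)\<^sup>2) \<partial>\<nu>) \<longlongrightarrow> gamma_const \<delta>) (at_right 0)"
  unfolding filterlim_at_right_to_top
proof -
  obtain c where c: "\<And>y. 0 \<le> y \<Longrightarrow> \<bar>weight_remainder \<delta> y\<bar> \<le> c"
    using weight_remainder_bounded[OF \<delta>] by blast
  have "((\<lambda>x. \<integral>z. weight_remainder \<delta> ((\<sigma> / inverse x * z)\<^sup>2) \<partial>\<nu>) \<longlongrightarrow> (\<integral>z. gamma_const \<delta> \<partial>\<nu>)) at_top"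
  proof (rule integral_dominated_convergence_at_top[where w = "\<lambda>_. c"])
    show "AE z in \<nu>. ((\<lambda>x. weight_remainder \<delta> ((\<sigma> / inverse x * z)\<^sup>2)) \<longlongrightarrow> gamma_const \<delta>) at_top"
      using std_normal_AE_nonzero
    proof eventually_elim
      case (elim z)
      have "filterlim (\<lambda>x. (\<sigma> * z)\<^sup>2 * x\<^sup>2) at_top at_top"
        using elim \<sigma> by (intro filterlim_tendsto_pos_mult_at_top[OF tendsto_const]
          filterlim_pow_at_top filterlim_ident) auto
      then have "filterlim (\<lambda>x. (\<sigma> / inverse x * z)\<^sup>2) at_top at_top"
        by (simp add: power_mult_distrib divide_inverse ac_simps)
      then show ?case by (rule filterlim_compose[OF weight_remainder_tendsto[OF \<delta>]])
    qed
    show "\<forall>\<^sub>F x in at_top. AE z in \<nu>. norm (weight_remainder \<delta> ((\<sigma> / inverse x * z)\<^sup>2)) \<le> c"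
      by (simp add: c)
  qed auto
  then show "((\<lambda>x. \<integral>z. weight_remainder \<delta> ((\<sigma> / inverse x * z)\<^sup>2) \<partial>\<nu>) \<longlongrightarrow> gamma_const \<delta>) at_top"
    using std_normal.prob_space by simp
qed

section \<open>The limit\<close>

lemma (in prob_space) prob_abs_ge_tendsto:
  fixes Z :: "'a \<Rightarrow> real"
  assumes [measurable]: "Z \<in> borel_measurable M" and a: "0 < a"
  shows "((\<lambda>\<epsilon>. prob {\<omega> \<in> space M. \<epsilon> * a \<le> \<bar>Z \<omega>\<bar>}) \<longlongrightarrow> 1 - prob {\<omega> \<in> space M. Z \<omega> = 0}) (at_right 0)"
  unfolding filterlim_at_right_to_top
proof -
  let ?A = "\<lambda>x. {\<omega> \<in> space M. inverse x * a \<le> \<bar>Z \<omega>\<bar>}" and ?B = "{\<omega> \<in> space M. Z \<omega> \<noteq> 0}"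
  have "((\<lambda>x. expectation (indicator (?A x))) \<longlongrightarrow> expectation (indicator ?B :: 'a \<Rightarrow> real)) at_top"
  proof (rule integral_dominated_convergence_at_top[where w = "\<lambda>_. 1"])
    show "AE \<omega> in M. ((\<lambda>x. indicator (?A x) \<omega>) \<longlongrightarrow> (indicator ?B \<omega> :: real)) at_top"
    proof (rule AE_I2)
      fix \<omega> assume \<omega>: "\<omega> \<in> space M"
      have "\<forall>\<^sub>F x in at_top. indicator (?A x) \<omega> = (indicator ?B \<omega> :: real)"
      proof (cases "Z \<omega> = 0")
        case True
        show ?thesis using eventually_gt_at_top[of 0]
        proof eventually_elim
          case (elim x)
          then have "0 < inverse x * a" using a by simp
          then show ?case using True by (simp add: not_le)
        qed
      next
        case False
        show ?thesis using eventually_ge_at_top[of "a / \<bar>Z \<omega>\<bar>"]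
        proof eventually_elim
          case (elim x)
          have "0 < a / \<bar>Z \<omega>\<bar>" using a False by simp
          then have "0 < x" using elim by linarith
          then have "inverse x * a \<le> \<bar>Z \<omega>\<bar>" using elim False by (simp add: field_simps)
          then show ?case using \<omega> False by simp
        qed
      qed
      then show "((\<lambda>x. indicator (?A x) \<omega>) \<longlongrightarrow> (indicator ?B \<omega> :: real)) at_top"
        by (rule tendsto_eventually)
    qed
  qed auto
  moreover have "expectation (indicator (?A x)) = prob (?A x)" for x by simp
  moreover have "expectation (indicator ?B) = prob ?B" by simp
  moreover have "prob ?B = 1 - prob {\<omega> \<in> space M. Z \<omega> = 0}" by (rule prob_neg) measurable
  ultimately show "((\<lambda>x. prob (?A x)) \<longlongrightarrow> 1 - prob {\<omega> \<in> space M. Z \<omega> = 0}) at_top" by simp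
qed

text \<open>The truncated logarithm grows more slowly than every power; the exponent \<open>p\<close> is chosen such that
\<open>\<ell>(y) powr (1 + 2 \<delta>)\<close> is at most a multiple of \<open>y powr \<delta>\<close>.\<close>

lemma integrable_ell_weighted_square:
  fixes X :: "'a \<Rightarrow> real"
  assumes Xm [measurable]: "X \<in> borel_measurable M" and \<delta>: "0 < \<delta>" "\<delta> \<le> 1"
    and X2: "integrable M (\<lambda>\<omega>. (X \<omega>)\<^sup>2)"
    and X2\<delta>: "integrable M (\<lambda>\<omega>. \<bar>X \<omega>\<bar> powr (2 + \<delta>))"
  shows "integrable M (\<lambda>\<omega>. (X \<omega>)\<^sup>2 * \<ell> (1 + \<bar>X \<omega>\<bar>) powr (1 + 2 * \<delta>))"
proof -
  define p where "p = \<delta> / (1 + 2 * \<delta>)"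
  have p: "0 < p" "p * (1 + 2 * \<delta>) = \<delta>" using \<delta> by (auto simp: p_def)
  define K where "K = (1 + 1 / p) powr (1 + 2 * \<delta>)"
  have K: "0 \<le> K" by (simp add: K_def)
  have ell_le: "\<ell> y powr (1 + 2 * \<delta>) \<le> K * y powr \<delta>" if y: "1 \<le> y" for y
  proof -
    have yp: "1 \<le> y powr p" using y p by (intro ge_one_powr_ge_zero) auto
    have "\<ell> y \<le> 1 + ln y" using ell_mult_le[OF y, of 1] by (simp add: ell_eq_1)
    also have "ln y = ln (y powr p) / p" using y p by (simp add: ln_powr)
    also have "1 + ln (y powr p) / p \<le> y powr p + y powr p / p"
    proof -
      have "0 < y powr p" using yp by linarith
      from ln_le_minus_one[OF this] have "ln (y powr p) \<le> y powr p" by linarith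
      then show ?thesis using p by (intro add_mono divide_right_mono yp) auto
    qed
    finally have "\<ell> y \<le> (1 + 1 / p) * y powr p" by (simp add: algebra_simps)
    then have "\<ell> y powr (1 + 2 * \<delta>) \<le> ((1 + 1 / p) * y powr p) powr (1 + 2 * \<delta>)"
      using \<delta> by (intro powr_mono2) (auto simp: less_imp_le)
    also have "\<dots> = K * y powr \<delta>"
      using p y by (simp add: powr_mult powr_powr K_def)
    finally show ?thesis .
  qed
  have bound: "x\<^sup>2 * \<ell> (1 + x) powr (1 + 2 * \<delta>) \<le> K * 2 * (x\<^sup>2 + x powr (2 + \<delta>))" if x: "0 \<le> x" for x
  proof -
    have "(1 + x) powr \<delta> \<le> (2 * max 1 x) powr \<delta>" using \<delta> x by (intro powr_mono2) auto
    also have "\<dots> = 2 powr \<delta> * max 1 x powr \<delta>" using x by (simp add: powr_mult)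
    also have "\<dots> \<le> 2 powr 1 * (1 + x powr \<delta>)"
      using \<delta> by (intro mult_mono powr_mono) (auto simp: max_def)
    finally have "(1 + x) powr \<delta> \<le> 2 * (1 + x powr \<delta>)" by simp
    then have "\<ell> (1 + x) powr (1 + 2 * \<delta>) \<le> K * (2 * (1 + x powr \<delta>))"
      using ell_le[of "1 + x"] x mult_left_mono[OF _ K] by (intro order_trans[OF ell_le]) auto
    then have "x\<^sup>2 * \<ell> (1 + x) powr (1 + 2 * \<delta>) \<le> x\<^sup>2 * (K * (2 * (1 + x powr \<delta>)))"
      by (rule mult_left_mono) simp
    also have "\<dots> = K * 2 * (x\<^sup>2 + x\<^sup>2 * x powr \<delta>)" by (simp add: algebra_simps)
    also have "x\<^sup>2 * x powr \<delta> = x powr (2 + \<delta>)"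
      using x by (cases "x = 0") (auto simp: powr_add powr_numeral)
    finally show ?thesis .
  qed
  show ?thesis
  proof (rule Bochner_Integration.integrable_bound)
    show "integrable M (\<lambda>\<omega>. K * 2 * ((X \<omega>)\<^sup>2 + \<bar>X \<omega>\<bar> powr (2 + \<delta>)))"
      using X2 X2\<delta> by auto
    show "AE \<omega> in M. norm ((X \<omega>)\<^sup>2 * \<ell> (1 + \<bar>X \<omega>\<bar>) powr (1 + 2 * \<delta>)) \<le> norm (K * 2 * ((X \<omega>)\<^sup>2 + \<bar>X \<omega>\<bar> powr (2 + \<delta>)))"
      using bound[OF abs_ge_zero] K by (intro AE_I2) (simp add: abs_mult)
  qed simp
qed

theorem theorem1p1:
  fixes M :: "'a measure" and X :: "'a \<Rightarrow> real" and Xs :: "nat \<Rightarrow> 'a \<Rightarrow> real"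
    and \<delta> \<sigma> :: real
  assumes "prob_space M"
    and "0 \<le> \<delta>" and "\<delta> \<le> 1"
    and "X \<in> borel_measurable M"
    and "prob_space.indep_vars M (\<lambda>_. borel) Xs {1..}"
    and "\<And>k. k \<ge> 1 \<Longrightarrow> distr M borel (Xs k) = distr M borel X"
    and "integrable M X" and "(\<integral>\<omega>. X \<omega> \<partial>M) = 0"
    and "integrable M (\<lambda>\<omega>. (X \<omega>)\<^sup>2)" and "(\<integral>\<omega>. (X \<omega>)\<^sup>2 \<partial>M) = \<sigma>\<^sup>2" and "\<sigma> > 0"
    and "0 < \<delta> \<Longrightarrow> integrable M (\<lambda>\<omega>. \<bar>X \<omega>\<bar> powr (2 + \<delta>))"
    and "\<delta> = 0 \<Longrightarrow> integrable M (\<lambda>\<omega>. \<bar>X \<omega>\<bar>\<^sup>2 * \<ell> (1 + \<bar>X \<omega>\<bar>))"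
  shows "convergent (gamma_seq \<delta>)
    \<and> summable (\<lambda>n. eta_term M Xs \<delta> (Suc n))
    \<and> (\<forall>\<epsilon>>0. summable (\<lambda>n. tail_term M Xs \<delta> \<epsilon> (Suc n)))
    \<and> ((\<lambda>\<epsilon>. (\<Sum>n. tail_term M Xs \<delta> \<epsilon> (Suc n))
          - (\<integral>x. \<bar>x\<bar> powr (2 * \<delta> + 2) \<partial>std_normal_distribution) / (\<delta> + 1)
            * \<sigma> powr (2 * \<delta> + 2) * \<epsilon> powr (- (2 * \<delta> + 2)))
        \<longlongrightarrow> gamma_const \<delta> - eta_const M Xs \<delta>) (at_right 0)"
proof -
  interpret prob_space M by fact
  note \<delta> = \<open>0 \<le> \<delta>\<close> \<open>\<delta> \<le> 1\<close> and \<sigma> = \<open>\<sigma> > 0\<close>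
  have XL: "integrable M (\<lambda>\<omega>. (X \<omega>)\<^sup>2 * \<ell> (1 + \<bar>X \<omega>\<bar>) powr (1 + 2 * \<delta>))"
  proof (cases "\<delta> = 0")
    case True
    then show ?thesis using assms(13) by (simp add: less_imp_le)
  next
    case False
    then show ?thesis using assms by (intro integrable_ell_weighted_square) auto
  qed
  obtain C where C: "summable (\<lambda>i. C (Suc i))"
    "\<And>n y. 1 \<le> n \<Longrightarrow> 0 < y \<Longrightarrow> log_weight \<delta> n * \<bar>prob {\<omega> \<in> space M. y \<le> \<bar>\<Sum>k=1..n. Xs k \<omega>\<bar>} 
          - measure \<nu> {z. y / (\<sigma> * sqrt n) \<le> \<bar>z\<bar>}\<bar> \<le> C n"
  proof (rule summable_two_sided_normal_approximation[OF assms(4,5) _ assms(7-11) \<delta> XL])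
    show "distr M borel (Xs k) = distr M borel X" if "1 \<le> k" for k
      using that by (rule assms(6))
  qed (rule that)
  define normal_term where "normal_term \<epsilon> n = log_weight \<delta> n * measure \<nu> {z. sqrt (\<ell> (real n)) / (\<sigma> / \<epsilon>) \<le> \<bar>z\<bar>}" for \<epsilon> n
  define d where "d i \<epsilon> = tail_term M Xs \<delta> \<epsilon> (Suc i) - normal_term \<epsilon> (Suc i)" for i \<epsilon>
  define r where "r \<epsilon> = (\<integral>z. weight_remainder \<delta> ((\<sigma> / \<epsilon> * z)\<^sup>2) \<partial>\<nu>)" for \<epsilon>
  define main where "main \<epsilon> = (\<integral>x. \<bar>x\<bar> powr (2 * \<delta> + 2) \<partial>\<nu>) / (\<delta> + 1) * \<sigma> powr (2 * \<delta> + 2) * \<epsilon> powr (- (2 * \<delta> + 2))" for \<epsilon>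

  have [measurable]: "Xs k \<in> borel_measurable M" if "1 \<le> k" for k
    using assms(5) that by (auto simp: indep_vars_def)
  have Sm [measurable]: "partial_sum Xs n \<in> borel_measurable M" for n
    unfolding partial_sum_def[abs_def] by measurable

  \<comment> \<open>The bound is uniform in \<open>\<epsilon>\<close>, as Tannery's theorem requires.\<close>
  have d_bound: "\<bar>d i \<epsilon>\<bar> \<le> C (Suc i)" if \<epsilon>: "0 < \<epsilon>" for i \<epsilon>
  proof -
    let ?n = "Suc i"
    let ?y = "\<epsilon> * sqrt (real ?n * \<ell> (real ?n))"
    have y: "0 < ?y" using \<epsilon> by (simp del: of_nat_Suc)
    have "?y / (\<sigma> * sqrt ?n) = sqrt (\<ell> (real ?n)) / (\<sigma> / \<epsilon>)"
      using \<sigma> \<epsilon> by (simp add: real_sqrt_mult del: of_nat_Suc)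
    then have "d i \<epsilon> = log_weight \<delta> ?n * (prob {\<omega> \<in> space M. ?y \<le> \<bar>\<Sum>k=1..?n. Xs k \<omega>\<bar>} 
          - measure \<nu> {z. ?y / (\<sigma> * sqrt ?n) \<le> \<bar>z\<bar>})"
      unfolding d_def normal_term_def tail_term_def log_weight_def partial_sum_def right_diff_distrib by simp
    then show ?thesis using C(2)[OF _ y, of ?n] by (simp add: abs_mult log_weight_nonneg del: of_nat_Suc)
  qed
  have d_lim: "(d i \<longlongrightarrow> - eta_term M Xs \<delta> (Suc i)) (at_right 0)" for i
  proof -
    let ?n = "Suc i"
    have a: "0 < sqrt (real ?n * \<ell> (real ?n))" by (simp del: of_nat_Suc)
    have b: "0 < sqrt (\<ell> (real ?n)) / \<sigma>" using \<sigma> by (simp del: of_nat_Suc)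
    have "AE z in \<nu>. \<not> (z = 0)" using std_normal_AE_nonzero .
    then have "measure \<nu> {z \<in> space \<nu>. z = 0} = 0"
      by (subst std_normal.prob_eq_0) auto
    then have "((\<lambda>\<epsilon>. measure \<nu> {z \<in> space \<nu>. \<epsilon> * (sqrt (\<ell> (real ?n)) / \<sigma>) \<le> \<bar>z\<bar>}) \<longlongrightarrow> 1) (at_right 0)"
      using std_normal.prob_abs_ge_tendsto[OF _ b, of "\<lambda>z. z"] by simp
    then have N: "((\<lambda>\<epsilon>. measure \<nu> {z. sqrt (\<ell> (real ?n)) / (\<sigma> / \<epsilon>) \<le> \<bar>z\<bar>}) \<longlongrightarrow> 1) (at_right 0)"
      by (simp add: ac_simps del: of_nat_Suc)
    have "(d i \<longlongrightarrow> log_weight \<delta> ?n * (1 - prob {\<omega> \<in> space M. partial_sum Xs ?n \<omega> = 0}) - log_weight \<delta> ?n * 1) (at_right 0)"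
      unfolding d_def normal_term_def tail_term_def log_weight_def
      by (intro tendsto_intros prob_abs_ge_tendsto[OF Sm a] N)
    then show ?thesis by (simp add: eta_term_def log_weight_def algebra_simps)
  qed
  have tannery: "(\<forall>\<^sub>F \<epsilon> in at_right 0. summable (\<lambda>i. norm (d i \<epsilon>))) \<and> summable (\<lambda>i. norm (- eta_term M Xs \<delta> (Suc i))) \<and>
      ((\<lambda>\<epsilon>. \<Sum>i. d i \<epsilon>) \<longlongrightarrow> (\<Sum>i. - eta_term M Xs \<delta> (Suc i))) (at_right 0)"
  proof (rule tannerys_theorem[OF d_lim _ C(1)])
    have "\<forall>\<^sub>F p in (at_top :: nat filter) \<times>\<^sub>F at_right (0 :: real). 0 < snd p"
      by (rule eventually_compose_filterlim[OF _ filterlim_snd]) (rule eventually_at_right_less)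
    then show "\<forall>\<^sub>F (k, n) in at_top \<times>\<^sub>F at_right 0. norm (d k n) \<le> C (Suc k)"
      by eventually_elim (auto simp: d_bound)
  qed simp
  have eta: "summable (\<lambda>n. eta_term M Xs \<delta> (Suc n))"
    using tannery by (auto intro: summable_norm_cancel)
  have normal: "(\<lambda>i. normal_term \<epsilon> (Suc i)) sums (r \<epsilon> + main \<epsilon>)" if \<epsilon>: "0 < \<epsilon>" for \<epsilon>
  proof -
    have "(\<sigma> / \<epsilon>) powr (2 * \<delta> + 2) = \<sigma> powr (2 * \<delta> + 2) * \<epsilon> powr (- (2 * \<delta> + 2))"
      using \<epsilon> \<sigma> by (simp only: powr_divide powr_minus_divide) simp
    then show ?thesis
      using weighted_normal_tail_sums[OF \<delta>, of "\<sigma> / \<epsilon>"] \<epsilon> \<sigma>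
      unfolding normal_term_def r_def main_def by (simp add: mult.assoc)
  qed
  have d_summable: "summable (\<lambda>i. d i \<epsilon>)" if "0 < \<epsilon>" for \<epsilon>
    by (rule summable_comparison_test'[OF C(1)]) (use d_bound[OF that] in simp)
  have tail: "(\<lambda>i. tail_term M Xs \<delta> \<epsilon> (Suc i)) sums ((\<Sum>i. d i \<epsilon>) + (r \<epsilon> + main \<epsilon>))" if \<epsilon>: "0 < \<epsilon>" for \<epsilon>
    using sums_add[OF summable_sums[OF d_summable[OF \<epsilon>]] normal[OF \<epsilon>]] by (simp add: d_def)
  have "((\<lambda>\<epsilon>. (\<Sum>i. d i \<epsilon>) + r \<epsilon>) \<longlongrightarrow> (\<Sum>i. - eta_term M Xs \<delta> (Suc i)) + gamma_const \<delta>) (at_right 0)"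
    unfolding r_def by (intro tendsto_add expectation_weight_remainder_tendsto \<delta> \<sigma>) (use tannery in blast)
  also have "(\<Sum>i. - eta_term M Xs \<delta> (Suc i)) + gamma_const \<delta> = gamma_const \<delta> - eta_const M Xs \<delta>"
    using suminf_minus[OF eta] by (simp add: eta_const_def)
  finally have "((\<lambda>\<epsilon>. (\<Sum>n. tail_term M Xs \<delta> \<epsilon> (Suc n)) - main \<epsilon>) \<longlongrightarrow> gamma_const \<delta> - eta_const M Xs \<delta>) (at_right 0)"
  proof (rule Lim_transform_eventually)
    show "\<forall>\<^sub>F \<epsilon> in at_right 0. (\<Sum>i. d i \<epsilon>) + r \<epsilon> = (\<Sum>n. tail_term M Xs \<delta> \<epsilon> (Suc n)) - main \<epsilon>"
      using eventually_at_right_less[of 0] 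
      by eventually_elim (simp add: sums_unique[OF tail, symmetric])
  qed
  then show ?thesis
    using convergent_gamma_seq[OF \<delta>] eta tail unfolding main_def by (auto intro: sums_summable)
qed

end
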